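(* Each of the following axioms and axiom schemas is computationally valid, i.e. valid in every computational interpretation (all terms are of appropriate sorts; $\mathsf{if}\,b\,\mathsf{then}\,x\,\mathsf{else}\,y$ is the conditional; $\mathsf{n},\mathsf{n}'$ are names; $\vec u,\vec v,\dots$ are finite sequences of terms). 1. (Refl, Sym, Trans) $\sim$ is reflexive, symmetric and transitive. 2. (Dup) $\vec u,t\sim\vec v,t'\Rightarrow \vec u,t,t\sim\vec v,t',t'$. 3. (Congr) $=$ is a congruence. 4. (Perm) For every permutation $\pi$ of $1,\dots,n$: $x_1,\dots,x_n\sim y_1,\dots,y_n\Rightarrow x_{\pi(1)},\dots,x_{\pi(n)}\sim y_{\pi(1)},\dots,y_{\pi(n)}$. 5. (FA) For every function symbol $f$: $\vec x,\vec y\sim\vec x',\vec y'\Rightarrow f(\vec x),\vec y\sim f(\vec x'),\vec y'$. 6. (Equations) $\mathsf{EQ}(x;x)=\mathsf{true}$; $\mathsf{if}\,\mathsf{true}\,\mathsf{then}\,x\,\mathsf{else}\,y=x$; $\mathsf{if}\,\mathsf{false}\,\mathsf{then}\,x\,\mathsf{else}\,y=y$; $\mathsf{if}\,b\,\mathsf{then}\,x\,\mathsf{else}\,x=x$; $\mathsf{if}\,b\,\mathsf{then}\,(\mathsf{if}\,b\,\mathsf{then}\,x\,\mathsf{else}\,y)\,\mathsf{else}\,z=\mathsf{if}\,b\,\mathsf{then}\,x\,\mathsf{else}\,z$; $\mathsf{if}\,b\,\mathsf{then}\,x\,\mathsf{else}\,(\mathsf{if}\,b\,\mathsf{then}\,y\,\mathsf{else}\,z)=\mathsf{if}\,b\,\mathsf{then}\,x\,\mathsf{else}\,z$;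 $\mathsf{if}\,b\,\mathsf{then}\,(\mathsf{if}\,a\,\mathsf{then}\,x\,\mathsf{else}\,y)\,\mathsf{else}\,z=\mathsf{if}\,a\,\mathsf{then}\,(\mathsf{if}\,b\,\mathsf{then}\,x\,\mathsf{else}\,z)\,\mathsf{else}\,(\mathsf{if}\,b\,\mathsf{then}\,y\,\mathsf{else}\,z)$; $\mathsf{if}\,b\,\mathsf{then}\,x\,\mathsf{else}\,(\mathsf{if}\,a\,\mathsf{then}\,y\,\mathsf{else}\,z)=\mathsf{if}\,a\,\mathsf{then}\,(\mathsf{if}\,b\,\mathsf{then}\,x\,\mathsf{else}\,y)\,\mathsf{else}\,(\mathsf{if}\,b\,\mathsf{then}\,x\,\mathsf{else}\,z)$; $f(\vec x,\mathsf{if}\,b\,\mathsf{then}\,y\,\mathsf{else}\,z,\vec w)=\mathsf{if}\,b\,\mathsf{then}\,f(\vec x,y,\vec w)\,\mathsf{else}\,f(\vec x,z,\vec w)$; $x\oplus y=y\oplus x$; $x\oplus x=\mathbf 0$; $\mathbf 0\oplus x=x$; $x\oplus(y\oplus z)=(x\oplus y)\oplus z$. 7. (Indep) If $\mathsf n$ does not occur in $x,y,\vec u,\vec v$: $\vec u\sim\vec v\Rightarrow\vec u,x\oplus\mathsf n\sim\vec v,y\oplus\mathsf n$. 8. (EqIndep) If $\mathsf n$ does not occur in $x$: $\mathsf{EQ}(\mathsf n;x)=\mathsf{false}$. 9. (FreshNonce) If $\mathsf n$ does not occur in $\vec u$ and $\mathsf n'$ does not occur in $\vec u'$: $\vec u\sim\vec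 u'\Rightarrow\vec u,\mathsf n\sim\vec u',\mathsf n'$. 10. (IfThen) For every context $t$: $\mathsf{if}\,\mathsf{EQ}(x;y)\,\mathsf{then}\,t[x]\,\mathsf{else}\,z,\ \vec w\sim\vec x'\Rightarrow\mathsf{if}\,\mathsf{EQ}(x;y)\,\mathsf{then}\,t[y]\,\mathsf{else}\,z,\ \vec w\sim\vec x'$. 11. (CS) If $b,\ \mathsf{if}\,b\,\mathsf{then}\,x\,\mathsf{else}\,z,\ \vec u\sim b',\ \mathsf{if}\,b'\,\mathsf{then}\,x'\,\mathsf{else}\,z',\ \vec u'$ and $b,\ \mathsf{if}\,b\,\mathsf{then}\,z\,\mathsf{else}\,y,\ \vec u\sim b',\ \mathsf{if}\,b'\,\mathsf{then}\,z'\,\mathsf{else}\,y',\ \vec u'$, then $\mathsf{if}\,b\,\mathsf{then}\,x\,\mathsf{else}\,y,\ \vec u\sim\mathsf{if}\,b'\,\mathsf{then}\,x'\,\mathsf{else}\,y',\ \vec u'$.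
   Context: Syntax. Terms are built from a set of names $\mathcal N$ (sort $\mathsf{Nonce}$), a set $\mathcal F$ of function symbols, a set $\mathcal G$ of function symbols representing the attacker's computations, and variables. Sorts are $\mathsf{bool}$, $\mathsf{Nonce}$, $\mathsf{term}$; every term of sort $\mathsf{bool}$ or $\mathsf{Nonce}$ also has sort $\mathsf{term}$. $\mathcal F$ contains at least $\mathsf H:\mathsf{term}\times\mathsf{Nonce}\to\mathsf{Nonce}$ (keyed hash), $\oplus:\mathsf{Nonce}\times\mathsf{Nonce}\to\mathsf{Nonce}$, pairing $\langle\_,\_\rangle:\mathsf{term}\times\mathsf{term}\to\mathsf{term}$, $\pi_1,\pi_2:\mathsf{term}\to\mathsf{term}$, $\mathsf{EQ}(\_;\_):\mathsf{term}\times\mathsf{term}\to\mathsf{bool}$, $\mathsf{if}\_\mathsf{then}\_\mathsf{else}\_:\mathsf{bool}\times s\times s\to s$ for each sort $s$, $\mathsf{true},\mathsf{false}:\ \to\mathsf{bool}$, $\mathbf 0:\ \to\mathsf{Nonce}$. Atomic formulas are $u_1,\dots,u_n\sim v_1,\dots,v_n$ where, for every $i$, $u_i$ and $v_i$ are terms of the same sort; formulas are first-order formulas over these atoms. $u=v$ abbreviates $\mathsf{EQ}(u;v)\sim\mathsf{true}$. All variables are implicitly universally quantified. Computational interpretations. The domain is the set of deterministic polynomial-time Turing machines equipped with an input (and working) tape and two random tapes $\rho_1$ (honestly generated randomness) and $\rho_2$ (randomness directly available to the attacker); the length of the input is the security parameter $\eta$. A name is interpreted as a machine that, on an input of length $\eta$,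 extracts a word of length $\eta$ from $\rho_1$; different names extract disjoint parts of $\rho_1$. $\mathsf{true},\mathsf{false},\mathsf{EQ},\mathsf{if\,then\,else},\oplus$ are interpreted in the expected way (xor is applied only to bitstrings of the fixed length of the random numbers, and $\mathbf 0$ is the all-zero such string); e.g. $\mathsf{if\,then\,else}$ maps machines $M_1,M_2,M_3$ to the machine which on $w,\rho_1,\rho_2$ returns $M_2(w,\rho_1,\rho_2)$ if $M_1(w,\rho_1,\rho_2)=1$ and $M_3(w,\rho_1,\rho_2)$ otherwise. The other symbols of $\mathcal F$ are interpreted as arbitrary deterministic polynomial-time Turing machines. A symbol $g\in\mathcal G$ with $n$ arguments is interpreted as a function $[\![g]\!]$ for which there is a polynomial-time Turing machine $\mathcal A_g$ with $[\![g]\!](d_1,\dots,d_n)(w,\rho_1,\rho_2)=\mathcal A_g(d_1(w,\rho_1,\rho_2),\dots,d_n(w,\rho_1,\rho_2),\rho_2)$ for all $d_1,\dots,d_n$ in the domain and all $w,\rho_1,\rho_2$ (so $\rho_1$ is not used directly). The predicate $\sim$ is interpreted as computational indistinguishability: $d_1,\dots,d_n\sim d_1',\dots,d_n'$ holds iff for every deterministic polynomial-time Turing machine $\mathcal A$, $$\big|\Pr_{\rho_1,\rho_2}(\mathcal A(d_1(1^\eta,\rho_1,\rho_2),\dots,d_n(1^\eta,\rho_1,\rho_2))=1)-\Pr_{\rho_1,\rho_2}(\mathcal A(d_1'(1^\eta,\rho_1,\rho_2),\dots,d_n'(1^\eta,\rho_1,\rho_2))=1)\big|$$ is negligible in $\eta$,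 where $\rho_1,\rho_2$ are drawn uniformly.
   Formalization: The distinguisher for ∼ also receives 1^η and the attacker tape ρ2 (otherwise FA fails for symbols of G reading ρ2), and in Indep, EqIndep and FreshNonce the terms are ground (a variable could otherwise denote the name n). *)

theory Defs
  imports
    "HOL-Probability.Probability"
    "HOL-Computational_Algebra.Polynomial"
    "HOL-Combinatorics.Permutations"
begin

section \<open>Polynomial-time Turing machines with random tapes\<close>

text \<open>
  Deterministic Turing machines with finitely many two-way infinite work tapes and finitely many
  two-way readable, read-only random tapes. The i-th argument is initially written on the i-th work
  tape (work tapes double as input tapes), and the result is read off work tape 0.
  Tape symbols are numbers: 0 is the blank, 1 and 2 encode the bits, further symbols are auxiliary.
  States are numbers: 0 is the initial state and 1 the halting state.
\<close>

type_synonym bits = "bool list"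
type_synonym rtape = "nat \<Rightarrow> bool"

datatype move = MLeft | MStay | MRight

fun move_head :: "move \<Rightarrow> int \<Rightarrow> int" where
  "move_head MLeft i = i - 1"
| "move_head MStay i = i"
| "move_head MRight i = i + 1"

record machine =
  num_states :: nat
  num_syms :: nat
  num_work :: nat
  trans_fun :: "nat \<Rightarrow> nat list \<Rightarrow> nat list \<Rightarrow> nat \<times> (nat \<times> move) list \<times> move list"

text \<open>
  The transition function maps the state, the symbols scanned on the work tapes and the symbols
  scanned on the random tapes to the new state, the symbol written and the head move on each work
  tape, and the head move on each random tape. Well-formedness for \<open>n\<close> arguments and \<open>r\<close> random
  tapes says that it restricts to a function between finite sets.
\<close>

definition wf_machine :: "nat \<Rightarrow> nat \<Rightarrow> machine \<Rightarrow> bool" where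
  "wf_machine n r M \<longleftrightarrow>
     2 \<le> num_states M \<and> 3 \<le> num_syms M \<and> 1 \<le> num_work M \<and> n \<le> num_work M \<and>
     (\<forall>q ss bs. q < num_states M \<and> length ss = num_work M \<and> set ss \<subseteq> {..<num_syms M} \<and>
        length bs = r \<and> set bs \<subseteq> {..<3} \<longrightarrow>
        (case trans_fun M q ss bs of (q', acts, mvs) \<Rightarrow>
           q' < num_states M \<and> length acts = num_work M \<and> fst ` set acts \<subseteq> {..<num_syms M} \<and>
           length mvs = r))"

record config =
  cstate :: nat
  cells :: "nat \<Rightarrow> int \<Rightarrow> nat"
  work_head :: "nat \<Rightarrow> int"
  rand_head :: "nat \<Rightarrow> int"

definition bit_sym :: "bool \<Rightarrow> nat" where
  "bit_sym b = (if b then 2 else 1)"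

definition word_cells :: "bits \<Rightarrow> int \<Rightarrow> nat" where
  "word_cells xs i = (if 0 \<le> i \<and> nat i < length xs then bit_sym (xs ! nat i) else 0)"

definition rand_cells :: "rtape \<Rightarrow> int \<Rightarrow> nat" where
  "rand_cells \<rho> i = (if 0 \<le> i then bit_sym (\<rho> (nat i)) else 0)"

definition init_config :: "bits list \<Rightarrow> config" where
  "init_config xs =
     \<lparr> cstate = 0,
       cells = (\<lambda>j. if j < length xs then word_cells (xs ! j) else (\<lambda>_. 0)),
       work_head = (\<lambda>_. 0),
       rand_head = (\<lambda>_. 0) \<rparr>"

definition step :: "machine \<Rightarrow> rtape list \<Rightarrow> config \<Rightarrow> config" where
  "step M rs c =
     (if cstate c = 1 then c
      else
        (case trans_fun M (cstate c)
                (map (\<lambda>j. cells c j (work_head c j)) [0..<num_work M])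
                (map (\<lambda>j. rand_cells (rs ! j) (rand_head c j)) [0..<length rs]) of
           (q', acts, mvs) \<Rightarrow>
             \<lparr> cstate = q',
               cells = (\<lambda>j. if j < num_work M
                            then (cells c j)(work_head c j := fst (acts ! j)) else cells c j),
               work_head = (\<lambda>j. if j < num_work M
                            then move_head (snd (acts ! j)) (work_head c j) else work_head c j),
               rand_head = (\<lambda>j. if j < length rs
                            then move_head (mvs ! j) (rand_head c j) else rand_head c j) \<rparr>))"

definition output_word :: "config \<Rightarrow> bits \<Rightarrow> bool" where
  "output_word c ys \<longleftrightarrow>
     (\<forall>i<length ys. cells c 0 (int i) = bit_sym (ys ! i)) \<and>
     cells c 0 (int (length ys)) \<notin> range bit_sym"

text \<open>\<open>F\<close> takes \<open>n\<close> bitstrings and \<open>r\<close> random tapes; the time bound is a polynomial in the total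
  length of the arguments and uniform in the contents of the random tapes.\<close>

definition polytime :: "nat \<Rightarrow> nat \<Rightarrow> (bits list \<Rightarrow> rtape list \<Rightarrow> bits) \<Rightarrow> bool" where
  "polytime n r F \<longleftrightarrow>
     (\<exists>M (p :: nat poly). wf_machine n r M \<and>
        (\<forall>xs rs. length xs = n \<and> length rs = r \<longrightarrow>
           (\<exists>t \<le> poly p (\<Sum>x\<leftarrow>xs. length x).
              (let c = (step M rs ^^ t) (init_config xs)
               in cstate c = 1 \<and> output_word c (F xs rs)))))"


section \<open>Terms\<close>

datatype sort = SBool | SNonce | STerm

datatype 'f fsym =
    Hash | Xor | Pair | Proj1 | Proj2 | Equal | Ite sort | TrueS | FalseS | Zero | OtherF 'f

datatype ('f, 'g) sym = Hon "'f fsym" | Att 'g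

datatype ('n, 'f, 'g) trm =
    Var sort nat
  | Name 'n
  | App "('f, 'g) sym" "('n, 'f, 'g) trm list"

record ('f, 'g) signature =
  other_type :: "'f \<Rightarrow> sort list \<times> sort"
  att_type :: "'g \<Rightarrow> sort list \<times> sort"

fun fsym_type :: "('f, 'g) signature \<Rightarrow> 'f fsym \<Rightarrow> sort list \<times> sort" where
  "fsym_type \<Sigma> Hash = ([STerm, SNonce], SNonce)"
| "fsym_type \<Sigma> Xor = ([SNonce, SNonce], SNonce)"
| "fsym_type \<Sigma> Pair = ([STerm, STerm], STerm)"
| "fsym_type \<Sigma> Proj1 = ([STerm], STerm)"
| "fsym_type \<Sigma> Proj2 = ([STerm], STerm)"
| "fsym_type \<Sigma> Equal = ([STerm, STerm], SBool)"
| "fsym_type \<Sigma> (Ite s) = ([SBool, s, s], s)"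
| "fsym_type \<Sigma> TrueS = ([], SBool)"
| "fsym_type \<Sigma> FalseS = ([], SBool)"
| "fsym_type \<Sigma> Zero = ([], SNonce)"
| "fsym_type \<Sigma> (OtherF f) = other_type \<Sigma> f"

fun sym_type :: "('f, 'g) signature \<Rightarrow> ('f, 'g) sym \<Rightarrow> sort list \<times> sort" where
  "sym_type \<Sigma> (Hon f) = fsym_type \<Sigma> f"
| "sym_type \<Sigma> (Att g) = att_type \<Sigma> g"

inductive has_sort :: "('f, 'g) signature \<Rightarrow> ('n, 'f, 'g) trm \<Rightarrow> sort \<Rightarrow> bool"
  for \<Sigma> :: "('f, 'g) signature" where
  "has_sort \<Sigma> (Var s k) s"
| "has_sort \<Sigma> (Name n) SNonce"
| "sym_type \<Sigma> h = (ss, s) \<Longrightarrow> length ts = length ss \<Longrightarrow>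
     (\<And>i. i < length ss \<Longrightarrow> has_sort \<Sigma> (ts ! i) (ss ! i)) \<Longrightarrow> has_sort \<Sigma> (App h ts) s"
| "has_sort \<Sigma> t s \<Longrightarrow> has_sort \<Sigma> t STerm"

fun ground :: "('n, 'f, 'g) trm \<Rightarrow> bool" where
  "ground (Var s k) = False"
| "ground (Name n) = True"
| "ground (App h ts) = (\<forall>t\<in>set ts. ground t)"

fun names :: "('n, 'f, 'g) trm \<Rightarrow> 'n set" where
  "names (Var s k) = {}"
| "names (Name n) = {n}"
| "names (App h ts) = (\<Union>t\<in>set ts. names t)"

fun subst :: "('n, 'f, 'g) trm \<Rightarrow> sort \<Rightarrow> nat \<Rightarrow> ('n, 'f, 'g) trm \<Rightarrow> ('n, 'f, 'g) trm" where
  "subst (Var s' k') s k u = (if s' = s \<and> k' = k then u else Var s' k')"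
| "subst (Name n) s k u = Name n"
| "subst (App h ts) s k u = App h (map (\<lambda>t. subst t s k u) ts)"

abbreviation ite ::
  "sort \<Rightarrow> ('n, 'f, 'g) trm \<Rightarrow> ('n, 'f, 'g) trm \<Rightarrow> ('n, 'f, 'g) trm \<Rightarrow> ('n, 'f, 'g) trm" where
  "ite s b x y \<equiv> App (Hon (Ite s)) [b, x, y]"

abbreviation eqt :: "('n, 'f, 'g) trm \<Rightarrow> ('n, 'f, 'g) trm \<Rightarrow> ('n, 'f, 'g) trm" where
  "eqt x y \<equiv> App (Hon Equal) [x, y]"

abbreviation xort :: "('n, 'f, 'g) trm \<Rightarrow> ('n, 'f, 'g) trm \<Rightarrow> ('n, 'f, 'g) trm" where
  "xort x y \<equiv> App (Hon Xor) [x, y]"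

abbreviation truet :: "('n, 'f, 'g) trm" where
  "truet \<equiv> App (Hon TrueS) []"

abbreviation falset :: "('n, 'f, 'g) trm" where
  "falset \<equiv> App (Hon FalseS) []"

abbreviation zerot :: "('n, 'f, 'g) trm" where
  "zerot \<equiv> App (Hon Zero) []"


section \<open>Formulas\<close>

datatype ('n, 'f, 'g) fm =
    Indist "('n, 'f, 'g) trm list" "('n, 'f, 'g) trm list"
  | Neg "('n, 'f, 'g) fm"
  | Imp "('n, 'f, 'g) fm" "('n, 'f, 'g) fm"
  | Forall sort nat "('n, 'f, 'g) fm"

fun wf_fm :: "('f, 'g) signature \<Rightarrow> ('n, 'f, 'g) fm \<Rightarrow> bool" where
  "wf_fm \<Sigma> (Indist us vs) =
     list_all2 (\<lambda>u v. \<exists>s. has_sort \<Sigma> u s \<and> has_sort \<Sigma> v s) us vs"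
| "wf_fm \<Sigma> (Neg \<phi>) = wf_fm \<Sigma> \<phi>"
| "wf_fm \<Sigma> (Imp \<phi> \<psi>) = (wf_fm \<Sigma> \<phi> \<and> wf_fm \<Sigma> \<psi>)"
| "wf_fm \<Sigma> (Forall s k \<phi>) = wf_fm \<Sigma> \<phi>"

definition Eq :: "('n, 'f, 'g) trm \<Rightarrow> ('n, 'f, 'g) trm \<Rightarrow> ('n, 'f, 'g) fm" where
  "Eq u v = Indist [eqt u v] [truet]"

definition Imps :: "('n, 'f, 'g) fm list \<Rightarrow> ('n, 'f, 'g) fm \<Rightarrow> ('n, 'f, 'g) fm" where
  "Imps \<phi>s \<psi> = foldr Imp \<phi>s \<psi>"


section \<open>Computational interpretations\<close>

text \<open>A domain element is identified with the function computed by the machine: it maps the input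
  and the two random tapes to the output.\<close>

type_synonym delem = "bits \<Rightarrow> rtape \<Rightarrow> rtape \<Rightarrow> bits"

fun sort_ok :: "nat \<Rightarrow> sort \<Rightarrow> bits \<Rightarrow> bool" where
  "sort_ok \<eta> SBool v = (v = [True] \<or> v = [False])"
| "sort_ok \<eta> SNonce v = (length v = \<eta>)"
| "sort_ok \<eta> STerm v = True"

definition in_domain :: "sort \<Rightarrow> delem \<Rightarrow> bool" where
  "in_domain s d \<longleftrightarrow>
     polytime 1 2 (\<lambda>xs rs. d (xs ! 0) (rs ! 0) (rs ! 1)) \<and>
     (\<forall>w \<rho>1 \<rho>2. sort_ok (length w) s (d w \<rho>1 \<rho>2))"

text \<open>
  Name \<open>n\<close> reads, on an input of length \<open>\<eta>\<close>, its i-th bit at position \<open>name_pos n \<eta> i\<close> of the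
  first random tape. Machines for function symbols receive the input \<open>w\<close> (hence the security
  parameter) in front of the values of their arguments; machines for attacker symbols
  additionally have access to the second random tape, and to no other.
\<close>

record ('n, 'f, 'g) interp =
  name_pos :: "'n \<Rightarrow> nat \<Rightarrow> nat \<Rightarrow> nat"
  hon_fun :: "'f fsym \<Rightarrow> bits list \<Rightarrow> bits"
  att_fun :: "'g \<Rightarrow> bits list \<Rightarrow> rtape \<Rightarrow> bits"

definition name_val :: "('n, 'f, 'g) interp \<Rightarrow> 'n \<Rightarrow> delem" where
  "name_val I n w \<rho>1 \<rho>2 = map (\<lambda>i. \<rho>1 (name_pos I n (length w) i)) [0..<length w]"

definition interpretation_of :: "('f, 'g) signature \<Rightarrow> ('n, 'f, 'g) interp \<Rightarrow> bool" where
  "interpretation_of \<Sigma> I \<longleftrightarrow>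
     \<comment> \<open>names\<close>
     (\<forall>n. in_domain SNonce (name_val I n)) \<and>
     (\<forall>\<eta> n. inj_on (name_pos I n \<eta>) {..<\<eta>}) \<and>
     (\<forall>\<eta> n n'. n \<noteq> n' \<longrightarrow> name_pos I n \<eta> ` {..<\<eta>} \<inter> name_pos I n' \<eta> ` {..<\<eta>} = {}) \<and>
     \<comment> \<open>symbols are interpreted by polynomial-time machines respecting the sorts\<close>
     (\<forall>f ss s. fsym_type \<Sigma> f = (ss, s) \<longrightarrow>
        polytime (Suc (length ss)) 0 (\<lambda>xs rs. hon_fun I f xs) \<and>
        (\<forall>w vs. list_all2 (sort_ok (length w)) ss vs \<longrightarrow>
           sort_ok (length w) s (hon_fun I f (w # vs)))) \<and>
     (\<forall>g ss s. att_type \<Sigma> g = (ss, s) \<longrightarrow>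
        polytime (Suc (length ss)) 1 (\<lambda>xs rs. att_fun I g xs (rs ! 0)) \<and>
        (\<forall>w vs \<rho>2. list_all2 (sort_ok (length w)) ss vs \<longrightarrow>
           sort_ok (length w) s (att_fun I g (w # vs) \<rho>2))) \<and>
     \<comment> \<open>symbols with a prescribed interpretation\<close>
     (\<forall>w. hon_fun I TrueS [w] = [True]) \<and>
     (\<forall>w. hon_fun I FalseS [w] = [False]) \<and>
     (\<forall>w. hon_fun I Zero [w] = replicate (length w) False) \<and>
     (\<forall>w x y. hon_fun I Equal [w, x, y] = [x = y]) \<and>
     (\<forall>w s b x y. hon_fun I (Ite s) [w, b, x, y] = (if b = [True] then x else y)) \<and>
     (\<forall>w x y. length x = length w \<and> length y = length w \<longrightarrow>
        hon_fun I Xor [w, x, y] = map2 (\<noteq>) x y)"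

type_synonym valuation = "sort \<Rightarrow> nat \<Rightarrow> delem"

definition valuation_ok :: "valuation \<Rightarrow> bool" where
  "valuation_ok \<sigma> \<longleftrightarrow> (\<forall>s k. in_domain s (\<sigma> s k))"

fun sem :: "('n, 'f, 'g) interp \<Rightarrow> valuation \<Rightarrow> ('n, 'f, 'g) trm \<Rightarrow> delem" where
  "sem I \<sigma> (Var s k) w \<rho>1 \<rho>2 = \<sigma> s k w \<rho>1 \<rho>2"
| "sem I \<sigma> (Name n) w \<rho>1 \<rho>2 = name_val I n w \<rho>1 \<rho>2"
| "sem I \<sigma> (App (Hon f) ts) w \<rho>1 \<rho>2 = hon_fun I f (w # map (\<lambda>t. sem I \<sigma> t w \<rho>1 \<rho>2) ts)"
| "sem I \<sigma> (App (Att g) ts) w \<rho>1 \<rho>2 = att_fun I g (w # map (\<lambda>t. sem I \<sigma> t w \<rho>1 \<rho>2) ts) \<rho>2"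

definition negligible :: "(nat \<Rightarrow> real) \<Rightarrow> bool" where
  "negligible f \<longleftrightarrow> (\<forall>k::nat. \<forall>\<^sub>F \<eta> in sequentially. \<bar>f \<eta>\<bar> < 1 / real \<eta> ^ k)"

definition coins :: "rtape measure" where
  "coins = (\<Pi>\<^sub>M i\<in>(UNIV :: nat set). measure_pmf (bernoulli_pmf (1 / 2)))"

text \<open>Probability that the distinguisher \<open>A\<close> accepts; like the attacker's function symbols, it is
  given the security parameter in unary and the attacker's random tape.\<close>

definition accept_prob :: "(bits list \<Rightarrow> rtape list \<Rightarrow> bits) \<Rightarrow> delem list \<Rightarrow> nat \<Rightarrow> real" where
  "accept_prob A ds \<eta> =
     (let w = replicate \<eta> True in
      measure (coins \<Otimes>\<^sub>M coins)
        {(\<rho>1, \<rho>2). A (w # map (\<lambda>d. d w \<rho>1 \<rho>2) ds) [\<rho>2] = [True]})"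

definition indist :: "delem list \<Rightarrow> delem list \<Rightarrow> bool" where
  "indist ds ds' \<longleftrightarrow>
     length ds = length ds' \<and>
     (\<forall>A. polytime (Suc (length ds)) 1 A \<longrightarrow>
        negligible (\<lambda>\<eta>. \<bar>accept_prob A ds \<eta> - accept_prob A ds' \<eta>\<bar>))"

fun sat :: "('n, 'f, 'g) interp \<Rightarrow> valuation \<Rightarrow> ('n, 'f, 'g) fm \<Rightarrow> bool" where
  "sat I \<sigma> (Indist us vs) = indist (map (sem I \<sigma>) us) (map (sem I \<sigma>) vs)"
| "sat I \<sigma> (Neg \<phi>) = (\<not> sat I \<sigma> \<phi>)"
| "sat I \<sigma> (Imp \<phi> \<psi>) = (sat I \<sigma> \<phi> \<longrightarrow> sat I \<sigma> \<psi>)"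
| "sat I \<sigma> (Forall s k \<phi>) =
     (\<forall>d. in_domain s d \<longrightarrow> sat I (\<sigma>(s := (\<sigma> s)(k := d))) \<phi>)"

definition comp_valid :: "('f, 'g) signature \<Rightarrow> ('n, 'f, 'g) fm \<Rightarrow> bool" where
  "comp_valid \<Sigma> \<phi> \<longleftrightarrow>
     (\<forall>I \<sigma>. interpretation_of \<Sigma> I \<and> valuation_ok \<sigma> \<longrightarrow> sat I \<sigma> \<phi>)"


section \<open>Axioms\<close>

text \<open>
  The instances of the axiom schemas are the well-formed (\<^const>\<open>wf_fm\<close>) formulas among the following;
  well-formedness imposes the sort and arity conditions. Sort annotations of conditionals are
  chosen independently, since by subsorting they may differ within one axiom. In the axioms about
  fresh names the terms are ground: a variable could otherwise denote the name in question.
\<close>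

inductive axiom :: "('n, 'f, 'g) fm \<Rightarrow> bool" where
  Refl: "axiom (Indist us us)"
| Sym: "axiom (Imp (Indist us vs) (Indist vs us))"
| Trans: "axiom (Imp (Indist us vs) (Imp (Indist vs ws) (Indist us ws)))"
| Dup: "axiom (Imp (Indist (us @ [t]) (vs @ [t'])) (Indist (us @ [t, t]) (vs @ [t', t'])))"
| EqRefl: "axiom (Eq x x)"
| EqSym: "axiom (Imp (Eq x y) (Eq y x))"
| EqTrans: "axiom (Imp (Eq x y) (Imp (Eq y z) (Eq x z)))"
| CongrFun:
    "length xs = length ys \<Longrightarrow> axiom (Imps (map2 Eq xs ys) (Eq (App h xs) (App h ys)))"
| CongrIndist:
    "length us = length us' \<Longrightarrow> length vs = length vs' \<Longrightarrow>
     axiom (Imps (map2 Eq us us' @ map2 Eq vs vs') (Imp (Indist us vs) (Indist us' vs')))"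
| Perm:
    "\<pi> permutes {..<length xs} \<Longrightarrow> length ys = length xs \<Longrightarrow>
     axiom (Imp (Indist xs ys) (Indist (permute_list \<pi> xs) (permute_list \<pi> ys)))"
| FA:
    "length xs = length xs' \<Longrightarrow>
     axiom (Imp (Indist (xs @ ys) (xs' @ ys')) (Indist (App h xs # ys) (App h xs' # ys')))"
| EqTrue: "axiom (Eq (eqt x x) truet)"
| IfTrue: "axiom (Eq (ite s truet x y) x)"
| IfFalse: "axiom (Eq (ite s falset x y) y)"
| IfSame: "axiom (Eq (ite s b x x) x)"
| IfIdemThen: "axiom (Eq (ite s1 b (ite s2 b x y) z) (ite s3 b x z))"
| IfIdemElse: "axiom (Eq (ite s1 b x (ite s2 b y z)) (ite s3 b x z))"
| IfIfThen:
    "axiom (Eq (ite s1 b (ite s2 a x y) z) (ite s3 a (ite s4 b x z) (ite s5 b y z)))"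
| IfIfElse:
    "axiom (Eq (ite s1 b x (ite s2 a y z)) (ite s3 a (ite s4 b x y) (ite s5 b x z)))"
| IfApp:
    "axiom (Eq (App h (xs @ [ite s1 b y z] @ ws))
               (ite s2 b (App h (xs @ [y] @ ws)) (App h (xs @ [z] @ ws))))"
| XorComm: "axiom (Eq (xort x y) (xort y x))"
| XorSelf: "axiom (Eq (xort x x) zerot)"
| XorZero: "axiom (Eq (xort zerot x) x)"
| XorAssoc: "axiom (Eq (xort x (xort y z)) (xort (xort x y) z))"
| Indep:
    "\<forall>t \<in> set (us @ vs @ [x, y]). ground t \<and> n \<notin> names t \<Longrightarrow>
     axiom (Imp (Indist us vs) (Indist (us @ [xort x (Name n)]) (vs @ [xort y (Name n)])))"
| EqIndep:
    "ground x \<Longrightarrow> n \<notin> names x \<Longrightarrow> axiom (Eq (eqt (Name n) x) falset)"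
| FreshNonce:
    "\<forall>t \<in> set us. ground t \<and> n \<notin> names t \<Longrightarrow>
     \<forall>t \<in> set us'. ground t \<and> n' \<notin> names t \<Longrightarrow>
     axiom (Imp (Indist us us') (Indist (us @ [Name n]) (us' @ [Name n'])))"
| IfThen:
    "axiom (Imp (Indist (ite s1 (eqt x y) (subst t s k x) z # ws) xs')
                (Indist (ite s2 (eqt x y) (subst t s k y) z # ws) xs'))"
| CS:
    "axiom (Imp (Indist (b # ite s1 b x z # us) (b' # ite s2 b' x' z' # us'))
           (Imp (Indist (b # ite s3 b z y # us) (b' # ite s4 b' z' y' # us'))
                (Indist (ite s5 b x y # us) (ite s6 b' x' y' # us'))))"

end

theory Submission
  imports Defs
begin

text \<open>
  Everything except the fresh-name axioms reduces to two facts: a distinguisher can be precomposed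
  with polynomial-time computations, and changing terms on an event of negligible probability changes
  acceptance probabilities negligibly. The first rests on an explicit composition of Turing machines.
  For the case split axiom, a distinguisher for the conditional is split into one that also tests
  \<open>b\<close> and one that tests its negation.

  For the fresh-name axioms, every term depends on a polynomially bounded prefix of the random tapes
  only. Exchanging the bits of a fresh name with bits of the second tape far beyond this prefix
  preserves the coin measure, so a distinguisher can sample the name itself. Fixing the value of \<open>x\<close>
  and flipping the bits of the name accordingly is also measure preserving, which removes the xor
  with \<open>x\<close>.
\<close>

section \<open>Turing machines with functional transition functions\<close>

type_synonym delta =
  "nat \<Rightarrow> (nat \<Rightarrow> nat) \<Rightarrow> (nat \<Rightarrow> nat) \<Rightarrow> nat \<times> (nat \<Rightarrow> nat \<times> move) \<times> (nat \<Rightarrow> move)"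

abbreviation total_length :: "bits list \<Rightarrow> nat" where
  "total_length xs \<equiv> \<Sum>x\<leftarrow>xs. length x"

definition wscan :: "nat \<Rightarrow> config \<Rightarrow> nat \<Rightarrow> nat" where
  "wscan K c j = (if j < K then cells c j (work_head c j) else 0)"

definition rscan :: "rtape list \<Rightarrow> config \<Rightarrow> nat \<Rightarrow> nat" where
  "rscan rs c j = (if j < length rs then rand_cells (rs ! j) (rand_head c j) else 0)"

fun update ::
  "nat \<Rightarrow> nat \<Rightarrow> config \<Rightarrow> nat \<times> (nat \<Rightarrow> nat \<times> move) \<times> (nat \<Rightarrow> move) \<Rightarrow> config" where
  "update K r c (q, a, m) =
     \<lparr> cstate = q,
       cells = (\<lambda>j. if j < K then (cells c j)(work_head c j := fst (a j)) else cells c j),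
       work_head = (\<lambda>j. if j < K then move_head (snd (a j)) (work_head c j) else work_head c j),
       rand_head = (\<lambda>j. if j < r then move_head (m j) (rand_head c j) else rand_head c j) \<rparr>"

definition fstep :: "nat \<Rightarrow> delta \<Rightarrow> rtape list \<Rightarrow> config \<Rightarrow> config" where
  "fstep K D rs c =
     (if cstate c = 1 then c
      else update K (length rs) c (D (cstate c) (wscan K c) (rscan rs c)))"

definition leads :: "nat \<Rightarrow> delta \<Rightarrow> rtape list \<Rightarrow> nat \<Rightarrow> (config \<Rightarrow> bool) \<Rightarrow> config \<Rightarrow> bool" where
  "leads K D rs T P c \<longleftrightarrow> (\<exists>t\<le>T. P ((fstep K D rs ^^ t) c))"

definition in_range :: "nat \<Rightarrow> nat \<Rightarrow> delta \<Rightarrow> bool" where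
  "in_range Q S D \<longleftrightarrow>
     (\<forall>q ss bs. (\<forall>j. ss j < S) \<longrightarrow> (\<forall>j. bs j < 3) \<longrightarrow>
        fst (D q ss bs) < Q \<and> (\<forall>j. fst (fst (snd (D q ss bs)) j) < S))"

lemma in_rangeI:
  assumes "\<And>q ss bs q' a m. (\<forall>j. ss j < S) \<Longrightarrow> (\<forall>j. bs j < 3) \<Longrightarrow> D q ss bs = (q', a, m) \<Longrightarrow>
     q' < Q \<and> (\<forall>j. fst (a j) < S)"
  shows "in_range Q S D"
  unfolding in_range_def
proof (intro allI impI)
  fix q :: nat and ss bs :: "nat \<Rightarrow> nat"
  assume "\<forall>j. ss j < S" "\<forall>j. bs j < 3"
  then show "fst (D q ss bs) < Q \<and> (\<forall>j. fst (fst (snd (D q ss bs)) j) < S)"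
    using assms[of ss bs q] by (cases "D q ss bs") auto
qed

lemma in_rangeD:
  assumes "in_range Q S D" "\<forall>j. ss j < S" "\<forall>j. bs j < 3" "D q ss bs = (q', a, m)"
  shows "q' < Q" "fst (a j) < S"
  using assms unfolding in_range_def by (metis fst_conv snd_conv)+

lemma leads_here: "P c \<Longrightarrow> leads K D rs T P c"
  unfolding leads_def by (rule exI[of _ 0]) auto

lemma leads_step:
  assumes "leads K D rs T P (fstep K D rs c)"
  shows "leads K D rs (Suc T) P c"
proof -
  obtain t where "t \<le> T" "P ((fstep K D rs ^^ t) (fstep K D rs c))"
    using assms unfolding leads_def by auto
  then show ?thesis
    unfolding leads_def by (intro exI[of _ "Suc t"]) (simp add: funpow_swap1)
qed

lemma leads_mono:
  assumes "leads K D rs T P c" "T \<le> T'" "\<And>c'. P c' \<Longrightarrow> P' c'"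
  shows "leads K D rs T' P' c"
  using assms order.trans[OF _ assms(2)] unfolding leads_def by auto

lemma leads_trans:
  assumes "leads K D rs T P c" "\<And>c'. P c' \<Longrightarrow> leads K D rs T' P' c'" "T + T' \<le> T''"
  shows "leads K D rs T'' P' c"
proof -
  obtain t where t: "t \<le> T" "P ((fstep K D rs ^^ t) c)"
    using assms(1) unfolding leads_def by auto
  then obtain t' where t': "t' \<le> T'" "P' ((fstep K D rs ^^ t') ((fstep K D rs ^^ t) c))"
    using assms(2) unfolding leads_def by blast
  then have "P' ((fstep K D rs ^^ (t' + t)) c)" by (simp add: funpow_add)
  moreover have "t' + t \<le> T''" using t(1) t'(1) assms(3) by linarith
  ultimately show ?thesis unfolding leads_def by blast
qed

lemma fstep_halted: "cstate c = 1 \<Longrightarrow> fstep K D rs c = c"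
  by (simp add: fstep_def)

lemma funpow_fixed: "f x = x \<Longrightarrow> (f ^^ t) x = x"
  by (induction t) auto

lemma leads_simulation:
  assumes sim: "\<And>c C. R c C \<Longrightarrow> cstate c \<noteq> 1 \<Longrightarrow> R (fstep k D rs c) (fstep K D' rs C)"
    and "R c C" "leads k D rs T (\<lambda>c'. cstate c' = 1 \<and> P c') c"
  shows "leads K D' rs T (\<lambda>C'. \<exists>c'. R c' C' \<and> cstate c' = 1 \<and> P c') C"
proof -
  obtain t where t: "t \<le> T" "cstate ((fstep k D rs ^^ t) c) = 1" "P ((fstep k D rs ^^ t) c)"
    using assms(3) unfolding leads_def by auto
  have "\<exists>t'\<le>t. R ((fstep k D rs ^^ t) c) ((fstep K D' rs ^^ t') C)"
    using t(2) assms(2)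
  proof (induction t arbitrary: c C)
    case (Suc t)
    show ?case
    proof (cases "cstate c = 1")
      case True
      then have "(fstep k D rs ^^ Suc t) c = c"
        by (intro funpow_fixed fstep_halted)
      then show ?thesis using Suc.prems(2) by (intro exI[of _ 0]) (simp add: fstep_halted True)
    next
      case False
      then obtain t' where "t' \<le> t"
        "R ((fstep k D rs ^^ t) (fstep k D rs c)) ((fstep K D' rs ^^ t') (fstep K D' rs C))"
        using Suc.IH[OF _ sim[OF Suc.prems(2) False]] Suc.prems(1)
        by (auto simp: funpow_swap1)
      then show ?thesis
        by (intro exI[of _ "Suc t'"]) (simp add: funpow_swap1)
    qed
  qed auto
  then obtain t' where "t' \<le> t" "R ((fstep k D rs ^^ t) c) ((fstep K D' rs ^^ t') C)" by blast
  then show ?thesis unfolding leads_def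
    by (intro exI[of _ t'] conjI exI[of _ "(fstep k D rs ^^ t) c"]) (use t in auto)
qed

definition machine_of :: "nat \<Rightarrow> nat \<Rightarrow> nat \<Rightarrow> nat \<Rightarrow> delta \<Rightarrow> machine" where
  "machine_of Q S K r D =
     \<lparr> num_states = Q, num_syms = S, num_work = K,
       trans_fun = (\<lambda>q ss bs.
         case D q (\<lambda>j. if j < K then ss ! j else 0) (\<lambda>j. if j < r then bs ! j else 0) of
           (q', a, m) \<Rightarrow> (q', map a [0..<K], map m [0..<r])) \<rparr>"

lemma wf_machine_of:
  assumes "in_range Q S D" "2 \<le> Q" "3 \<le> S" "1 \<le> K" "n \<le> K"
  shows "wf_machine n r (machine_of Q S K r D)"
  unfolding wf_machine_def
proof (intro conjI allI impI)
  fix q :: nat and ss bs :: "nat list"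
  assume *: "q < num_states (machine_of Q S K r D) \<and>
       length ss = num_work (machine_of Q S K r D) \<and>
       set ss \<subseteq> {..<num_syms (machine_of Q S K r D)} \<and> length bs = r \<and> set bs \<subseteq> {..<3}"
  obtain q' a m where d:
    "D q (\<lambda>j. if j < K then ss ! j else 0) (\<lambda>j. if j < r then bs ! j else 0) = (q', a, m)"
    by (metis prod_cases3)
  have 1: "\<forall>j. (if j < K then ss ! j else 0) < S"
    using * assms(3) by (auto simp: machine_of_def subset_iff)
  have 2: "\<forall>j. (if j < r then bs ! j else 0) < (3::nat)"
    using * by (auto simp: machine_of_def subset_iff)
  have eq: "trans_fun (machine_of Q S K r D) q ss bs = (q', map a [0..<K], map m [0..<r])"
    by (simp add: machine_of_def d)
  show "case trans_fun (machine_of Q S K r D) q ss bs of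
       (q', acts, mvs) \<Rightarrow>
         q' < num_states (machine_of Q S K r D) \<and>
         length acts = num_work (machine_of Q S K r D) \<and>
         fst ` set acts \<subseteq> {..<num_syms (machine_of Q S K r D)} \<and> length mvs = r"
    unfolding eq prod.case using in_rangeD[OF assms(1)] 1 2 d by (auto simp: machine_of_def)
qed (use assms in \<open>auto simp: machine_of_def\<close>)

lemma step_machine_of:
  assumes "length rs = r"
  shows "step (machine_of Q S K r D) rs = fstep K D rs"
proof (rule ext)
  fix c
  have 1: "(\<lambda>j. if j < K then map (\<lambda>j. cells c j (work_head c j)) [0..<K] ! j else 0) = wscan K c"
    by (auto simp: wscan_def)
  have 2: "(\<lambda>j. if j < r then map (\<lambda>j. rand_cells (rs ! j) (rand_head c j)) [0..<r] ! j else 0)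
     = rscan rs c"
    using assms by (auto simp: rscan_def)
  show "step (machine_of Q S K r D) rs c = fstep K D rs c" using assms
    by (auto simp: step_def fstep_def machine_of_def 1 2 split: prod.splits)
qed

lemma polytimeI:
  assumes "in_range Q S D" "2 \<le> Q" "3 \<le> S" "1 \<le> K" "n \<le> K"
    and "\<And>xs rs. length xs = n \<Longrightarrow> length rs = r \<Longrightarrow>
       leads K D rs (poly p (total_length xs)) (\<lambda>c. cstate c = 1 \<and> output_word c (F xs rs))
         (init_config xs)"
  shows "polytime n r F"
proof -
  let ?M = "machine_of Q S K r D"
  have "wf_machine n r ?M"
    by (rule wf_machine_of) fact+
  moreover have "\<exists>t\<le>poly p (total_length xs).
      let c = (step ?M rs ^^ t) (init_config xs) in cstate c = 1 \<and> output_word c (F xs rs)"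
    if "length xs = n \<and> length rs = r" for xs rs
    using assms(6)[of xs rs] that step_machine_of[of rs r Q S K D]
    unfolding leads_def Let_def by auto
  ultimately show ?thesis
    unfolding polytime_def by (intro exI[of _ ?M] exI[of _ p]) auto
qed

lemma wf_machineD:
  assumes "wf_machine n r M" "q < num_states M" "length ss = num_work M"
    "set ss \<subseteq> {..<num_syms M}" "length bs = r" "set bs \<subseteq> {..<3}"
    "trans_fun M q ss bs = (q', acts, mvs)"
  shows "q' < num_states M \<and> length acts = num_work M \<and> fst ` set acts \<subseteq> {..<num_syms M}"
proof -
  have "\<forall>q ss bs. q < num_states M \<and> length ss = num_work M \<and> set ss \<subseteq> {..<num_syms M} \<and>
        length bs = r \<and> set bs \<subseteq> {..<3} \<longrightarrow>
        (case trans_fun M q ss bs of (q', acts, mvs) \<Rightarrow>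
           q' < num_states M \<and> length acts = num_work M \<and> fst ` set acts \<subseteq> {..<num_syms M} \<and>
           length mvs = r)"
    using assms(1) unfolding wf_machine_def by (elim conjE)
  from this[rule_format, of q ss bs] show ?thesis using assms(2-7) by simp
qed

text \<open>Clamping states and symbols makes the range condition hold for arbitrary scanned values; on
  valid configurations it has no effect.\<close>

definition delta_of :: "nat \<Rightarrow> machine \<Rightarrow> delta" where
  "delta_of r M q ss bs =
     (case trans_fun M (min q (num_states M - 1))
             (map (\<lambda>j. min (ss j) (num_syms M - 1)) [0..<num_work M]) (map bs [0..<r]) of
        (q', acts, mvs) \<Rightarrow>
          (q', (\<lambda>j. if j < num_work M then acts ! j else (0, MStay)), (!) mvs))"

lemma in_range_delta_of:
  assumes "wf_machine n r M" "num_syms M \<le> S"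
  shows "in_range (num_states M) S (delta_of r M)"
proof (rule in_rangeI)
  fix q ss bs q' a m
  assume bs: "\<forall>j. bs j < (3::nat)" and d: "delta_of r M q ss bs = (q', a, m)"
  let ?q = "min q (num_states M - 1)"
  let ?ss = "map (\<lambda>j. min (ss j) (num_syms M - 1)) [0..<num_work M]"
  let ?bs = "map bs [0..<r]"
  obtain q1 acts mvs where tr: "trans_fun M ?q ?ss ?bs = (q1, acts, mvs)"
    by (metis prod_cases3)
  have M: "2 \<le> num_states M" "3 \<le> num_syms M" using assms(1) by (auto simp: wf_machine_def)
  have *: "q1 < num_states M \<and> length acts = num_work M \<and> fst ` set acts \<subseteq> {..<num_syms M}"
    by (rule wf_machineD[OF assms(1) _ _ _ _ _ tr]) (use bs M in auto)
  have "fst (acts ! j) < S" if "j < num_work M" for j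
    using * assms(2) that nth_mem[of j acts] by fastforce
  then show "q' < num_states M \<and> (\<forall>j. fst (a j) < S)"
    using d tr * M assms(2) by (auto simp: delta_of_def)
qed

definition valid_config :: "machine \<Rightarrow> config \<Rightarrow> bool" where
  "valid_config M c \<longleftrightarrow> cstate c < num_states M \<and> (\<forall>j<num_work M. \<forall>z. cells c j z < num_syms M)"

lemma rand_cells_less: "rand_cells \<rho> z < 3"
  by (auto simp: rand_cells_def bit_sym_def)

lemma fstep_delta_of:
  assumes "wf_machine n r M" "length rs = r" "valid_config M c"
  shows "step M rs c = fstep (num_work M) (delta_of r M) rs c" "valid_config M (step M rs c)"
proof -
  let ?ss = "map (\<lambda>j. cells c j (work_head c j)) [0..<num_work M]"
  let ?bs = "map (\<lambda>j. rand_cells (rs ! j) (rand_head c j)) [0..<length rs]"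
  obtain q1 acts mvs where tr: "trans_fun M (cstate c) ?ss ?bs = (q1, acts, mvs)"
    by (metis prod_cases3)
  have q: "min (cstate c) (num_states M - 1) = cstate c"
    using assms(3) by (auto simp: valid_config_def)
  have "map (\<lambda>j. min (wscan (num_work M) c j) (num_syms M - 1)) [0..<num_work M] = ?ss"
  proof (intro map_cong refl)
    fix j assume "j \<in> set [0..<num_work M]"
    then have "cells c j (work_head c j) < num_syms M" "j < num_work M"
      using assms(3) by (auto simp: valid_config_def)
    then show "min (wscan (num_work M) c j) (num_syms M - 1) = cells c j (work_head c j)"
      unfolding wscan_def by simp
  qed
  moreover have "map (rscan rs c) [0..<r] = ?bs"
    using assms(2) by (auto simp: rscan_def)
  ultimately have d: "delta_of r M (cstate c) (wscan (num_work M) c) (rscan rs c) =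
     (q1, (\<lambda>j. if j < num_work M then acts ! j else (0, MStay)), (!) mvs)"
    unfolding delta_of_def by (simp only: q tr) simp
  show "step M rs c = fstep (num_work M) (delta_of r M) rs c"
    using tr d by (auto simp: step_def fstep_def)
  have *: "q1 < num_states M \<and> length acts = num_work M \<and> fst ` set acts \<subseteq> {..<num_syms M}"
    by (rule wf_machineD[OF assms(1) _ _ _ _ _ tr])
      (use assms(2,3) rand_cells_less in \<open>auto simp: valid_config_def\<close>)
  have "fst (acts ! j) < num_syms M" if "j < num_work M" for j
    using * that nth_mem[of j acts] by fastforce
  then show "valid_config M (step M rs c)"
    using assms(3) * tr by (auto simp: step_def valid_config_def)
qed

lemma valid_init_config:
  assumes "wf_machine n r M"
  shows "valid_config M (init_config xs)"
  using assms by (auto simp: wf_machine_def valid_config_def init_config_def word_cells_def bit_sym_def)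

lemma polytimeE:
  assumes "polytime n r F"
  obtains Q S K D p where "2 \<le> Q" "3 \<le> S" "1 \<le> K" "n \<le> K"
    "\<And>S'. S \<le> S' \<Longrightarrow> in_range Q S' D"
    "\<And>xs rs. length xs = n \<Longrightarrow> length rs = r \<Longrightarrow>
       leads K D rs (poly p (total_length xs)) (\<lambda>c. cstate c = 1 \<and> output_word c (F xs rs))
         (init_config xs)"
proof -
  obtain M p where M: "wf_machine n r M" and run:
    "\<And>xs rs. length xs = n \<and> length rs = r \<Longrightarrow>
           (\<exists>t \<le> poly p (total_length xs).
              (let c = (step M rs ^^ t) (init_config xs)
               in cstate c = 1 \<and> output_word c (F xs rs)))"
    using assms unfolding polytime_def by metis
  have eq: "(step M rs ^^ t) (init_config xs) =
      (fstep (num_work M) (delta_of r M) rs ^^ t) (init_config xs) \<and>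
      valid_config M ((step M rs ^^ t) (init_config xs))" if "length rs = r" for xs rs t
    by (induction t)
       (use fstep_delta_of[OF M that] valid_init_config[OF M] in auto)
  show thesis
  proof (rule that[of "num_states M" "num_syms M" "num_work M" "delta_of r M" p])
    fix xs :: "bits list" and rs :: "rtape list"
    assume l: "length xs = n" "length rs = r"
    show "leads (num_work M) (delta_of r M) rs (poly p (sum_list (map length xs)))
        (\<lambda>c. cstate c = 1 \<and> output_word c (F xs rs)) (init_config xs)"
      using run[of xs rs] l eq[OF l(2), of _ xs] unfolding leads_def Let_def by auto
  qed (use M in_range_delta_of[OF M] in \<open>auto simp: wf_machine_def\<close>)
qed

section \<open>Sequencing, tape embeddings and homing\<close>

lemma set_cstate_same [simp]: "cstate c = q \<Longrightarrow> c\<lparr>cstate := q\<rparr> = c"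
  by (cases c) auto

lemma wscan_cstate [simp]: "wscan K (c\<lparr>cstate := q\<rparr>) = wscan K c"
  by (auto simp: wscan_def)

lemma rscan_cstate [simp]: "rscan rs (c\<lparr>cstate := q\<rparr>) = rscan rs c"
  by (auto simp: rscan_def)

text \<open>State \<open>q\<close> of the first machine becomes \<open>2 * q\<close>, so its halting state is \<open>2\<close>, which doubles as the
  initial state of the second machine; the other states of the second machine become odd.\<close>

definition second_state :: "nat \<Rightarrow> nat" where
  "second_state q = (if q = 0 then 2 else if q = 1 then 1 else 2 * q + 1)"

definition seq :: "delta \<Rightarrow> delta \<Rightarrow> delta" where
  "seq D1 D2 q ss bs =
     (if even q \<and> q \<noteq> 2 then apfst ((*) 2) (D1 (q div 2) ss bs)
      else apfst second_state (D2 (if q = 2 then 0 else q div 2) ss bs))"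

lemma in_range_seq:
  assumes "in_range Q1 S D1" "in_range Q2 S D2"
  shows "in_range (2 * (Q1 + Q2) + 3) S (seq D1 D2)"
  unfolding in_range_def
proof (intro allI impI)
  fix q :: nat and ss bs :: "nat \<Rightarrow> nat"
  assume *: "\<forall>j. ss j < S" "\<forall>j. bs j < 3"
  have 1: "fst (D1 q' ss bs) < Q1 \<and> (\<forall>j. fst (fst (snd (D1 q' ss bs)) j) < S)" for q'
    using assms(1) * unfolding in_range_def by simp
  have 2: "fst (D2 q' ss bs) < Q2 \<and> (\<forall>j. fst (fst (snd (D2 q' ss bs)) j) < S)" for q'
    using assms(2) * unfolding in_range_def by simp
  have 3: "second_state q' \<le> 2 * q' + 2" for q' by (simp add: second_state_def)
  show "fst (seq D1 D2 q ss bs) < 2 * (Q1 + Q2) + 3 \<and>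
       (\<forall>j. fst (fst (snd (seq D1 D2 q ss bs)) j) < S)"
  proof (cases "even q \<and> q \<noteq> 2")
    case True
    then show ?thesis using 1[of "q div 2"] by (simp add: seq_def)
  next
    case False
    let ?q = "if q = 2 then 0 else q div 2"
    have "seq D1 D2 q ss bs = apfst second_state (D2 ?q ss bs)"
      unfolding seq_def using False by auto
    then show ?thesis using 2[of ?q] 3[of "fst (D2 ?q ss bs)"] by simp
  qed
qed

lemma fstep_seq_first:
  assumes "cstate c \<noteq> 1"
  shows "fstep K (seq D1 D2) rs (c\<lparr>cstate := 2 * cstate c\<rparr>) =
    (fstep K D1 rs c)\<lparr>cstate := 2 * cstate (fstep K D1 rs c)\<rparr>"
  using assms
  by (cases "D1 (cstate c) (wscan K c) (rscan rs c)") (auto simp: fstep_def seq_def)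

lemma fstep_seq_second:
  assumes "cstate c \<noteq> 1"
  shows "fstep K (seq D1 D2) rs (c\<lparr>cstate := second_state (cstate c)\<rparr>) =
    (fstep K D2 rs c)\<lparr>cstate := second_state (cstate (fstep K D2 rs c))\<rparr>"
proof -
  have 1: "second_state (cstate c) \<noteq> 1" using assms by (simp add: second_state_def)
  have 2: "seq D1 D2 (second_state (cstate c)) ss bs = apfst second_state (D2 (cstate c) ss bs)"
    for ss bs using assms by (auto simp: seq_def second_state_def)
  show ?thesis
    using assms 1 2
    by (cases "D2 (cstate c) (wscan K c) (rscan rs c)") (auto simp: fstep_def)
qed

lemma leads_seq:
  assumes "cstate c = 0"
    and first: "leads K D1 rs T1 (\<lambda>c'. cstate c' = 1 \<and> P (c'\<lparr>cstate := 0\<rparr>)) c"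
    and second: "\<And>c'. cstate c' = 0 \<Longrightarrow> P c' \<Longrightarrow>
      leads K D2 rs T2 (\<lambda>c''. cstate c'' = 1 \<and> P' c'') c'"
  shows "leads K (seq D1 D2) rs (T1 + T2) (\<lambda>c''. cstate c'' = 1 \<and> P' c'') c"
proof -
  let ?R = "\<lambda>c C :: config. C = c\<lparr>cstate := 2 * cstate c\<rparr>"
  let ?S = "\<lambda>c C :: config. C = c\<lparr>cstate := second_state (cstate c)\<rparr>"
  have 1: "leads K (seq D1 D2) rs T1
    (\<lambda>C'. \<exists>c'. ?R c' C' \<and> cstate c' = 1 \<and> P (c'\<lparr>cstate := 0\<rparr>)) c"
    by (rule leads_simulation[where R = ?R, OF _ _ first])
      (use assms(1) fstep_seq_first in auto)
  have 2: "leads K (seq D1 D2) rs T2 (\<lambda>c''. cstate c'' = 1 \<and> P' c'') C'"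
    if C': "\<exists>c'. ?R c' C' \<and> cstate c' = 1 \<and> P (c'\<lparr>cstate := 0\<rparr>)" for C'
  proof -
    obtain c' where c': "C' = c'\<lparr>cstate := 2\<rparr>" "P (c'\<lparr>cstate := 0\<rparr>)" using C' by auto
    have "leads K (seq D1 D2) rs T2 (\<lambda>C''. \<exists>c''. ?S c'' C'' \<and> cstate c'' = 1 \<and> P' c'') C'"
      by (rule leads_simulation[where R = ?S, OF _ _ second[OF _ c'(2)]])
        (use c'(1) fstep_seq_second in \<open>auto simp: second_state_def\<close>)
    then show ?thesis
      by (rule leads_mono) (auto simp: second_state_def)
  qed
  show ?thesis by (rule leads_trans[OF 1 2]) auto
qed

definition embed :: "nat \<Rightarrow> (nat \<Rightarrow> nat) \<Rightarrow> (nat \<Rightarrow> nat option) \<Rightarrow> delta \<Rightarrow> delta" where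
  "embed k e d D q ss bs =
     (case D q (\<lambda>i. if i < k then ss (e i) else 0) bs of
        (q', a, m) \<Rightarrow> (q', (\<lambda>j. case d j of Some i \<Rightarrow> a i | None \<Rightarrow> (ss j, MStay)), m))"

lemma in_range_embed:
  assumes "in_range Q S D" "0 < S"
  shows "in_range Q S (embed k e d D)"
proof (rule in_rangeI)
  fix q ss bs q' a m
  assume *: "\<forall>j. ss j < S" "\<forall>j. bs j < (3::nat)" "embed k e d D q ss bs = (q', a, m)"
  obtain a' where "D q (\<lambda>i. if i < k then ss (e i) else 0) bs = (q', a', m)"
    "a = (\<lambda>j. case d j of Some i \<Rightarrow> a' i | None \<Rightarrow> (ss j, MStay))"
    using *(3) by (auto simp: embed_def split: prod.splits)
  moreover have "\<forall>i. (if i < k then ss (e i) else 0) < S" using * assms(2) by auto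
  ultimately show "q' < Q \<and> (\<forall>j. fst (a j) < S)"
    using in_rangeD[OF assms(1), of "\<lambda>i. if i < k then ss (e i) else 0" bs q q' a' m] *
    by (auto split: option.splits)
qed

definition tape_embedding :: "nat \<Rightarrow> nat \<Rightarrow> (nat \<Rightarrow> nat) \<Rightarrow> (nat \<Rightarrow> nat option) \<Rightarrow> bool" where
  "tape_embedding k K e d \<longleftrightarrow>
     (\<forall>i<k. e i < K \<and> d (e i) = Some i) \<and> (\<forall>j i. d j = Some i \<longrightarrow> i < k \<and> e i = j)"

definition embeds ::
  "nat \<Rightarrow> (nat \<Rightarrow> nat) \<Rightarrow> (nat \<Rightarrow> nat option) \<Rightarrow> nat \<Rightarrow> config \<Rightarrow> config \<Rightarrow> config \<Rightarrow> bool" where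
  "embeds k e d r C0 c C \<longleftrightarrow>
     cstate C = cstate c \<and>
     (\<forall>i<k. cells C (e i) = cells c i \<and> work_head C (e i) = work_head c i) \<and>
     (\<forall>j<r. rand_head C j = rand_head c j) \<and>
     (\<forall>j. d j = None \<longrightarrow> cells C j = cells C0 j \<and> work_head C j = work_head C0 j)"

lemma embeds_fstep:
  assumes te: "tape_embedding k K e d" and em: "embeds k e d (length rs) C0 c C" and "cstate c \<noteq> 1"
  shows "embeds k e d (length rs) C0 (fstep k D rs c) (fstep K (embed k e d D) rs C)"
proof -
  have 1: "(\<lambda>i. if i < k then wscan K C (e i) else 0) = wscan k c"
    using te em by (auto simp: wscan_def tape_embedding_def embeds_def)
  have 2: "rscan rs C = rscan rs c"
    using em by (auto simp: rscan_def embeds_def)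
  obtain q a m where d: "D (cstate c) (wscan k c) (rscan rs c) = (q, a, m)"
    by (metis prod_cases3)
  have C: "fstep K (embed k e d D) rs C =
    update K (length rs) C
      (q, (\<lambda>j. case d j of Some i \<Rightarrow> a i | None \<Rightarrow> (wscan K C j, MStay)), m)"
    using em assms(3) d by (simp add: fstep_def embed_def embeds_def 1 2)
  have c: "fstep k D rs c = update k (length rs) c (q, a, m)"
    using assms(3) d by (simp add: fstep_def)
  show ?thesis unfolding C c
    using te em by (auto simp: embeds_def tape_embedding_def wscan_def)
qed

lemma leads_embed:
  assumes te: "tape_embedding k K e d" and em: "embeds k e d (length rs) C0 c C"
    and run: "leads k D rs T (\<lambda>c. cstate c = 1 \<and> P c) c"
    and post: "\<And>c' C'. embeds k e d (length rs) C0 c' C' \<Longrightarrow> P c' \<Longrightarrow> P' C'"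
  shows "leads K (embed k e d D) rs T (\<lambda>C'. cstate C' = 1 \<and> P' C') C"
proof -
  have "leads K (embed k e d D) rs T
      (\<lambda>C'. \<exists>c'. embeds k e d (length rs) C0 c' C' \<and> cstate c' = 1 \<and> P c') C"
    by (rule leads_simulation[where R = "embeds k e d (length rs) C0", OF _ em run])
      (rule embeds_fstep[OF te])
  then show ?thesis
  proof (rule leads_mono, safe)
    fix C' c' assume c': "embeds k e d (length rs) C0 c' C'" "cstate c' = 1" "P c'"
    show "cstate C' = 1" using c' by (simp add: embeds_def)
    show "P' C'" by (rule post) fact+
  qed
qed

abbreviation keep :: "(nat \<Rightarrow> nat) \<Rightarrow> nat \<Rightarrow> nat \<times> move" where
  "keep ss \<equiv> \<lambda>j. (ss j, MStay)"

abbreviation stay :: "nat \<Rightarrow> move" where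
  "stay \<equiv> \<lambda>_. MStay"

lemma update_keep:
  "update K r c (q, keep (wscan K c), m) =
     c\<lparr>cstate := q, rand_head := \<lambda>j. if j < r then move_head (m j) (rand_head c j) else rand_head c j\<rparr>"
  by (rule config.equality) (auto simp: wscan_def)

lemma update_keep_stay: "update K r c (q, keep (wscan K c), stay) = c\<lparr>cstate := q\<rparr>"
  by (rule config.equality) (auto simp: wscan_def)

lemma move_head_bound: "\<bar>move_head m i\<bar> \<le> \<bar>i\<bar> + 1"
  by (cases m) auto

lemma head_bound:
  "\<bar>work_head ((fstep K D rs ^^ t) c) j\<bar> \<le> \<bar>work_head c j\<bar> + int t \<and>
   \<bar>rand_head ((fstep K D rs ^^ t) c) j\<bar> \<le> \<bar>rand_head c j\<bar> + int t"
proof (induction t)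
  case (Suc t)
  let ?c = "(fstep K D rs ^^ t) c"
  obtain q a m where d: "D (cstate ?c) (wscan K ?c) (rscan rs ?c) = (q, a, m)"
    by (metis prod_cases3)
  have "fstep K D rs ?c = (if cstate ?c = 1 then ?c else update K (length rs) ?c (q, a, m))"
    unfolding fstep_def[of K D rs ?c] d ..
  then show ?case
    using Suc move_head_bound[of "snd (a j)" "work_head ?c j"]
      move_head_bound[of "m j" "rand_head ?c j"]
    by auto
qed auto

lemma leads_head_bound:
  assumes "leads K D rs T P c"
  shows "leads K D rs T
    (\<lambda>c'. P c' \<and> (\<forall>j. \<bar>work_head c' j\<bar> \<le> \<bar>work_head c j\<bar> + int T \<and>
       \<bar>rand_head c' j\<bar> \<le> \<bar>rand_head c j\<bar> + int T)) c"
proof -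
  obtain t where t: "t \<le> T" "P ((fstep K D rs ^^ t) c)"
    using assms unfolding leads_def by auto
  have "\<bar>work_head ((fstep K D rs ^^ t) c) j\<bar> \<le> \<bar>work_head c j\<bar> + int T \<and>
   \<bar>rand_head ((fstep K D rs ^^ t) c) j\<bar> \<le> \<bar>rand_head c j\<bar> + int T" for j
    using head_bound[where K = K and D = D and rs = rs and t = t and c = c and j = j] t(1) by linarith
  then show ?thesis unfolding leads_def using t by blast
qed

text \<open>
  A machine may halt with its output head anywhere and nothing on the tape marks the origin. An extra
  tape \<open>k\<close> carries a mark at the origin and moves in lockstep with tape \<open>0\<close>; the parity of the state
  records on which side of the origin the heads are. States \<open>6\<close> and \<open>7\<close>, which encode the halting
  state of the given machine, walk back to the mark.
\<close>

definition homing :: "nat \<Rightarrow> delta \<Rightarrow> delta" where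
  "homing k D q ss bs =
     (if q = 0 then (4, (\<lambda>j. (if j = k then 1 else ss j, MStay)), stay)
      else if q < 4 then (1, keep ss, stay)
      else if (q - 4) div 2 = 1 then
        (if ss k = 1 then (1, keep ss, stay)
         else (q, (\<lambda>j. (ss j, if j = 0 \<or> j = k then (if odd q then MRight else MLeft) else MStay)), stay))
      else
        (case D ((q - 4) div 2) (\<lambda>j. if j < k then ss j else 0) bs of
           (q', a, m) \<Rightarrow>
             (4 + 2 * q' + of_bool (if ss k = 1 then snd (a 0) = MLeft else odd q),
              (\<lambda>j. if j < k then a j else (ss j, if j = k then snd (a 0) else MStay)), m)))"

lemma in_range_homing:
  assumes "in_range Q S D" "3 \<le> S" "2 \<le> Q"
  shows "in_range (2 * Q + 6) S (homing k D)"
proof (rule in_rangeI)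
  fix q ss bs q' a m
  assume *: "\<forall>j. ss j < S" "\<forall>j. bs j < (3::nat)" and h: "homing k D q ss bs = (q', a, m)"
  obtain q1 a1 m1 where d: "D ((q - 4) div 2) (\<lambda>j. if j < k then ss j else 0) bs = (q1, a1, m1)"
    by (metis prod_cases3)
  have "\<forall>j. (if j < k then ss j else 0) < S" using * assms(2) by auto
  then have q1: "q1 < Q" "fst (a1 j) < S" for j
    using in_rangeD[OF assms(1), of "\<lambda>j. if j < k then ss j else 0" bs "(q - 4) div 2" q1 a1 m1] *(2) d
    by auto
  have "q < 2 * Q + 6" if "(q - 4) div 2 = 1" using that assms(3) by linarith
  then show "q' < 2 * Q + 6 \<and> (\<forall>j. fst (a j) < S)"
    using h d q1 * assms(2)
    by (auto simp: homing_def split: if_splits)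
qed

definition shadows :: "nat \<Rightarrow> nat \<Rightarrow> config \<Rightarrow> config \<Rightarrow> bool" where
  "shadows k r c C \<longleftrightarrow> (\<exists>s.
     cstate C = 4 + 2 * cstate c + of_bool s \<and>
     (work_head c 0 \<noteq> 0 \<longrightarrow> s = (work_head c 0 < 0)) \<and>
     (\<forall>j<k. cells C j = cells c j \<and> work_head C j = work_head c j) \<and>
     cells C k = (\<lambda>z. if z = 0 then 1 else 0) \<and> work_head C k = work_head c 0 \<and>
     (\<forall>j<r. rand_head C j = rand_head c j))"

lemma shadows_fstep:
  assumes sh: "shadows k (length rs) c C" and "cstate c \<noteq> 1" "0 < k"
  shows "shadows k (length rs) (fstep k D rs c) (fstep (Suc k) (homing k D) rs C)"
proof -
  obtain s where s: "cstate C = 4 + 2 * cstate c + of_bool s"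
     "work_head c 0 \<noteq> 0 \<longrightarrow> s = (work_head c 0 < 0)"
     "\<forall>j<k. cells C j = cells c j \<and> work_head C j = work_head c j"
     "cells C k = (\<lambda>z. if z = 0 then 1 else 0)" "work_head C k = work_head c 0"
     "\<forall>j<length rs. rand_head C j = rand_head c j"
    using sh unfolding shadows_def by blast
  have 1: "(\<lambda>j. if j < k then wscan (Suc k) C j else 0) = wscan k c"
    using s by (auto simp: wscan_def)
  have 2: "rscan rs C = rscan rs c"
    using s by (auto simp: rscan_def)
  have 3: "wscan (Suc k) C k = (if work_head c 0 = 0 then 1 else 0)"
    using s by (auto simp: wscan_def)
  have 4: "(cstate C - 4) div 2 = cstate c" "cstate C \<ge> 4" "odd (cstate C) = s" using s(1) by auto
  obtain q a m where d: "D (cstate c) (wscan k c) (rscan rs c) = (q, a, m)"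
    by (metis prod_cases3)
  define s' where "s' = (if work_head c 0 = 0 then snd (a 0) = MLeft else s)"
  have C: "fstep (Suc k) (homing k D) rs C =
    update (Suc k) (length rs) C (4 + 2 * q + of_bool s',
        (\<lambda>j. if j < k then a j else (wscan (Suc k) C j, if j = k then snd (a 0) else MStay)), m)"
    using assms(2) d 4 by (simp add: fstep_def homing_def 1 2 3 s'_def)
  have c: "fstep k D rs c = update k (length rs) c (q, a, m)"
    using assms(2) d by (simp add: fstep_def)
  have sgn: "move_head (snd (a 0)) (work_head c 0) \<noteq> 0 \<longrightarrow>
      s' = (move_head (snd (a 0)) (work_head c 0) < 0)"
    using s(2) by (cases "snd (a 0)") (auto simp: s'_def)
  show ?thesis unfolding C c shadows_def
    by (rule exI[of _ s']) (use s sgn assms(3) in \<open>auto simp: wscan_def\<close>)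
qed

lemma leads_home:
  assumes "0 < k"
  shows "cells C k = (\<lambda>z. if z = 0 then 1 else 0) \<Longrightarrow> work_head C k = work_head C 0 \<Longrightarrow>
    cstate C = 6 + of_bool s \<Longrightarrow> (work_head C 0 \<noteq> 0 \<longrightarrow> s = (work_head C 0 < 0)) \<Longrightarrow>
    \<bar>work_head C 0\<bar> \<le> int n \<Longrightarrow>
    leads (Suc k) (homing k D) rs (Suc n)
      (\<lambda>C'. cstate C' = 1 \<and> cells C' = cells C \<and> work_head C' 0 = 0 \<and> rand_head C' = rand_head C) C"
    (is "_ \<Longrightarrow> _ \<Longrightarrow> _ \<Longrightarrow> _ \<Longrightarrow> _ \<Longrightarrow> leads _ _ _ _ (?P C) C")
proof (induction n arbitrary: C)
  case 0
  have "fstep (Suc k) (homing k D) rs C = C\<lparr>cstate := 1\<rparr>"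
    using 0 by (simp add: fstep_def homing_def wscan_def[of _ _ k] update_keep_stay del: update.simps)
  then show ?case using 0 by (intro leads_step leads_here) simp
next
  case (Suc n)
  show ?case
  proof (cases "work_head C 0 = 0")
    case True
    then have "fstep (Suc k) (homing k D) rs C = C\<lparr>cstate := 1\<rparr>"
      using Suc.prems by (simp add: fstep_def homing_def wscan_def[of _ _ k] update_keep_stay del: update.simps)
    then show ?thesis using True by (intro leads_step leads_here) simp
  next
    case False
    let ?C = "fstep (Suc k) (homing k D) rs C"
    have 1: "wscan (Suc k) C k = 0" using Suc.prems False by (simp add: wscan_def)
    have "(6 + of_bool s - 4) div 2 = (1::nat)" by (cases s) auto
    then have C: "?C = update (Suc k) (length rs) C (cstate C,
        (\<lambda>j. (wscan (Suc k) C j, if j = 0 \<or> j = k then (if odd (cstate C) then MRight else MLeft) else MStay)), stay)"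
      using Suc.prems(3) 1 by (simp add: fstep_def homing_def)
    have 2: "cells ?C = cells C" "rand_head ?C = rand_head C" "cstate ?C = cstate C"
      "work_head ?C k = work_head ?C 0"
      "work_head ?C 0 = (if s then work_head C 0 + 1 else work_head C 0 - 1)"
      unfolding C using Suc.prems assms by (auto simp: wscan_def)
    have "leads (Suc k) (homing k D) rs (Suc n)
      (?P ?C) ?C"
    proof (rule Suc.IH)
      show "work_head ?C 0 \<noteq> 0 \<longrightarrow> s = (work_head ?C 0 < 0)"
        "\<bar>work_head ?C 0\<bar> \<le> int n"
        unfolding 2(5) using Suc.prems(4,5) False by auto
    qed (use 2 Suc.prems in auto)
    then show ?thesis by (rule leads_step[OF leads_mono]) (simp_all add: 2)
  qed
qed

lemma leads_homing:
  assumes "leads k D rs T (\<lambda>c. cstate c = 1 \<and> P c) (init_config xs)" "length xs \<le> k" "0 < k"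
  shows "leads (Suc k) (homing k D) rs (2 * T + 2)
    (\<lambda>C. cstate C = 1 \<and> work_head C 0 = 0 \<and> (\<forall>j. j < length rs \<longrightarrow> \<bar>rand_head C j\<bar> \<le> int T) \<and>
       (\<exists>c. P c \<and> cells C 0 = cells c 0)) (init_config xs)"
    (is "leads _ _ _ _ ?Q _")
proof -
  let ?c = "init_config xs" and ?C = "fstep (Suc k) (homing k D) rs (init_config xs)"
  have sh: "shadows k (length rs) ?c ?C"
    unfolding shadows_def using assms(2)
    by (intro exI[of _ False]) (auto simp: fstep_def homing_def init_config_def wscan_def fun_eq_iff)
  have bounded: "leads k D rs T (\<lambda>c. cstate c = 1 \<and> P c \<and>
      (\<forall>j. \<bar>work_head c j\<bar> \<le> int T \<and> \<bar>rand_head c j\<bar> \<le> int T)) ?c"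
    by (rule leads_mono[OF leads_head_bound[OF assms(1)]]) (auto simp: init_config_def)
  have run: "leads (Suc k) (homing k D) rs T (\<lambda>C'. \<exists>c'. shadows k (length rs) c' C' \<and>
      cstate c' = 1 \<and> P c' \<and> (\<forall>j. \<bar>work_head c' j\<bar> \<le> int T \<and> \<bar>rand_head c' j\<bar> \<le> int T)) ?C"
    by (rule leads_simulation[where R = "shadows k (length rs)", OF _ sh bounded])
      (rule shadows_fstep[OF _ _ assms(3)])
  have "leads (Suc k) (homing k D) rs (T + Suc T) ?Q ?C"
  proof (rule leads_trans[OF run])
    fix C' assume "\<exists>c'. shadows k (length rs) c' C' \<and> cstate c' = 1 \<and> P c' \<and>
       (\<forall>j. \<bar>work_head c' j\<bar> \<le> int T \<and> \<bar>rand_head c' j\<bar> \<le> int T)"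
    then obtain c' s where c': "cstate c' = 1" "P c'"
      "\<forall>j. \<bar>work_head c' j\<bar> \<le> int T \<and> \<bar>rand_head c' j\<bar> \<le> int T"
      "cstate C' = 4 + 2 * cstate c' + of_bool s"
     "work_head c' 0 \<noteq> 0 \<longrightarrow> s = (work_head c' 0 < 0)"
     "\<forall>j<k. cells C' j = cells c' j \<and> work_head C' j = work_head c' j"
     "cells C' k = (\<lambda>z. if z = 0 then 1 else 0)" "work_head C' k = work_head c' 0"
     "\<forall>j<length rs. rand_head C' j = rand_head c' j"
      unfolding shadows_def by blast
    have "leads (Suc k) (homing k D) rs (Suc T)
      (\<lambda>C. cstate C = 1 \<and> cells C = cells C' \<and> work_head C 0 = 0 \<and> rand_head C = rand_head C') C'"
      by (rule leads_home[OF assms(3), where s = s]) (use c' assms(3) in auto)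
    then show "leads (Suc k) (homing k D) rs (Suc T) ?Q C'"
      by (rule leads_mono) (use c' assms(3) in auto)
  qed simp
  then have "leads (Suc k) (homing k D) rs (Suc (T + Suc T)) ?Q ?c"
    by (rule leads_step)
  then show ?thesis by (rule leads_mono) auto
qed

section \<open>Rewinding and copying\<close>

text \<open>The origin of a random tape can be found without a mark, since exactly its negative cells are
  blank.\<close>

definition rewind :: "nat \<Rightarrow> delta" where
  "rewind r q ss bs =
     (if q = 0 then
        (if \<forall>j<r. bs j = 0 then (2, keep ss, stay)
         else (0, keep ss, \<lambda>j. if bs j = 0 then MStay else MLeft))
      else if \<forall>j<r. bs j \<noteq> 0 then (1, keep ss, stay)
      else (2, keep ss, \<lambda>j. if bs j = 0 then MRight else MStay))"

lemma in_range_rewind: "in_range 3 S (rewind r)"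
  by (rule in_rangeI) (auto simp: rewind_def split: if_splits)

lemma rand_cells_eq_0_iff: "rand_cells \<rho> z = 0 \<longleftrightarrow> z < 0"
  by (auto simp: rand_cells_def bit_sym_def)

lemma rscan_eq_0_iff: "j < length rs \<Longrightarrow> rscan rs c j = 0 \<longleftrightarrow> rand_head c j < 0"
  by (simp add: rscan_def rand_cells_eq_0_iff)

lemma leads_rewind_left:
  assumes "1 \<le> B"
  shows "cstate c = 0 \<Longrightarrow> \<forall>j<length rs. rand_head c j < int n \<and> - int B \<le> rand_head c j \<Longrightarrow>
    leads K (rewind (length rs)) rs (Suc n)
      (\<lambda>c'. cstate c' = 2 \<and> cells c' = cells c \<and> work_head c' = work_head c \<and>
         (\<forall>j<length rs. rand_head c' j < 0 \<and> - int B \<le> rand_head c' j)) c"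
    (is "_ \<Longrightarrow> _ \<Longrightarrow> leads _ _ _ _ (?P c) c")
proof (induction n arbitrary: c)
  case 0
  have "fstep K (rewind (length rs)) rs c = c\<lparr>cstate := 2\<rparr>"
    using 0 by (simp add: fstep_def rewind_def rscan_eq_0_iff update_keep_stay del: update.simps)
  then show ?case using 0 by (intro leads_step leads_here) simp
next
  case (Suc n)
  show ?case
  proof (cases "\<forall>j<length rs. rand_head c j < 0")
    case True
    have "fstep K (rewind (length rs)) rs c = c\<lparr>cstate := 2\<rparr>"
      using Suc.prems True
      by (simp add: fstep_def rewind_def rscan_eq_0_iff update_keep_stay del: update.simps)
    then show ?thesis using Suc.prems True by (intro leads_step leads_here) simp
  next
    case False
    let ?c = "fstep K (rewind (length rs)) rs c"
    have c: "?c = c\<lparr>cstate := 0, rand_head := \<lambda>j. if j < length rs then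
        move_head (if rscan rs c j = 0 then MStay else MLeft) (rand_head c j) else rand_head c j\<rparr>"
      using Suc.prems False
      by (auto simp: fstep_def rewind_def rscan_eq_0_iff update_keep simp del: update.simps)
    have "leads K (rewind (length rs)) rs (Suc n)
      (?P ?c) ?c"
      using Suc.prems assms by (intro Suc.IH) (auto simp: c rscan_eq_0_iff)
    then show ?thesis by (rule leads_step[OF leads_mono]) (simp_all add: c)
  qed
qed

lemma leads_rewind_right:
  shows "cstate c = 2 \<Longrightarrow> \<forall>j<length rs. rand_head c j \<le> 0 \<and> - int n \<le> rand_head c j \<Longrightarrow>
    leads K (rewind (length rs)) rs (Suc n)
      (\<lambda>c'. cstate c' = 1 \<and> cells c' = cells c \<and> work_head c' = work_head c \<and>
         (\<forall>j<length rs. rand_head c' j = 0)) c"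
    (is "_ \<Longrightarrow> _ \<Longrightarrow> leads _ _ _ _ (?P c) c")
proof (induction n arbitrary: c)
  case 0
  have "\<forall>j<length rs. rand_head c j = 0" using 0(2) by auto
  then have "fstep K (rewind (length rs)) rs c = c\<lparr>cstate := 1\<rparr>"
    using 0 by (simp add: fstep_def rewind_def rscan_eq_0_iff update_keep_stay del: update.simps)
  then show ?case using 0 by (intro leads_step leads_here) auto
next
  case (Suc n)
  show ?case
  proof (cases "\<forall>j<length rs. rand_head c j = 0")
    case True
    have "fstep K (rewind (length rs)) rs c = c\<lparr>cstate := 1\<rparr>"
      using Suc.prems True
      by (simp add: fstep_def rewind_def rscan_eq_0_iff update_keep_stay del: update.simps)
    then show ?thesis using Suc.prems True by (intro leads_step leads_here) simp
  next
    case False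
    let ?c = "fstep K (rewind (length rs)) rs c"
    have "\<not> (\<forall>j<length rs. \<not> rand_head c j < 0)"
      using False Suc.prems by (meson antisym_conv1)
    then have c: "?c = c\<lparr>cstate := 2, rand_head := \<lambda>j. if j < length rs then
        move_head (if rscan rs c j = 0 then MRight else MStay) (rand_head c j) else rand_head c j\<rparr>"
      using Suc.prems
      by (auto simp: fstep_def rewind_def rscan_eq_0_iff update_keep simp del: update.simps)
    have "leads K (rewind (length rs)) rs (Suc n)
      (?P ?c) ?c"
      using Suc.prems by (intro Suc.IH) (auto simp: c rscan_eq_0_iff)
    then show ?thesis by (rule leads_step[OF leads_mono]) (simp_all add: c)
  qed
qed

lemma leads_rewind:
  assumes "cstate c = 0" "\<forall>j<length rs. \<bar>rand_head c j\<bar> \<le> int T"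
  shows "leads K (rewind (length rs)) rs (2 * T + 5)
    (\<lambda>c'. cstate c' = 1 \<and> cells c' = cells c \<and> work_head c' = work_head c \<and>
       (\<forall>j<length rs. rand_head c' j = 0)) c"
proof -
  have 1: "leads K (rewind (length rs)) rs (Suc (Suc T))
      (\<lambda>c'. cstate c' = 2 \<and> cells c' = cells c \<and> work_head c' = work_head c \<and>
         (\<forall>j<length rs. rand_head c' j < 0 \<and> - int (Suc T) \<le> rand_head c' j)) c"
    by (rule leads_rewind_left) (use assms in force)+
  have 2: "leads K (rewind (length rs)) rs (Suc (Suc T))
      (\<lambda>c''. cstate c'' = 1 \<and> cells c'' = cells c \<and> work_head c'' = work_head c \<and>
         (\<forall>j<length rs. rand_head c'' j = 0)) c'"
    if c': "cstate c' = 2 \<and> cells c' = cells c \<and> work_head c' = work_head c \<and>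
         (\<forall>j<length rs. rand_head c' j < 0 \<and> - int (Suc T) \<le> rand_head c' j)" for c'
    by (rule leads_mono[OF leads_rewind_right[of c' rs "Suc T"]]) (use c' in force)+
  show ?thesis by (rule leads_trans[OF 1 2]) auto
qed

abbreviation is_bit :: "nat \<Rightarrow> bool" where
  "is_bit s \<equiv> s = 1 \<or> s = 2"

lemma range_bit_sym: "s \<in> range bit_sym \<longleftrightarrow> is_bit s"
  by (auto simp: bit_sym_def image_iff)

text \<open>All heads move right in lockstep until every source in \<open>I\<close> is exhausted, and then back to the mark
  on tape \<open>mk\<close>, so that they end where they started.\<close>

definition copy :: "(nat \<Rightarrow> nat option) \<Rightarrow> nat set \<Rightarrow> nat \<Rightarrow> delta" where
  "copy src I mk q ss bs =
     (if q = 0 then (2, (\<lambda>j. (if j = mk then 1 else ss j, MStay)), stay)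
      else if q = 2 then
        (if \<forall>i\<in>I. \<not> is_bit (ss i) then (3, keep ss, stay)
         else (2, (\<lambda>j. (case src j of Some i \<Rightarrow> if is_bit (ss i) then ss i else ss j | None \<Rightarrow> ss j,
                 MRight)), stay))
      else if ss mk = 1 then (1, keep ss, stay)
      else (3, (\<lambda>j. (ss j, MLeft)), stay))"

lemma in_range_copy: "3 \<le> S \<Longrightarrow> in_range 4 S (copy src I mk)"
  by (rule in_rangeI) (auto simp: copy_def split: if_splits option.splits)

definition copied :: "(nat \<Rightarrow> nat option) \<Rightarrow> nat \<Rightarrow> nat \<Rightarrow> (nat \<Rightarrow> int \<Rightarrow> nat) \<Rightarrow> nat \<Rightarrow> int \<Rightarrow> nat" where
  "copied src mk p w j =
     (if j = mk then (w j)(0 := 1)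
      else case src j of
        Some i \<Rightarrow> (\<lambda>z. if 0 \<le> z \<and> z < int p \<and> is_bit (w i z) then w i z else w j z)
      | None \<Rightarrow> w j)"

lemma leads_copy:
  assumes "cstate c = 0"
    and tapes: "I \<subseteq> {..<K}" "mk < K" "mk \<notin> I"
      "\<And>j i. src j = Some i \<Longrightarrow> j < K \<and> j \<notin> I \<and> j \<noteq> mk \<and> i \<in> I"
    and heads: "\<And>i. i \<in> I \<Longrightarrow> work_head c i = 0" "work_head c mk = 0"
      "\<And>j i. src j = Some i \<Longrightarrow> work_head c j = 0"
    and marker: "\<And>z. 0 < z \<Longrightarrow> z \<le> int L \<Longrightarrow> cells c mk z \<noteq> 1"
    and len: "\<And>p. p < L \<Longrightarrow> \<exists>i\<in>I. is_bit (cells c i (int p))"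
      "\<And>i. i \<in> I \<Longrightarrow> \<not> is_bit (cells c i (int L))"
  shows "leads K (copy src I mk) rs (2 * L + 3)
    (\<lambda>c'. c' = c\<lparr>cstate := 1, cells := copied src mk L (cells c)\<rparr>) c"
    (is "leads _ _ _ _ ?P _")
proof -
  define conf where "conf q l p = c\<lparr>cstate := q, cells := copied src mk l (cells c),
     work_head := \<lambda>j. if j < K then work_head c j + int p else work_head c j\<rparr>" for q l p
  have conf [simp]: "cstate (conf q l p) = q" "cells (conf q l p) = copied src mk l (cells c)"
     "work_head (conf q l p) = (\<lambda>j. if j < K then work_head c j + int p else work_head c j)"
     "rand_head (conf q l p) = rand_head c" for q l p
    by (auto simp: conf_def)
  have src_I: "src i = None" if "i \<in> I" for i using tapes(4)[of i] that by (cases "src i") auto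
  have src_mk: "src mk = None" using tapes(4)[of mk] by (cases "src mk") auto
  have cop_I: "copied src mk l w i = w i" if "i \<in> I" for l w i
    using that src_I tapes(3) by (auto simp: copied_def)
  have scan_I: "wscan K (conf q l p) i = cells c i (int p)" if "i \<in> I" for q l p i
    using that tapes heads by (auto simp: wscan_def cop_I)
  have scan_mk: "wscan K (conf q l p) mk = ((cells c mk)(0 := 1)) (int p)" for q l p
    using tapes heads by (auto simp: wscan_def copied_def)
  let ?step = "fstep K (copy src I mk) rs"
  have start: "?step c = conf 2 0 0"
    by (rule config.equality)
       (use assms(1) heads tapes src_mk in
         \<open>auto simp: fstep_def copy_def wscan_def copied_def fun_eq_iff split: option.splits\<close>)
  have right: "?step (conf 2 p p) = conf 2 (Suc p) (Suc p)" if p: "p < L" for p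
  proof -
    obtain i where "i \<in> I" "is_bit (cells c i (int p))" using len(1)[OF p] by blast
    then have ex: "\<not> (\<forall>i\<in>I. \<not> is_bit (wscan K (conf 2 p p) i))" using scan_I by metis
    have st: "?step (conf 2 p p) = update K (length rs) (conf 2 p p)
      (2, (\<lambda>j. (case src j of Some i \<Rightarrow> if is_bit (wscan K (conf 2 p p) i)
          then wscan K (conf 2 p p) i else wscan K (conf 2 p p) j | None \<Rightarrow> wscan K (conf 2 p p) j,
                 MRight)), stay)"
      using ex by (auto simp: fstep_def copy_def simp del: update.simps)
    show ?thesis
    proof (rule config.equality)
      show "cells (?step (conf 2 p p)) = cells (conf 2 (Suc p) (Suc p))"
      proof (intro ext)
        fix j z
        show "cells (?step (conf 2 p p)) j z = cells (conf 2 (Suc p) (Suc p)) j z"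
        proof (cases "src j")
          case None
          then show ?thesis unfolding st by (auto simp: wscan_def copied_def)
        next
          case (Some i)
          then have "j < K" "j \<noteq> mk" "i \<in> I" "work_head c j = 0" using tapes(4) heads by auto
          then show ?thesis unfolding st using Some scan_I[of i 2 p p]
            by (auto simp: copied_def wscan_def)
        qed
      qed
    qed (unfold st, auto simp: fun_eq_iff)
  qed
  have turn: "?step (conf 2 L L) = conf 3 L L"
    using len(2) scan_I by (simp add: fstep_def copy_def update_keep_stay conf_def del: update.simps)
  have left: "?step (conf 3 L (Suc p)) = conf 3 L p" if "p < L" for p
    by (rule config.equality)
       (use marker[of "int (Suc p)"] that scan_mk[of 3 L "Suc p"] in
         \<open>auto simp: fstep_def copy_def wscan_def fun_eq_iff\<close>)
  have stop: "?step (conf 3 L 0) = c\<lparr>cstate := 1, cells := copied src mk L (cells c)\<rparr>"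
    using scan_mk[of 3 L 0]
    by (simp add: fstep_def copy_def update_keep_stay conf_def del: update.simps)
       (rule config.equality, auto)
  have run_left: "p \<le> L \<Longrightarrow> leads K (copy src I mk) rs (Suc p) ?P (conf 3 L p)" for p
  proof (induction p)
    case 0
    show ?case by (rule leads_step, rule leads_here) (rule stop)
  next
    case (Suc p)
    show ?case by (rule leads_step) (use Suc left[of p] in simp)
  qed
  have run_right: "n \<le> L \<Longrightarrow> leads K (copy src I mk) rs (n + Suc (Suc L)) ?P (conf 2 (L - n) (L - n))" for n
  proof (induction n)
    case 0
    have "leads K (copy src I mk) rs (Suc (Suc L)) ?P (conf 2 L L)"
      by (rule leads_step) (use run_left[of L] turn in simp)
    then show ?case by simp
  next
    case (Suc n)
    then have "?step (conf 2 (L - Suc n) (L - Suc n)) = conf 2 (L - n) (L - n)"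
      using right[of "L - Suc n"] by (simp add: Suc_diff_Suc)
    then show ?case using Suc by (simp add: leads_step del: add_Suc_right)
  qed
  have "leads K (copy src I mk) rs (Suc (L + Suc (Suc L))) ?P c"
    by (rule leads_step) (use run_right[of L] in \<open>simp add: start\<close>)
  then show ?thesis by (rule leads_mono) auto
qed

section \<open>Composition of polynomial-time functions\<close>

lemma poly_mono_nat:
  fixes p :: "nat poly"
  assumes "x \<le> y"
  shows "poly p x \<le> poly p y"
  by (induction p) (auto intro!: add_mono mult_le_mono assms)

lemma cells_blank_beyond:
  "int (total_length xs) + int t \<le> z \<Longrightarrow> cells ((fstep K D rs ^^ t) (init_config xs)) j z = 0"
proof (induction t)
  case 0
  have "length (xs ! j) \<le> total_length xs" if "j < length xs"
    using that by (intro member_le_sum_list) auto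
  then show ?case using 0 by (auto simp: init_config_def word_cells_def)
next
  case (Suc t)
  let ?c = "(fstep K D rs ^^ t) (init_config xs)"
  obtain q a m where d: "D (cstate ?c) (wscan K ?c) (rscan rs ?c) = (q, a, m)"
    by (metis prod_cases3)
  have eq: "fstep K D rs ?c = (if cstate ?c = 1 then ?c else update K (length rs) ?c (q, a, m))"
    unfolding fstep_def[of K D rs ?c] d ..
  have "\<bar>work_head ?c j\<bar> \<le> int t"
    using head_bound[where K = K and D = D and rs = rs and t = t and c = "init_config xs" and j = j]
    by (simp add: init_config_def)
  then have "work_head ?c j \<noteq> z" using Suc.prems by linarith
  moreover have "cells ?c j z = 0" using Suc by simp
  ultimately show ?case by (simp add: eq)
qed

lemma output_length_bound:
  assumes "leads K D rs T (\<lambda>c. cstate c = 1 \<and> output_word c y) (init_config xs)"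
  shows "length y \<le> total_length xs + T"
proof (rule ccontr)
  let ?N = "total_length xs + T"
  obtain t where t: "t \<le> T" "output_word ((fstep K D rs ^^ t) (init_config xs)) y"
    using assms unfolding leads_def by auto
  assume "\<not> length y \<le> ?N"
  then have "cells ((fstep K D rs ^^ t) (init_config xs)) 0 (int ?N) = bit_sym (y ! ?N)"
    using t(2) unfolding output_word_def by (metis not_le)
  moreover have "cells ((fstep K D rs ^^ t) (init_config xs)) 0 (int ?N) = 0"
    using t(1) by (intro cells_blank_beyond) simp
  ultimately show False by (auto simp: bit_sym_def split: if_splits)
qed

lemma is_bit_word_cells: "is_bit (word_cells x z) \<longleftrightarrow> 0 \<le> z \<and> z < int (length x)"
  by (auto simp: word_cells_def bit_sym_def)

lemma word_cells_copied:
  "length x \<le> L \<Longrightarrow>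
    (\<lambda>z. if 0 \<le> z \<and> z < int L \<and> is_bit (word_cells x z) then word_cells x z else 0) = word_cells x"
  unfolding is_bit_word_cells by (auto simp: word_cells_def fun_eq_iff)

lemma word_cells_output:
  assumes "\<forall>i<length y. w (int i) = bit_sym (y ! i)"
  shows "(\<lambda>z. if 0 \<le> z \<and> z < int (length y) \<and> is_bit (w z) then w z else 0) = word_cells y"
proof
  fix z
  show "(if 0 \<le> z \<and> z < int (length y) \<and> is_bit (w z) then w z else 0) = word_cells y z"
  proof (cases "0 \<le> z \<and> z < int (length y)")
    case True
    then have "w z = bit_sym (y ! nat z)" using assms[rule_format, of "nat z"] by (simp add: nat_less_iff)
    then show ?thesis using True by (auto simp: word_cells_def bit_sym_def)
  qed (auto simp: word_cells_def)
qed

lemma sum_list_map_le: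
  assumes "\<And>i. i < l \<Longrightarrow> h i \<le> (B :: nat)"
  shows "(\<Sum>i\<leftarrow>[0..<l]. h i) \<le> l * B"
proof -
  have "(\<Sum>i\<leftarrow>[0..<l]. h i) \<le> (\<Sum>i\<leftarrow>[0..<l]. B)"
    using assms by (intro sum_list_mono) auto
  then show ?thesis by (simp add: sum_list_triv)
qed

lemma common_length:
  obtains L where "L \<le> total_length xs" "\<forall>i<length xs. length (xs ! i) \<le> L"
    "\<forall>p<L. \<exists>i<length xs. p < length (xs ! i)"
proof
  let ?L = "foldr (\<lambda>x. max (length x)) xs 0"
  show "?L \<le> total_length xs" by (induction xs) auto
  show "\<forall>i<length xs. length (xs ! i) \<le> ?L"
    by (induction xs) (auto simp: nth_Cons split: nat.splits)
  show "\<forall>p<?L. \<exists>i<length xs. p < length (xs ! i)"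
  proof (induction xs)
    case (Cons x xs)
    show ?case
    proof (intro allI impI)
      fix p assume "p < foldr (\<lambda>x. max (length x)) (x # xs) 0"
      then consider "p < length x" | "p < foldr (\<lambda>x. max (length x)) xs 0"
        by (auto simp: less_max_iff_disj)
      then show "\<exists>i<length (x # xs). p < length ((x # xs) ! i)"
        by cases (use Cons in force)+
    qed
  qed simp
qed

text \<open>
  Tape layout of the composed machine: the inputs are on tapes \<open>0, \<dots>, n - 1\<close>, tape \<open>n\<close> marks the
  origin for copying, the outer machine uses tape \<open>0\<close> (the first argument is passed on unchanged,
  and the output is expected there) and tapes \<open>n + i\<close>, and the inner machine uses the rest.
\<close>

lemma polytime_comp:
  assumes A: "polytime m r A" and G: "polytime l r G"
    and nm: "1 \<le> n" "1 \<le> m" "f 0 = 0" and g: "\<And>i. i < l \<Longrightarrow> g i < n"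
  shows "polytime n r (\<lambda>xs rs.
    A (map (\<lambda>i. if f i < n then xs ! f i else G (map (\<lambda>i. xs ! g i) [0..<l]) rs) [0..<m]) rs)"
proof -
  obtain QA SA kA DA pA where
    A: "2 \<le> QA" "3 \<le> SA" "1 \<le> kA" "m \<le> kA" "\<And>S'. SA \<le> S' \<Longrightarrow> in_range QA S' DA"
    and runA: "\<And>xs rs. length xs = m \<Longrightarrow> length rs = r \<Longrightarrow>
       leads kA DA rs (poly pA (total_length xs)) (\<lambda>c. cstate c = 1 \<and> output_word c (A xs rs))
         (init_config xs)"
    by (rule polytimeE[OF A]) blast
  obtain QG SG kG DG pG where
    G: "2 \<le> QG" "3 \<le> SG" "1 \<le> kG" "l \<le> kG" "\<And>S'. SG \<le> S' \<Longrightarrow> in_range QG S' DG"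
    and runG: "\<And>xs rs. length xs = l \<Longrightarrow> length rs = r \<Longrightarrow>
       leads kG DG rs (poly pG (total_length xs)) (\<lambda>c. cstate c = 1 \<and> output_word c (G xs rs))
         (init_config xs)"
    by (rule polytimeE[OF G]) blast
  define S where "S = max SA SG"
  define K where "K = n + kA + Suc kG"
  define eA where "eA i = (if i = 0 then 0 else n + i)" for i :: nat
  define dA where "dA j = (if j = 0 then Some 0 else if n < j \<and> j < n + kA then Some (j - n) else None)"
    for j :: nat
  define eG where "eG i = n + kA + i" for i
  define dG where "dG j = (if n + kA \<le> j \<and> j < n + kA + Suc kG then Some (j - (n + kA)) else None)"
    for j
  define src1 where "src1 j =
    (if n < j \<and> j < n + m \<and> f (j - n) < n then Some (f (j - n))
     else if n + kA \<le> j \<and> j < n + kA + l then Some (g (j - (n + kA))) else None)" for j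
  define src2 where "src2 j = (if n < j \<and> j < n + m \<and> \<not> f (j - n) < n then Some (n + kA) else None)"
    for j
  define D where "D =
    seq (copy src1 {..<n} n)
   (seq (embed (Suc kG) eG dG (homing kG DG))
   (seq (rewind r)
   (seq (copy src2 {n + kA} n)
        (embed kA eA dA DA))))"
  define PG where "PG = pcompose pG [:0, l:]"
  define p where "p = [:13, 2:] + smult 4 PG + smult 2 ([:0, l:] + PG) +
    pcompose pA (smult m ([:0, 1:] + [:0, l:] + PG))"
  have S: "3 \<le> S" "SA \<le> S" "SG \<le> S" using A(2) by (auto simp: S_def)
  have teA: "tape_embedding kA K eA dA" and teG: "tape_embedding (Suc kG) K eG dG"
    using A(3) by (auto simp: tape_embedding_def eA_def dA_def eG_def dG_def K_def)
  obtain Q where Q: "in_range Q S D" "2 \<le> Q"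
  proof
    show "in_range (2 * (4 + (2 * ((2 * QG + 6) + (2 * (3 + (2 * (4 + QA) + 3)) + 3)) + 3)) + 3) S D"
      unfolding D_def using S G(1)
      by (intro in_range_seq in_range_copy in_range_embed in_range_homing in_range_rewind A(5) G(5)) auto
  qed simp
  show ?thesis
  proof (rule polytimeI[OF Q S(1)])
    show "1 \<le> K" "n \<le> K" using A(3) by (auto simp: K_def)
    fix xs :: "bits list" and rs :: "rtape list"
    assume len: "length xs = n" "length rs = r"
    define argsG where "argsG = map (\<lambda>i. xs ! g i) [0..<l]"
    define y where "y = G argsG rs"
    define argsA where "argsA = map (\<lambda>i. if f i < n then xs ! f i else y) [0..<m]"
    define N where "N = total_length xs"
    define TG where "TG = poly pG (total_length argsG)"
    define TA where "TA = poly pA (total_length argsA)"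
    obtain L where L: "L \<le> N" "\<forall>i<n. length (xs ! i) \<le> L" "\<forall>p<L. \<exists>i<n. p < length (xs ! i)"
      using common_length[of xs] len unfolding N_def by metis
    have xs_le: "length (xs ! i) \<le> N" if "i < n" for i using L that le_trans by blast
    have sumG: "total_length argsG \<le> l * N"
      unfolding argsG_def map_map comp_def by (rule sum_list_map_le) (use g xs_le in auto)
    have TG: "TG \<le> poly PG N"
      using poly_mono_nat[OF sumG, of pG] by (simp add: TG_def PG_def poly_pcompose mult.commute)
    have y: "length y \<le> l * N + poly PG N"
      using output_length_bound[OF runG[of argsG rs]] sumG TG len
      by (simp add: y_def TG_def argsG_def)
    have sumA: "total_length argsA \<le> m * (N + (l * N + poly PG N))"
      unfolding argsA_def map_map comp_def
      by (rule sum_list_map_le) (use xs_le y in \<open>auto intro: trans_le_add1 trans_le_add2\<close>)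
    have TA: "TA \<le> poly (pcompose pA (smult m ([:0, 1:] + [:0, l:] + PG))) N"
      using poly_mono_nat[OF sumA, of pA]
      by (simp add: TA_def poly_pcompose algebra_simps)
    have time: "(2 * L + 3) + ((2 * TG + 2) + ((2 * TG + 5) + ((2 * length y + 3) + TA))) \<le> poly p N"
      using L(1) TG y TA by (simp add: p_def mult.commute)
    define c0 where "c0 = init_config xs"
    have c0: "cstate c0 = 0" "work_head c0 = (\<lambda>_. 0)" "rand_head c0 = (\<lambda>_. 0)"
      "cells c0 j = (if j < n then word_cells (xs ! j) else (\<lambda>_. 0))" for j
      using len by (auto simp: c0_def init_config_def)
    define w1 where "w1 = copied src1 n L (cells c0)"
    have w1_keep: "w1 j = cells c0 j" if "j \<noteq> n" "src1 j = None" for j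
      using that by (simp add: w1_def copied_def)
    have w1_copy: "w1 j = word_cells (xs ! i)" if "src1 j = Some i" for i j
    proof -
      have "i < n" "\<not> j < n" "j \<noteq> n" using that g A(3) by (auto simp: src1_def split: if_splits)
      then show ?thesis
        using that L word_cells_copied[of "xs ! i" L] by (simp add: w1_def copied_def c0 cong: if_cong)
    qed
    have w1_n: "w1 n z = (if z = 0 then 1 else 0)" for z
      by (simp add: w1_def copied_def c0)
    define P1 where "P1 c \<longleftrightarrow> cells c = w1 \<and> work_head c = (\<lambda>_. 0) \<and> rand_head c = (\<lambda>_. 0)"
      for c :: config
    have stage1: "leads K (copy src1 {..<n} n) rs (2 * L + 3)
      (\<lambda>c. cstate c = 1 \<and> P1 (c\<lparr>cstate := 0\<rparr>)) c0"
    proof (rule leads_mono[OF leads_copy])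
      show "src1 j = Some i \<Longrightarrow> j < K \<and> j \<notin> {..<n} \<and> j \<noteq> n \<and> i \<in> {..<n}" for i j
        using g A G by (auto simp: src1_def K_def split: if_splits)
      fix i p
      show "\<exists>i\<in>{..<n}. is_bit (cells c0 i (int p))" if "p < L"
      proof -
        obtain i where i: "i < n" "p < length (xs ! i)" using L(3) \<open>p < L\<close> by blast
        have "is_bit (word_cells (xs ! i) (int p))" unfolding is_bit_word_cells using i by simp
        then show ?thesis using i(1) by (intro bexI[of _ i]) (simp_all add: c0)
      qed
      show "\<not> is_bit (cells c0 i (int L))" if i: "i \<in> {..<n}"
      proof -
        have "\<not> is_bit (word_cells (xs ! i) (int L))" unfolding is_bit_word_cells using i L(2) by force
        then show ?thesis using i by (simp add: c0)
      qed
    qed (use c0 in \<open>auto simp: K_def P1_def w1_def\<close>)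
    define P2 where "P2 R c \<longleftrightarrow>
      (\<forall>j<n + kA. cells c j = w1 j \<and> work_head c j = 0) \<and>
      (\<forall>i<length y. cells c (n + kA) (int i) = bit_sym (y ! i)) \<and>
      \<not> is_bit (cells c (n + kA) (int (length y))) \<and>
      work_head c (n + kA) = 0 \<and> (\<forall>j<length rs. \<bar>rand_head c j\<bar> \<le> int R)"
      for R :: nat and c :: config
    have stage2: "leads K (embed (Suc kG) eG dG (homing kG DG)) rs (2 * TG + 2)
      (\<lambda>c. cstate c = 1 \<and> P2 TG (c\<lparr>cstate := 0\<rparr>)) c1" if c1: "cstate c1 = 0" "P1 c1" for c1
    proof -
      have cellsG: "w1 (n + kA + i) = cells (init_config argsG) i" if "i < Suc kG" for i
      proof (cases "i < l")
        case True
        then have "src1 (n + kA + i) = Some (g i)" using A by (auto simp: src1_def)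
        from w1_copy[OF this] True show ?thesis by (simp add: init_config_def argsG_def)
      next
        case False
        then have "src1 (n + kA + i) = None" using A by (auto simp: src1_def)
        then show ?thesis using False A by (simp add: w1_keep c0 init_config_def argsG_def)
      qed
      have em: "embeds (Suc kG) eG dG (length rs) c1 (init_config argsG) c1"
        using c1 cellsG by (auto simp: embeds_def P1_def eG_def init_config_def)
      have "leads kG DG rs TG (\<lambda>c. cstate c = 1 \<and> output_word c y) (init_config argsG)"
        unfolding TG_def y_def by (rule runG) (use len in \<open>auto simp: argsG_def\<close>)
      from leads_homing[OF this]
      have hom: "leads (Suc kG) (homing kG DG) rs (2 * TG + 2)
        (\<lambda>C. cstate C = 1 \<and> work_head C 0 = 0 \<and> (\<forall>j. j < length rs \<longrightarrow> \<bar>rand_head C j\<bar> \<le> int TG) \<and>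
         (\<exists>c. output_word c y \<and> cells C 0 = cells c 0)) (init_config argsG)"
        using G by (simp add: argsG_def)
      show ?thesis
      proof (rule leads_embed[OF teG em hom])
        fix c' c
        assume c: "embeds (Suc kG) eG dG (length rs) c1 c' c"
          and "work_head c' 0 = 0 \<and> (\<forall>j. j < length rs \<longrightarrow> \<bar>rand_head c' j\<bar> \<le> int TG) \<and>
            (\<exists>c. output_word c y \<and> cells c' 0 = cells c 0)"
        then obtain c'' where c': "work_head c' 0 = 0" "\<forall>j. j < length rs \<longrightarrow> \<bar>rand_head c' j\<bar> \<le> int TG"
          "output_word c'' y" "cells c' 0 = cells c'' 0" by blast
        have 1: "cells c j = w1 j \<and> work_head c j = 0" if "j < n + kA" for j
          using c c1(2) that by (auto simp: embeds_def dG_def P1_def)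
        have 2: "cells c (n + kA) = cells c'' 0" "work_head c (n + kA) = 0"
          using c c'(1,4) by (auto simp: embeds_def eG_def)
        have 3: "\<forall>j<length rs. \<bar>rand_head c j\<bar> \<le> int TG"
          using c c'(2) by (auto simp: embeds_def)
        show "P2 TG (c\<lparr>cstate := 0\<rparr>)"
          using c'(3) 1 2 3 unfolding P2_def output_word_def range_bit_sym by simp
      qed
    qed
    have stage3: "leads K (rewind r) rs (2 * TG + 5)
      (\<lambda>c. cstate c = 1 \<and> P2 0 (c\<lparr>cstate := 0\<rparr>)) c2" if c2: "cstate c2 = 0" "P2 TG c2" for c2
      unfolding len(2)[symmetric]
      by (rule leads_mono[OF leads_rewind[OF c2(1)]]) (use c2 in \<open>auto simp: P2_def\<close>)
    define P4 where "P4 c \<longleftrightarrow> (\<forall>i<kA. cells c (eA i) = cells (init_config argsA) i \<and>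
      work_head c (eA i) = 0) \<and> (\<forall>j<length rs. rand_head c j = 0)" for c :: config
    have stage4: "leads K (copy src2 {n + kA} n) rs (2 * length y + 3)
      (\<lambda>c. cstate c = 1 \<and> P4 (c\<lparr>cstate := 0\<rparr>)) c3" if c3: "cstate c3 = 0" "P2 0 c3" for c3
    proof (rule leads_mono[OF leads_copy])
      show "src2 j = Some i \<Longrightarrow> j < K \<and> j \<notin> {n + kA} \<and> j \<noteq> n \<and> i \<in> {n + kA}" for i j
        using A by (auto simp: src2_def K_def split: if_splits)
      show "src2 j = Some i \<Longrightarrow> work_head c3 j = 0" for i j
        using A c3 by (auto simp: src2_def P2_def split: if_splits)
      show "0 < z \<Longrightarrow> cells c3 n z \<noteq> 1" for z
        using c3 w1_n A(3) by (simp add: P2_def)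
      show "p < length y \<Longrightarrow> \<exists>i\<in>{n + kA}. is_bit (cells c3 i (int p))" for p
        using c3 by (simp add: P2_def bit_sym_def)
    next
      fix c
      assume c: "c = c3\<lparr>cstate := 1, cells := copied src2 n (length y) (cells c3)\<rparr>"
      have "cells c (eA i) = cells (init_config argsA) i" if "i < kA" for i
      proof (cases "i = 0")
        case True
        then have "src1 0 = None" "src2 0 = None" using nm A by (auto simp: src1_def src2_def)
        then show ?thesis
          using True c3 nm A by (simp add: c copied_def eA_def P2_def w1_keep c0 init_config_def argsA_def)
      next
        case False
        have c3i: "cells c3 (n + i) = w1 (n + i)" using c3(2) \<open>i < kA\<close> by (simp add: P2_def)
        show ?thesis
        proof (cases "i < m \<and> \<not> f i < n")
          case True
          then have "src1 (n + i) = None" "src2 (n + i) = Some (n + kA)"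
            using False \<open>i < kA\<close> by (auto simp: src1_def src2_def)
          then show ?thesis
            using True False c3(2) c3i word_cells_output[of y "cells c3 (n + kA)"]
            by (simp add: c copied_def eA_def w1_keep c0 init_config_def argsA_def P2_def cong: if_cong)
        next
          case not_y: False
          then have src2: "src2 (n + i) = None" by (auto simp: src2_def)
          show ?thesis
          proof (cases "i < m")
            case True
            then have "src1 (n + i) = Some (f i)" using False not_y by (auto simp: src1_def)
            then show ?thesis
              using True False not_y c3i src2
              by (simp add: c copied_def eA_def w1_copy init_config_def argsA_def)
          next
            case i: False
            then have "src1 (n + i) = None" using \<open>i < kA\<close> by (auto simp: src1_def)
            then show ?thesis
              using i False c3i src2
              by (simp add: c copied_def eA_def w1_keep c0 init_config_def argsA_def)
          qed
        qed
      qed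
      then show "cstate c = 1 \<and> P4 (c\<lparr>cstate := 0\<rparr>)"
        using c3 nm by (auto simp: P4_def P2_def c eA_def)
    qed (use c3 A(3) in \<open>auto simp: P2_def K_def\<close>)
    have stage5: "leads K (embed kA eA dA DA) rs TA
      (\<lambda>c. cstate c = 1 \<and> output_word c (A argsA rs)) c4" if c4: "cstate c4 = 0" "P4 c4" for c4
    proof -
      have em: "embeds kA eA dA (length rs) c4 (init_config argsA) c4"
        using c4 by (auto simp: embeds_def P4_def init_config_def)
      have "leads kA DA rs TA (\<lambda>c. cstate c = 1 \<and> output_word c (A argsA rs)) (init_config argsA)"
        unfolding TA_def by (rule runA) (use len in \<open>auto simp: argsA_def\<close>)
      then show ?thesis
      proof (rule leads_embed[OF teA em])
        fix c' c
        assume c': "embeds kA eA dA (length rs) c4 c' c" "output_word c' (A argsA rs)"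
        have "cells c (eA 0) = cells c' 0" using c'(1) A(3) by (auto simp: embeds_def)
        then show "output_word c (A argsA rs)"
          using c'(2) by (simp add: eA_def output_word_def)
      qed
    qed
    have "leads K D rs ((2 * L + 3) + ((2 * TG + 2) + ((2 * TG + 5) + ((2 * length y + 3) + TA))))
      (\<lambda>c. cstate c = 1 \<and> output_word c (A argsA rs)) c0"
      unfolding D_def
      by (rule leads_seq[where P = P1, OF c0(1) stage1],
          rule leads_seq[where P = "P2 TG", OF _ stage2], assumption+,
          rule leads_seq[where P = "P2 0", OF _ stage3], assumption+,
          rule leads_seq[where P = P4, OF _ stage4], assumption+, rule stage5)
    then show "leads K D rs (poly p (total_length xs))
      (\<lambda>c. cstate c = 1 \<and> output_word c
        (A (map (\<lambda>i. if f i < n then xs ! f i else G (map (\<lambda>i. xs ! g i) [0..<l]) rs) [0..<m]) rs))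
      (init_config xs)"
      using time unfolding c0_def argsA_def y_def argsG_def N_def by (rule leads_mono)
  qed
qed

section \<open>Locality of polynomial-time functions and elementary machines\<close>

lemma output_word_unique:
  assumes "output_word c x" "output_word c y"
  shows "x = y"
proof -
  have *: "length x \<le> length y \<and> (\<forall>i<length x. i < length y \<longrightarrow> x ! i = y ! i)"
    if "output_word c x" "output_word c y" for x y
  proof -
    have "length x \<le> length y"
    proof (rule ccontr)
      assume "\<not> length x \<le> length y"
      then have "cells c 0 (int (length y)) \<in> range bit_sym"
        using that(1) by (simp add: output_word_def)
      then show False using that(2) by (simp add: output_word_def)
    qed
    moreover have "bit_sym a = bit_sym b \<longleftrightarrow> a = b" for a b by (simp add: bit_sym_def)
    ultimately show ?thesis using that unfolding output_word_def by metis
  qed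
  show ?thesis
    using *[OF assms] *[OF assms(2,1)] by (intro nth_equalityI) auto
qed

lemma output_word_init: "xs \<noteq> [] \<Longrightarrow> cells c 0 = cells (init_config xs) 0 \<Longrightarrow> output_word c (xs ! 0)"
  by (auto simp: output_word_def init_config_def word_cells_def bit_sym_def image_iff)

lemma leads_at:
  assumes "leads K D rs T (\<lambda>c. cstate c = 1 \<and> P c) c"
  shows "cstate ((fstep K D rs ^^ T) c) = 1" "P ((fstep K D rs ^^ T) c)"
proof -
  obtain t where t: "t \<le> T" "cstate ((fstep K D rs ^^ t) c) = 1" "P ((fstep K D rs ^^ t) c)"
    using assms unfolding leads_def by auto
  have "(fstep K D rs ^^ T) c = (fstep K D rs ^^ (T - t)) ((fstep K D rs ^^ t) c)"
    using t(1) by (simp flip: funpow_add comp_apply[of "_ ^^ _" "_ ^^ _"])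
  also have "\<dots> = (fstep K D rs ^^ t) c"
    by (rule funpow_fixed) (rule fstep_halted, rule t)
  finally show "cstate ((fstep K D rs ^^ T) c) = 1" "P ((fstep K D rs ^^ T) c)" using t by auto
qed

lemma funpow_agree:
  assumes "length rs' = length rs" "\<forall>j<length rs. \<forall>i<T. (rs ! j) i = (rs' ! j) i"
  shows "t \<le> T \<Longrightarrow> (fstep K D rs ^^ t) (init_config xs) = (fstep K D rs' ^^ t) (init_config xs)"
proof (induction t)
  case (Suc t)
  let ?c = "(fstep K D rs ^^ t) (init_config xs)"
  have "rscan rs ?c j = rscan rs' ?c j" for j
  proof (cases "j < length rs")
    case True
    have "\<bar>rand_head ?c j\<bar> \<le> int t"
      using head_bound[where K = K and D = D and rs = rs and t = t and c = "init_config xs" and j = j]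
      by (simp add: init_config_def)
    then have "nat (rand_head ?c j) < T" using Suc.prems by linarith
    then show ?thesis using assms True by (simp add: rscan_def rand_cells_def)
  qed (use assms in \<open>simp add: rscan_def\<close>)
  then have "rscan rs ?c = rscan rs' ?c" by (rule ext)
  then have "fstep K D rs ?c = fstep K D rs' ?c" by (simp add: fstep_def assms(1))
  then show ?case using Suc by simp
qed simp

lemma polytime_bounded:
  assumes "polytime n r F"
  obtains q where
    "\<And>xs rs. length xs = n \<Longrightarrow> length rs = r \<Longrightarrow> length (F xs rs) \<le> poly q (total_length xs)"
    "\<And>xs rs rs'. length xs = n \<Longrightarrow> length rs = r \<Longrightarrow> length rs' = r \<Longrightarrow>
       \<forall>j<r. \<forall>i<poly q (total_length xs). (rs ! j) i = (rs' ! j) i \<Longrightarrow> F xs rs = F xs rs'"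
proof -
  obtain Q S K D p where run: "\<And>xs rs. length xs = n \<Longrightarrow> length rs = r \<Longrightarrow>
       leads K D rs (poly p (total_length xs)) (\<lambda>c. cstate c = 1 \<and> output_word c (F xs rs))
         (init_config xs)"
    by (rule polytimeE[OF assms]) blast
  show thesis
  proof (rule that[of "[:0, 1:] + p"])
    fix xs :: "bits list" and rs :: "rtape list"
    assume "length xs = n" "length rs = r"
    from output_length_bound[OF run[OF this]]
    show "length (F xs rs) \<le> poly ([:0, 1:] + p) (total_length xs)" by simp
  next
    fix xs :: "bits list" and rs rs' :: "rtape list"
    assume *: "length xs = n" "length rs = r" "length rs' = r"
      "\<forall>j<r. \<forall>i<poly ([:0, 1:] + p) (total_length xs). (rs ! j) i = (rs' ! j) i"
    let ?T = "poly p (total_length xs)"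
    have "(fstep K D rs ^^ ?T) (init_config xs) = (fstep K D rs' ^^ ?T) (init_config xs)"
      using * by (intro funpow_agree[of _ _ ?T]) auto
    then show "F xs rs = F xs rs'"
      using leads_at(2)[OF run, of xs rs] leads_at(2)[OF run, of xs rs'] *(1-3)
      by (metis output_word_unique)
  qed
qed

lemma polytime_lift:
  assumes "polytime n 0 (\<lambda>xs rs. F xs)"
  shows "polytime n r (\<lambda>xs rs. F xs)"
proof -
  obtain Q S K D p where *: "2 \<le> Q" "3 \<le> S" "1 \<le> K" "n \<le> K"
    "\<And>S'. S \<le> S' \<Longrightarrow> in_range Q S' D"
    and run: "\<And>xs rs. length xs = n \<Longrightarrow> length rs = 0 \<Longrightarrow>
       leads K D rs (poly p (total_length xs)) (\<lambda>c. cstate c = 1 \<and> output_word c (F xs))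
         (init_config xs)"
    by (rule polytimeE[OF assms]) blast
  define D' :: delta where "D' q ss bs = (case D q ss (\<lambda>_. 0) of (q', a, m) \<Rightarrow> (q', a, stay))" for q ss bs
  have "in_range Q S D'"
  proof (rule in_rangeI)
    fix q ss bs q' a m
    assume h: "\<forall>j. ss j < S" "\<forall>j. bs j < (3::nat)" "D' q ss bs = (q', a, m)"
    then obtain m' where "D q ss (\<lambda>_. 0) = (q', a, m')" by (auto simp: D'_def split: prod.splits)
    then show "q' < Q \<and> (\<forall>j. fst (a j) < S)"
      using in_rangeD[OF *(5)[OF order.refl], of ss "\<lambda>_. 0" q q' a m'] h(1) by simp
  qed
  moreover have eq: "fstep K D' rs = fstep K D []" for rs
  proof
    fix c
    have "rscan [] c = (\<lambda>_. 0)" by (auto simp: rscan_def)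
    then show "fstep K D' rs c = fstep K D [] c"
      by (cases "D (cstate c) (wscan K c) (\<lambda>_. 0)") (auto simp: fstep_def D'_def)
  qed
  have "leads K D' rs = leads K D []" for rs
    by (intro ext) (simp add: leads_def eq)
  ultimately show ?thesis
    using *(1-4) run[of _ "[]"] by (intro polytimeI[of Q S D' K _ r p]) auto
qed

definition halt :: delta where
  "halt q ss bs = (1, keep ss, stay)"

lemma leads_halt:
  "leads K halt rs (Suc T) (\<lambda>c'. cstate c' = 1 \<and> cells c' = cells c) c"
proof (rule leads_step)
  show "leads K halt rs T (\<lambda>c'. cstate c' = 1 \<and> cells c' = cells c) (fstep K halt rs c)"
    by (rule leads_here) (auto simp: fstep_def halt_def update_keep_stay simp del: update.simps)
qed

lemma in_range_halt: "in_range 2 S halt"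
  by (rule in_rangeI) (auto simp: halt_def)

lemma polytime_nil: "polytime 0 r (\<lambda>xs rs. [])"
proof (rule polytimeI[OF in_range_halt, of 3 1 _ _ "[:1:]"])
  fix xs :: "bits list" and rs :: "rtape list"
  assume "length xs = 0"
  then show "leads 1 halt rs (poly [:1:] (total_length xs))
    (\<lambda>c. cstate c = 1 \<and> output_word c []) (init_config xs)"
    by (intro leads_mono[OF leads_halt[of _ _ 0]])
      (auto simp: output_word_def init_config_def bit_sym_def)
qed auto

lemma polytime_first: "polytime 1 r (\<lambda>xs rs. xs ! 0)"
proof (rule polytimeI[OF in_range_halt, of 3 1 _ _ "[:1:]"])
  fix xs :: "bits list" and rs :: "rtape list"
  assume "length xs = 1"
  then show "leads 1 halt rs (poly [:1:] (total_length xs))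
    (\<lambda>c. cstate c = 1 \<and> output_word c (xs ! 0)) (init_config xs)"
    by (intro leads_mono[OF leads_halt[of _ _ 0]]) (auto intro!: output_word_init)
qed auto

lemma polytime_cong:
  assumes "\<And>xs rs. length xs = n \<Longrightarrow> length rs = r \<Longrightarrow> F xs rs = G xs rs" "polytime n r F"
  shows "polytime n r G"
proof -
  obtain M p where M: "wf_machine n r M" "\<And>xs rs. length xs = n \<and> length rs = r \<Longrightarrow>
           (\<exists>t \<le> poly p (total_length xs).
              (let c = (step M rs ^^ t) (init_config xs)
               in cstate c = 1 \<and> output_word c (F xs rs)))"
    using assms(2) unfolding polytime_def by metis
  show ?thesis unfolding polytime_def
    by (rule exI[of _ M], rule exI[of _ p]) (use M assms(1) in auto)
qed

lemma polytime_reindex: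
  assumes "polytime m r A" "1 \<le> n" "1 \<le> m" "f 0 = 0" "\<And>i. i < m \<Longrightarrow> f i < n"
  shows "polytime n r (\<lambda>xs rs. A (map (\<lambda>i. xs ! f i) [0..<m]) rs)"
proof (rule polytime_cong[OF _ polytime_comp[where A = A and G = "\<lambda>xs rs. []" and l = 0 and f = f and
      g = id, OF assms(1) polytime_nil assms(2-4)]])
  fix xs and rs :: "rtape list"
  show "A (map (\<lambda>i. if f i < n then xs ! f i else []) [0..<m]) rs =
    A (map (\<lambda>i. xs ! f i) [0..<m]) rs"
    using assms(5) by (intro arg_cong2[of _ _ _ _ A] map_cong) auto
qed simp

definition decide :: "(bool \<Rightarrow> bool \<Rightarrow> bool) \<Rightarrow> delta" where
  "decide \<phi> q ss bs =
     (if q = 0 then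
        (2 + of_bool (ss 1 = 2) + 2 * of_bool (ss 2 = 2),
         (\<lambda>j. (ss j, if j = 0 then MStay else MRight)), stay)
      else if q < 6 then
        (6, (\<lambda>j. if j = 0 then (bit_sym (\<phi> (odd q \<and> ss 1 = 0) (4 \<le> q \<and> ss 2 = 0)), MRight)
                else (ss j, MStay)), stay)
      else (1, (\<lambda>j. if j = 0 then (0, MStay) else (ss j, MStay)), stay))"

lemma in_range_decide: "in_range 7 3 (decide \<phi>)"
  by (rule in_rangeI) (auto simp: decide_def bit_sym_def split: if_splits)

lemma eq_True_iff_word_cells: "x = [True] \<longleftrightarrow> word_cells x 0 = 2 \<and> word_cells x 1 = 0"
  by (cases x; cases "tl x") (auto simp: word_cells_def bit_sym_def)

lemma polytime_decide:
  "polytime 3 r (\<lambda>xs rs. [\<phi> (xs ! 1 = [True]) (xs ! 2 = [True])])"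
proof (rule polytimeI[OF in_range_decide, where p = "[:3:]"])
  fix xs :: "bits list" and rs :: "rtape list"
  assume len: "length xs = 3"
  define b1 where "b1 \<longleftrightarrow> word_cells (xs ! 1) 0 = 2"
  define b2 where "b2 \<longleftrightarrow> word_cells (xs ! 2) 0 = 2"
  define c0 where "c0 = init_config xs"
  define c1 where "c1 = fstep 3 (decide \<phi>) rs c0"
  define c2 where "c2 = fstep 3 (decide \<phi>) rs c1"
  let ?v = "\<phi> (xs ! 1 = [True]) (xs ! 2 = [True])"
  have 1: "cstate c1 = 2 + of_bool b1 + 2 * of_bool b2"
    "cells c1 1 = word_cells (xs ! 1)" "cells c1 2 = word_cells (xs ! 2)"
    "work_head c1 0 = 0" "work_head c1 1 = 1" "work_head c1 2 = 1"
    using len by (auto simp: c1_def c0_def fstep_def decide_def wscan_def init_config_def b1_def b2_def)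
  have c2: "c2 = update 3 (length rs) c1
    (6, (\<lambda>j. if j = 0 then (bit_sym ?v, MRight) else (wscan 3 c1 j, MStay)), stay)"
  proof -
    have "cstate c1 \<noteq> 1" "cstate c1 \<noteq> 0" "cstate c1 < 6" "odd (cstate c1) = b1" "(4 \<le> cstate c1) = b2"
      unfolding 1(1) by (cases b1; cases b2; simp)+
    moreover have "(xs ! 1 = [True]) = (b1 \<and> wscan 3 c1 1 = 0)" "(xs ! 2 = [True]) = (b2 \<and> wscan 3 c1 2 = 0)"
      unfolding eq_True_iff_word_cells using 1(2-) by (auto simp: b1_def b2_def wscan_def)
    ultimately show ?thesis by (simp add: c2_def fstep_def decide_def del: update.simps cong: if_cong)
  qed
  have 2: "cstate c2 = 6" "cells c2 0 0 = bit_sym ?v" "work_head c2 0 = 1"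
    unfolding c2 using 1 by auto
  have 3: "cstate (fstep 3 (decide \<phi>) rs c2) = 1" "cells (fstep 3 (decide \<phi>) rs c2) 0 0 = bit_sym ?v"
    "cells (fstep 3 (decide \<phi>) rs c2) 0 1 = 0"
    using 2 by (auto simp: fstep_def decide_def)
  have "leads 3 (decide \<phi>) rs 0 (\<lambda>c. cstate c = 1 \<and> output_word c [?v]) (fstep 3 (decide \<phi>) rs c2)"
    by (rule leads_here) (use 3 in \<open>simp add: output_word_def range_bit_sym\<close>)
  then have "leads 3 (decide \<phi>) rs (Suc (Suc (Suc 0))) (\<lambda>c. cstate c = 1 \<and> output_word c [?v]) (init_config xs)"
    unfolding c2_def c1_def c0_def by (intro leads_step)
  then show "leads 3 (decide \<phi>) rs (poly [:3:] (total_length xs))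
    (\<lambda>c. cstate c = 1 \<and> output_word c [?v]) (init_config xs)"
    by (simp add: numeral_3_eq_3)
qed auto

section \<open>Unary products and sampling of random bits\<close>

lemma fstep_update:
  "cstate c \<noteq> 1 \<Longrightarrow> D (cstate c) (wscan K c) (rscan rs c) = d \<Longrightarrow>
    fstep K D rs c = update K (length rs) c d"
  by (simp add: fstep_def)

lemma word_cells_eq_0_iff: "word_cells x z = 0 \<longleftrightarrow> \<not> (0 \<le> z \<and> z < int (length x))"
  by (auto simp: word_cells_def bit_sym_def)

text \<open>Products of lengths are needed to reach polynomially distant cells of a random tape.\<close>

definition multiply :: delta where
  "multiply q ss bs =
     (if q = 0 then
        (if ss 1 = 0 then (1, (\<lambda>j. if j = 0 then (0, MStay) else (ss j, MStay)), stay)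
         else (2, keep ss, stay))
      else if q = 2 then
        (if ss 2 = 0 then (3, (\<lambda>j. (ss j, if j = 2 then MLeft else MStay)), stay)
         else (2, (\<lambda>j. if j = 0 then (1, MRight) else (ss j, if j = 2 then MRight else MStay)), stay))
      else
        (if ss 2 = 0 then (0, (\<lambda>j. (ss j, if j = 1 \<or> j = 2 then MRight else MStay)), stay)
         else (3, (\<lambda>j. (ss j, if j = 2 then MLeft else MStay)), stay)))"

lemma in_range_multiply: "in_range 4 3 multiply"
  by (rule in_rangeI) (auto simp: multiply_def split: if_splits)

definition multiplying :: "bits \<Rightarrow> bits \<Rightarrow> nat \<Rightarrow> nat \<Rightarrow> int \<Rightarrow> nat \<Rightarrow> config \<Rightarrow> bool" where
  "multiplying x y q a b m c \<longleftrightarrow>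
     cstate c = q \<and> cells c 1 = word_cells x \<and> cells c 2 = word_cells y \<and>
     work_head c 1 = int a \<and> work_head c 2 = b \<and> work_head c 0 = int m \<and>
     (\<forall>i<m. cells c 0 (int i) = 1)"

lemma multiplying_scan:
  assumes "multiplying x y q a b m c"
  shows "wscan 3 c 1 = word_cells x (int a)" "wscan 3 c 2 = word_cells y b" "cstate c = q"
  using assms by (auto simp: multiplying_def wscan_def)

lemma multiply_inner:
  "k \<le> length y \<Longrightarrow> multiplying x y 2 a (int (length y - k)) m c \<Longrightarrow>
    leads 3 multiply rs k (multiplying x y 2 a (int (length y)) (m + k)) c"
proof (induction k arbitrary: m c)
  case 0
  then show ?case by (intro leads_here) simp
next
  case (Suc k)
  let ?c = "fstep 3 multiply rs c"
  have "wscan 3 c 2 \<noteq> 0"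
    using Suc.prems by (simp add: multiplying_scan[OF Suc.prems(2)] word_cells_eq_0_iff)
  then have "?c = update 3 (length rs) c
     (2, (\<lambda>j. if j = 0 then (1, MRight) else (wscan 3 c j, if j = 2 then MRight else MStay)), stay)"
    using multiplying_scan(3)[OF Suc.prems(2)] by (intro fstep_update) (auto simp: multiply_def)
  then have "multiplying x y 2 a (int (length y - k)) (Suc m) ?c"
    using Suc.prems by (auto simp: multiplying_def wscan_def less_Suc_eq of_nat_diff)
  from Suc.IH[OF _ this] show ?case
    using Suc.prems by (intro leads_step) simp
qed

lemma multiply_back:
  "k \<le> length y \<Longrightarrow> multiplying x y 3 a (int k - 1) m c \<Longrightarrow>
    leads 3 multiply rs (Suc k) (multiplying x y 0 (Suc a) 0 m) c"
proof (induction k arbitrary: c)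
  case 0
  let ?c = "fstep 3 multiply rs c"
  have "wscan 3 c 2 = 0"
    using 0 by (simp add: multiplying_scan[OF 0(2)] word_cells_eq_0_iff)
  then have "?c = update 3 (length rs) c
     (0, (\<lambda>j. (wscan 3 c j, if j = 1 \<or> j = 2 then MRight else MStay)), stay)"
    using multiplying_scan(3)[OF 0(2)] by (intro fstep_update) (auto simp: multiply_def)
  then have "multiplying x y 0 (Suc a) 0 m ?c"
    using 0 by (auto simp: multiplying_def wscan_def)
  then show ?case by (intro leads_step leads_here)
next
  case (Suc k)
  let ?c = "fstep 3 multiply rs c"
  have "wscan 3 c 2 \<noteq> 0"
    using Suc.prems by (simp add: multiplying_scan[OF Suc.prems(2)] word_cells_eq_0_iff)
  then have "?c = update 3 (length rs) c
     (3, (\<lambda>j. (wscan 3 c j, if j = 2 then MLeft else MStay)), stay)"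
    using multiplying_scan(3)[OF Suc.prems(2)] by (intro fstep_update) (auto simp: multiply_def)
  then have "multiplying x y 3 a (int k - 1) m ?c"
    using Suc.prems by (auto simp: multiplying_def wscan_def)
  from Suc.IH[OF _ this] Suc.prems(1) show ?case by (auto intro: leads_step)
qed

lemma multiply_round:
  assumes "a < length x" "multiplying x y 0 a 0 m c"
  shows "leads 3 multiply rs (2 * length y + 3) (multiplying x y 0 (Suc a) 0 (m + length y)) c"
proof -
  have "wscan 3 c 1 \<noteq> 0"
    unfolding multiplying_scan[OF assms(2)] word_cells_eq_0_iff using assms(1) by simp
  then have "fstep 3 multiply rs c = update 3 (length rs) c (2, keep (wscan 3 c), stay)"
    using multiplying_scan(3)[OF assms(2)] by (intro fstep_update) (auto simp: multiply_def)
  then have 1: "multiplying x y 2 a (int (length y - length y)) m (fstep 3 multiply rs c)"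
    using assms by (auto simp: multiplying_def update_keep_stay simp del: update.simps)
  have 2: "leads 3 multiply rs (Suc (length y)) (multiplying x y 2 a (int (length y)) (m + length y)) c"
    by (rule leads_step, rule multiply_inner[OF _ 1]) simp
  have 3: "leads 3 multiply rs (Suc (Suc (length y))) (multiplying x y 0 (Suc a) 0 (m + length y)) c'"
    if c': "multiplying x y 2 a (int (length y)) (m + length y) c'" for c'
  proof -
    have "wscan 3 c' 2 = 0"
      by (simp add: multiplying_scan[OF c'] word_cells_eq_0_iff)
    then have "fstep 3 multiply rs c' = update 3 (length rs) c'
       (3, (\<lambda>j. (wscan 3 c' j, if j = 2 then MLeft else MStay)), stay)"
      using multiplying_scan(3)[OF c'] by (intro fstep_update) (auto simp: multiply_def)
    then have "multiplying x y 3 a (int (length y) - 1) (m + length y) (fstep 3 multiply rs c')"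
      using c' by (auto simp: multiplying_def wscan_def)
    from leads_step[OF multiply_back[OF order.refl this]] show ?thesis .
  qed
  show ?thesis by (rule leads_trans[OF 2 3]) auto
qed

lemma multiply_run:
  "k \<le> length x \<Longrightarrow> multiplying x y 0 (length x - k) 0 m c \<Longrightarrow>
    leads 3 multiply rs (k * (2 * length y + 3) + 1)
      (\<lambda>c. cstate c = 1 \<and> output_word c (replicate (m + k * length y) False)) c"
proof (induction k arbitrary: m c)
  case 0
  have "wscan 3 c 1 = 0"
    unfolding multiplying_scan[OF 0(2)] word_cells_eq_0_iff by simp
  then have st: "fstep 3 multiply rs c = update 3 (length rs) c
      (1, (\<lambda>j. if j = 0 then (0, MStay) else (wscan 3 c j, MStay)), stay)"
    using multiplying_scan(3)[OF 0(2)] by (intro fstep_update) (auto simp: multiply_def)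
  have "cstate (fstep 3 multiply rs c) = 1 \<and> output_word (fstep 3 multiply rs c) (replicate m False)"
    unfolding st using 0 by (auto simp: multiplying_def output_word_def bit_sym_def image_iff)
  then have "leads 3 multiply rs (Suc 0)
      (\<lambda>c. cstate c = 1 \<and> output_word c (replicate m False)) c"
    by (intro leads_step leads_here)
  then show ?case by simp
next
  case (Suc k)
  then have "leads 3 multiply rs (2 * length y + 3) (multiplying x y 0 (length x - k) 0 (m + length y)) c"
    using multiply_round[of "length x - Suc k" x y m c rs] by (simp add: Suc_diff_Suc)
  then have "leads 3 multiply rs (Suc k * (2 * length y + 3) + 1)
      (\<lambda>c. cstate c = 1 \<and> output_word c (replicate ((m + length y) + k * length y) False)) c"
    by (rule leads_trans[OF _ Suc.IH]) (use Suc.prems(1) in auto)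
  then show ?case by (simp add: add.assoc)
qed

lemma polytime_multiply:
  "polytime 3 r (\<lambda>xs rs. replicate (length (xs ! 1) * length (xs ! 2)) False)"
proof (rule polytimeI[OF in_range_multiply, where p = "[:1, 3, 2:]"])
  fix xs :: "bits list" and rs :: "rtape list"
  assume len: "length xs = 3"
  let ?x = "xs ! 1" and ?y = "xs ! 2" and ?N = "\<Sum>x\<leftarrow>xs. length x"
  have "multiplying ?x ?y 0 (length ?x - length ?x) 0 0 (init_config xs)"
    using len by (auto simp: multiplying_def init_config_def)
  note run = multiply_run[OF order.refl this]
  have "length ?x \<le> ?N" "length ?y \<le> ?N"
    using len by (auto intro!: member_le_sum_list)
  then have "length ?x * (2 * length ?y + 3) \<le> ?N * (2 * ?N + 3)"
    by (intro mult_le_mono) auto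
  then have "length ?x * (2 * length ?y + 3) + 1 \<le> poly [:1, 3, 2:] ?N"
    by (simp add: algebra_simps)
  then show "leads 3 multiply rs (poly [:1, 3, 2:] ?N)
    (\<lambda>c. cstate c = 1 \<and> output_word c (replicate (length ?x * length ?y) False)) (init_config xs)"
    by (rule leads_mono[OF run]) simp
qed auto

definition slice :: delta where
  "slice q ss bs =
     (if q = 0 then
        (if ss 1 = 0 then (2, keep ss, stay)
         else (0, (\<lambda>j. (ss j, if j = 1 then MRight else MStay)), (\<lambda>_. MRight)))
      else
        (if ss 0 = 0 then (1, keep ss, stay)
         else (2, (\<lambda>j. if j = 0 then (bs 0, MRight) else (ss j, MStay)), (\<lambda>_. MRight))))"

lemma in_range_slice: "in_range 3 3 slice"
  by (rule in_rangeI) (auto simp: slice_def split: if_splits)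

lemma slice_skip:
  "k \<le> length x \<Longrightarrow>
   cstate c = 0 \<and> cells c 0 = word_cells w \<and> cells c 1 = word_cells x \<and> work_head c 0 = 0 \<and>
     work_head c 1 = int (length x - k) \<and> rand_head c 0 = int (length x - k) \<Longrightarrow>
   leads 2 slice [\<rho>] (Suc k)
     (\<lambda>c. cstate c = 2 \<and> cells c 0 = word_cells w \<and> work_head c 0 = 0 \<and>
       rand_head c 0 = int (length x)) c" (is "_ \<Longrightarrow> _ \<Longrightarrow> leads 2 slice _ _ ?P c")
proof (induction k arbitrary: c)
  case 0
  then have "wscan 2 c 1 = 0" by (simp add: wscan_def word_cells_eq_0_iff)
  then have "fstep 2 slice [\<rho>] c = update 2 (length [\<rho>]) c (2, keep (wscan 2 c), stay)"
    using 0 by (intro fstep_update) (auto simp: slice_def)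
  then have "fstep 2 slice [\<rho>] c = c\<lparr>cstate := 2\<rparr>" by (simp only: update_keep_stay)
  then show ?case using 0 by (intro leads_step leads_here) simp
next
  case (Suc k)
  let ?c = "fstep 2 slice [\<rho>] c"
  have "wscan 2 c 1 \<noteq> 0" using Suc.prems by (simp add: wscan_def word_cells_eq_0_iff)
  then have "?c = update 2 (length [\<rho>]) c
      (0, (\<lambda>j. (wscan 2 c j, if j = 1 then MRight else MStay)), (\<lambda>_. MRight))"
    using Suc.prems by (intro fstep_update) (auto simp: slice_def)
  then have "cstate ?c = 0 \<and> cells ?c 0 = word_cells w \<and> cells ?c 1 = word_cells x \<and>
     work_head ?c 0 = 0 \<and> work_head ?c 1 = int (length x - k) \<and> rand_head ?c 0 = int (length x - k)"
    using Suc.prems by (auto simp: wscan_def of_nat_diff)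
  then have "leads 2 slice [\<rho>] (Suc k) ?P ?c" using Suc.IH[of ?c] Suc.prems(1) by simp
  then show ?case by (rule leads_step)
qed

lemma slice_write:
  fixes w :: bits and \<rho> :: rtape and l :: nat
  defines "y \<equiv> map (\<lambda>i. \<rho> (l + i)) [0..<length w]"
  shows "k \<le> length w \<Longrightarrow>
   cstate c = 2 \<and> (\<forall>z\<ge>int (length w - k). cells c 0 z = word_cells w z) \<and>
     (\<forall>i<length w - k. cells c 0 (int i) = bit_sym (y ! i)) \<and>
     work_head c 0 = int (length w - k) \<and> rand_head c 0 = int (l + (length w - k)) \<Longrightarrow>
   leads 2 slice [\<rho>] (Suc k) (\<lambda>c. cstate c = 1 \<and> output_word c y) c"
    (is "_ \<Longrightarrow> _ \<Longrightarrow> leads 2 slice _ _ ?P c")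
proof (induction k arbitrary: c)
  case 0
  then have "wscan 2 c 0 = 0" by (simp add: wscan_def word_cells_eq_0_iff)
  then have "fstep 2 slice [\<rho>] c = update 2 (length [\<rho>]) c (1, keep (wscan 2 c), stay)"
    using 0 by (intro fstep_update) (auto simp: slice_def)
  then have "fstep 2 slice [\<rho>] c = c\<lparr>cstate := 1\<rparr>" by (simp only: update_keep_stay)
  moreover have "word_cells w (int (length w)) = 0" by (simp add: word_cells_def)
  ultimately show ?case using 0
    by (intro leads_step leads_here) (simp add: output_word_def range_bit_sym y_def)
next
  case (Suc k)
  let ?c = "fstep 2 slice [\<rho>] c" and ?i = "length w - Suc k"
  have "wscan 2 c 0 \<noteq> 0" using Suc.prems by (simp add: wscan_def word_cells_eq_0_iff)
  moreover have "rscan [\<rho>] c 0 = bit_sym (y ! ?i)"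
  proof -
    have "rand_head c 0 = int (l + ?i)" "y ! ?i = \<rho> (l + ?i)" using Suc.prems by (auto simp: y_def)
    moreover have "nat (int (l + ?i)) = l + ?i" "0 \<le> int (l + ?i)" by (simp_all only: nat_int of_nat_0_le_iff)
    ultimately show ?thesis by (simp only: rscan_def rand_cells_def) simp
  qed
  ultimately have c: "?c = update 2 (length [\<rho>]) c
      (2, (\<lambda>j. if j = 0 then (bit_sym (y ! ?i), MRight) else (wscan 2 c j, MStay)), (\<lambda>_. MRight))"
    using Suc.prems by (intro fstep_update) (auto simp: slice_def cong: if_cong)
  have i: "length w - k = Suc ?i" using Suc.prems(1) by simp
  have "cstate ?c = 2 \<and> (\<forall>z\<ge>int (length w - k). cells ?c 0 z = word_cells w z) \<and>
     (\<forall>i<length w - k. cells ?c 0 (int i) = bit_sym (y ! i)) \<and>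
     work_head ?c 0 = int (length w - k) \<and> rand_head ?c 0 = int (l + (length w - k))"
    using Suc.prems unfolding c i by (auto simp: less_Suc_eq)
  then have "leads 2 slice [\<rho>] (Suc k) ?P ?c" using Suc.IH[of ?c] Suc.prems(1) by simp
  then show ?case by (rule leads_step)
qed

lemma polytime_slice:
  "polytime 2 1 (\<lambda>xs rs. map (\<lambda>i. (rs ! 0) (length (xs ! 1) + i)) [0..<length (xs ! 0)])"
proof (rule polytimeI[OF in_range_slice, where p = "[:2, 2:]"])
  fix xs :: "bits list" and rs :: "rtape list"
  assume len: "length xs = 2" "length rs = 1"
  let ?w = "xs ! 0" and ?x = "xs ! 1"
  obtain \<rho> where rs: "rs = [\<rho>]" using len(2) by (metis length_0_conv length_Suc_conv One_nat_def)
  let ?y = "map (\<lambda>i. \<rho> (length ?x + i)) [0..<length ?w]"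
  have 1: "leads 2 slice [\<rho>] (Suc (length ?x))
     (\<lambda>c. cstate c = 2 \<and> cells c 0 = word_cells ?w \<and> work_head c 0 = 0 \<and>
       rand_head c 0 = int (length ?x)) (init_config xs)"
    by (rule slice_skip) (use len in \<open>auto simp: init_config_def\<close>)
  have 2: "leads 2 slice [\<rho>] (Suc (length ?w)) (\<lambda>c. cstate c = 1 \<and> output_word c ?y) c"
    if "cstate c = 2 \<and> cells c 0 = word_cells ?w \<and> work_head c 0 = 0 \<and>
       rand_head c 0 = int (length ?x)" for c
    by (rule slice_write) (use that in auto)
  have "length ?x \<le> total_length xs" "length ?w \<le> total_length xs"
    using len by (auto intro!: member_le_sum_list)
  then have "Suc (length ?x) + Suc (length ?w) \<le> poly [:2, 2:] (total_length xs)"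
    by simp
  from leads_trans[OF 1 2 this]
  show "leads 2 slice rs (poly [:2, 2:] (total_length xs))
    (\<lambda>c. cstate c = 1 \<and> output_word c (map (\<lambda>i. (rs ! 0) (length ?x + i)) [0..<length ?w]))
    (init_config xs)"
    unfolding rs by simp
qed auto

lemma polytime_unary_power:
  "\<exists>U. polytime 1 r (\<lambda>xs rs. U (xs ! 0)) \<and> (\<forall>w. length (U w) = length w ^ Suc k)"
proof (induction k)
  case 0
  show ?case using polytime_first by (intro exI[of _ "\<lambda>x. x"]) simp
next
  case (Suc k)
  then obtain U where U: "polytime 1 r (\<lambda>xs rs. U (xs ! 0))" "\<And>w. length (U w) = length w ^ Suc k"
    by blast
  have "polytime 1 r (\<lambda>xs rs. replicate (length (xs ! 0) * length (U (xs ! 0))) False)"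
    by (rule polytime_cong[OF _ polytime_comp[where f = "\<lambda>i. if i = 2 then 1 else 0" and g = id,
          OF polytime_multiply U(1)]]) auto
  then show ?case
    using U(2) by (intro exI[of _ "\<lambda>w. replicate (length w * length (U w)) False"]) simp
qed

lemma polytime_sample:
  "polytime 1 1 (\<lambda>xs rs. map (\<lambda>i. (rs ! 0) (length (xs ! 0) ^ Suc k + i)) [0..<length (xs ! 0)])"
proof -
  obtain U where U: "polytime 1 1 (\<lambda>xs rs. U (xs ! 0))" "\<And>w. length (U w) = length w ^ Suc k"
    using polytime_unary_power by blast
  show ?thesis
    by (rule polytime_cong[OF _ polytime_comp[where f = id and g = id,
          OF polytime_slice U(1)]]) (auto simp: U(2))
qed

section \<open>Symmetries of the coin measure\<close>

abbreviation coin :: "bool measure" where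
  "coin \<equiv> measure_pmf (bernoulli_pmf (1 / 2))"

lemma emeasure_coin_flip: "emeasure coin ((\<lambda>b. b \<noteq> s) -` A) = emeasure coin A"
proof -
  have "map_pmf (\<lambda>b. b \<noteq> s) (bernoulli_pmf (1 / 2)) = bernoulli_pmf (1 / 2)"
  proof (rule pmf_eqI)
    fix i
    have "(\<lambda>b. b \<noteq> s) -` {i} = {i \<noteq> s}" by auto
    then show "pmf (map_pmf (\<lambda>b. b \<noteq> s) (bernoulli_pmf (1 / 2))) i = pmf (bernoulli_pmf (1 / 2)) i"
      by (cases i; cases s) (simp_all add: pmf_map measure_pmf_single)
  qed
  then have "emeasure (map_pmf (\<lambda>b. b \<noteq> s) (bernoulli_pmf (1 / 2))) A = emeasure coin A" by simp
  then show ?thesis by simp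
qed

interpretation coin_flips: product_prob_space "\<lambda>_. coin" UNIV
  by unfold_locales

abbreviation flips :: "('i \<Rightarrow> bool) measure" where
  "flips \<equiv> PiM UNIV (\<lambda>_. coin)"

lemma prod_emb_coins: "prod_emb UNIV (\<lambda>_. coin) J (Pi\<^sub>E J F) = {x. \<forall>j\<in>J. x j \<in> F j}"
  by (auto simp: prod_emb_def space_PiM)

lemma emeasure_coins_cylinder:
  "finite J \<Longrightarrow> emeasure (flips) {x. \<forall>j\<in>J. x j \<in> F j} = (\<Prod>j\<in>J. emeasure coin (F j))"
  using coin_flips.emeasure_PiM_Collect[of J F] by (simp add: space_PiM)

lemma sets_coins_cylinder:
  "finite J \<Longrightarrow> {x. \<forall>j\<in>J. x j \<in> F j} \<in> sets (flips)"
  unfolding prod_emb_coins[symmetric] by (intro sets_PiM_I) auto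

lemma distr_reindex_flip:
  assumes "inj f"
  shows "distr (flips) (flips) (\<lambda>\<omega> j. \<omega> (f j) \<noteq> s j) = flips"
proof (rule coin_flips.PiM_eq)
  fix J :: "'a set" and F :: "'a \<Rightarrow> bool set"
  assume J: "finite J"
  let ?T = "\<lambda>\<omega> j. \<omega> (f j) \<noteq> s j"
  let ?G = "\<lambda>i. (\<lambda>b. b \<noteq> s (the_inv f i)) -` F (the_inv f i)"
  have T: "?T \<in> measurable (flips) (flips)"
    by (rule measurable_PiM_single') (auto simp: space_PiM intro!: measurable_compose[OF measurable_component_singleton])
  have "?T -` {x. \<forall>j\<in>J. x j \<in> F j} = {x. \<forall>i\<in>f ` J. x i \<in> ?G i}"
    using assms by (auto simp: the_inv_f_f)
  then have "emeasure (distr (flips) (flips) ?T) {x. \<forall>j\<in>J. x j \<in> F j} =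
      emeasure (flips) {x. \<forall>i\<in>f ` J. x i \<in> ?G i}"
    by (subst emeasure_distr[OF T sets_coins_cylinder[OF J]]) (simp add: space_PiM)
  also have "\<dots> = (\<Prod>i\<in>f ` J. emeasure coin (?G i))"
    using J by (intro emeasure_coins_cylinder) simp
  also have "\<dots> = (\<Prod>j\<in>J. emeasure coin (?G (f j)))"
    using assms by (subst prod.reindex) (auto intro: inj_on_subset)
  also have "\<dots> = (\<Prod>j\<in>J. emeasure coin (F j))"
    by (simp only: the_inv_f_f[OF assms] emeasure_coin_flip)
  finally show "emeasure (distr (flips) (flips) ?T)
     (prod_emb UNIV (\<lambda>_. coin) J (Pi\<^sub>E J F)) = (\<Prod>j\<in>J. emeasure coin (F j))"
    unfolding prod_emb_coins .
qed simp

lemma measurable_coins_pair: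
  "(\<lambda>(a, b). case_sum a b) \<in> measurable (coins \<Otimes>\<^sub>M coins) (flips)"
proof (rule measurable_PiM_single')
  fix i :: "nat + nat"
  show "(\<lambda>\<omega>. (case \<omega> of (a, b) \<Rightarrow> case_sum a b) i) \<in> measurable (coins \<Otimes>\<^sub>M coins) coin"
  proof (cases i)
    case (Inl j)
    have "(\<lambda>x. fst x j) \<in> measurable (coins \<Otimes>\<^sub>M coins) coin"
      unfolding coins_def by measurable
    then show ?thesis using Inl by (simp add: case_prod_unfold)
  next
    case (Inr j)
    have "(\<lambda>x. snd x j) \<in> measurable (coins \<Otimes>\<^sub>M coins) coin"
      unfolding coins_def by measurable
    then show ?thesis using Inr by (simp add: case_prod_unfold)
  qed
qed (auto simp: space_PiM)

lemma prob_space_coins: "prob_space coins"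
  unfolding coins_def by (rule coin_flips.P.prob_space_axioms)

lemma distr_coins_pair:
  "distr (coins \<Otimes>\<^sub>M coins) (flips) (\<lambda>(a, b). case_sum a b) = flips"
proof (rule coin_flips.PiM_eq)
  interpret C: prob_space coins by (rule prob_space_coins)
  fix J :: "(nat + nat) set" and F :: "nat + nat \<Rightarrow> bool set"
  assume J: "finite J"
  let ?J1 = "Inl -` J" and ?J2 = "Inr -` J"
  let ?X1 = "{x. \<forall>j\<in>?J1. x j \<in> F (Inl j)}" and ?X2 = "{x. \<forall>j\<in>?J2. x j \<in> F (Inr j)}"
  have fin: "finite ?J1" "finite ?J2" using J by (auto intro: finite_vimageI)
  have JJ: "J = Inl ` ?J1 \<union> Inr ` ?J2"
  proof (rule set_eqI)
    fix x show "x \<in> J \<longleftrightarrow> x \<in> Inl ` ?J1 \<union> Inr ` ?J2" by (cases x) auto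
  qed
  have "(\<lambda>(a, b). case_sum a b) -` {x. \<forall>j\<in>J. x j \<in> F j} = ?X1 \<times> ?X2"
    by (auto simp: Ball_def split_sum_all)
  then have "emeasure (distr (coins \<Otimes>\<^sub>M coins) (flips) (\<lambda>(a, b). case_sum a b))
      {x. \<forall>j\<in>J. x j \<in> F j} = emeasure (coins \<Otimes>\<^sub>M coins) (?X1 \<times> ?X2)"
    by (subst emeasure_distr[OF measurable_coins_pair sets_coins_cylinder[OF J]])
       (simp add: space_pair_measure coins_def space_PiM)
  also have "\<dots> = emeasure coins ?X1 * emeasure coins ?X2"
    using fin by (intro C.emeasure_pair_measure_Times) (auto simp: coins_def intro!: sets_coins_cylinder)
  also have "\<dots> = (\<Prod>j\<in>?J1. emeasure coin (F (Inl j))) * (\<Prod>j\<in>?J2. emeasure coin (F (Inr j)))"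
    unfolding coins_def using fin by (simp add: emeasure_coins_cylinder)
  also have "\<dots> = (\<Prod>j\<in>J. emeasure coin (F j))"
  proof -
    have "(\<Prod>j\<in>J. emeasure coin (F j)) =
        (\<Prod>j\<in>Inl ` ?J1. emeasure coin (F j)) * (\<Prod>j\<in>Inr ` ?J2. emeasure coin (F j))"
      by (subst JJ, rule prod.union_disjoint) (use J in auto)
    then show ?thesis by (simp only: prod.reindex inj_Inl inj_Inr comp_def)
  qed
  finally show "emeasure (distr (coins \<Otimes>\<^sub>M coins) (flips) (\<lambda>(a, b). case_sum a b))
     (prod_emb UNIV (\<lambda>_. coin) J (Pi\<^sub>E J F)) = (\<Prod>j\<in>J. emeasure coin (F j))"
    unfolding prod_emb_coins .
qed simp

definition agree :: "nat \<Rightarrow> rtape \<Rightarrow> rtape \<Rightarrow> bool" where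
  "agree N \<rho> \<rho>' \<longleftrightarrow> (\<forall>i<N. \<rho> i = \<rho>' i)"

definition finitary :: "(rtape \<Rightarrow> rtape \<Rightarrow> 'a) \<Rightarrow> bool" where
  "finitary P \<longleftrightarrow> (\<exists>N. \<forall>r1 r2 r1' r2'. agree N r1 r1' \<longrightarrow> agree N r2 r2' \<longrightarrow> P r1 r2 = P r1' r2')"

definition coin_prob :: "(rtape \<Rightarrow> rtape \<Rightarrow> bool) \<Rightarrow> real" where
  "coin_prob P = measure (coins \<Otimes>\<^sub>M coins) {(r1, r2). P r1 r2}"

lemma prefix_set_cylinder: "{\<rho>. agree N \<rho> \<rho>'} \<in> sets coins"
proof -
  have "{\<rho>. agree N \<rho> \<rho>'} = {x. \<forall>j\<in>{..<N}. x j \<in> {\<rho>' j}}" by (auto simp: agree_def)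
  then show ?thesis unfolding coins_def by (simp only:) (intro sets_coins_cylinder, simp)
qed

lemma finitary_measurable:
  assumes "finitary P"
  shows "{(r1, r2). P r1 r2} \<in> sets (coins \<Otimes>\<^sub>M coins)"
proof -
  obtain N where N: "\<And>r1 r2 r1' r2'. agree N r1 r1' \<Longrightarrow> agree N r2 r2' \<Longrightarrow> P r1 r2 = P r1' r2'"
    using assms unfolding finitary_def by blast
  define e :: "bool list \<Rightarrow> rtape" where "e l i = (i < length l \<and> l ! i)" for l i
  have agree_e: "agree N \<rho> (e (map \<rho> [0..<N]))" for \<rho> by (auto simp: agree_def e_def)
  have "{(r1, r2). P r1 r2} =
      (\<Union>p\<in>{(a, b). P (e a) (e b)}. {\<rho>. agree N \<rho> (e (fst p))} \<times> {\<rho>. agree N \<rho> (e (snd p))})"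
    (is "?L = ?R")
  proof (intro equalityI subsetI)
    fix x assume "x \<in> ?L"
    then obtain r1 r2 where x: "x = (r1, r2)" "P r1 r2" by auto
    then have "P (e (map r1 [0..<N])) (e (map r2 [0..<N]))"
      using N[OF agree_e agree_e] by blast
    then show "x \<in> ?R"
      using x agree_e by (intro UN_I[of "(map r1 [0..<N], map r2 [0..<N])"]) auto
  next
    fix x assume "x \<in> ?R"
    then show "x \<in> ?L" using N by auto
  qed
  also have "\<dots> \<in> sets (coins \<Otimes>\<^sub>M coins)"
    by (intro sets.countable_UN'' countableI_type pair_measureI prefix_set_cylinder)
  finally show ?thesis .
qed

lemma prob_space_pair: "prob_space (coins \<Otimes>\<^sub>M coins)"
proof -
  interpret C: prob_space coins by (rule prob_space_coins)
  interpret CC: pair_prob_space coins coins ..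
  show ?thesis by (rule CC.prob_space_axioms)
qed

lemma prob_transform:
  fixes f :: "nat + nat \<Rightarrow> nat + nat" and s :: "nat + nat \<Rightarrow> bool"
  assumes "inj f" "finitary P"
  defines "T \<equiv> \<lambda>r1 r2 j. case_sum r1 r2 (f j) \<noteq> s j"
  shows "coin_prob (\<lambda>r1 r2. P (\<lambda>i. T r1 r2 (Inl i)) (\<lambda>i. T r1 r2 (Inr i))) = coin_prob P"
proof -
  let ?M = "flips :: (nat + nat \<Rightarrow> bool) measure"
  let ?S = "\<lambda>\<omega> j. \<omega> (f j) \<noteq> s j"
  let ?X = "{\<omega>. P (\<lambda>i. \<omega> (Inl i)) (\<lambda>i. \<omega> (Inr i))}"
  have S: "?S \<in> measurable ?M ?M"
    by (rule measurable_PiM_single') (auto simp: space_PiM intro!: measurable_compose[OF measurable_component_singleton])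
  have split: "(\<lambda>\<omega> :: nat + nat \<Rightarrow> bool. (\<lambda>i. \<omega> (Inl i), \<lambda>i. \<omega> (Inr i))) \<in> measurable ?M (coins \<Otimes>\<^sub>M coins)"
    unfolding coins_def
    by (intro measurable_Pair measurable_PiM_single') (auto simp: space_PiM)
  have X: "?X \<in> sets ?M"
    using measurable_sets[OF split finitary_measurable[OF assms(2)]]
    by (simp add: vimage_def space_PiM)
  have prob: "measure (coins \<Otimes>\<^sub>M coins) ((\<lambda>(a, b). case_sum a b) -` Y) = measure ?M Y"
    if "Y \<in> sets ?M" for Y
    using measure_distr[OF measurable_coins_pair that] unfolding distr_coins_pair
    by (simp add: space_pair_measure coins_def space_PiM)
  have SX: "?S -` ?X \<in> sets ?M" using measurable_sets[OF S X] by (simp add: space_PiM)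
  have "coin_prob (\<lambda>r1 r2. P (\<lambda>i. T r1 r2 (Inl i)) (\<lambda>i. T r1 r2 (Inr i))) =
      measure (coins \<Otimes>\<^sub>M coins) ((\<lambda>(a, b). case_sum a b) -` (?S -` ?X))"
    unfolding coin_prob_def T_def by (intro arg_cong2[of _ _ _ _ measure]) auto
  also have "\<dots> = measure ?M (?S -` ?X)" by (rule prob[OF SX])
  also have "\<dots> = measure ?M ?X"
    using measure_distr[OF S X] unfolding distr_reindex_flip[OF assms(1)] by (simp add: space_PiM)
  also have "\<dots> = measure (coins \<Otimes>\<^sub>M coins) ((\<lambda>(a, b). case_sum a b) -` ?X)"
    by (rule prob[OF X, symmetric])
  also have "\<dots> = coin_prob P"
    unfolding coin_prob_def by (intro arg_cong2[of _ _ _ _ measure]) auto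
  finally show ?thesis .
qed

section \<open>Polynomially bounded domain elements\<close>

lemma agree_mono: "agree N \<rho> \<rho>' \<Longrightarrow> M \<le> N \<Longrightarrow> agree M \<rho> \<rho>'"
  by (auto simp: agree_def)

lemma finitary_map2:
  assumes "finitary f" "finitary g"
  shows "finitary (\<lambda>r1 r2. h (f r1 r2) (g r1 r2))"
proof -
  obtain N where N: "\<And>r1 r2 r1' r2'. agree N r1 r1' \<Longrightarrow> agree N r2 r2' \<Longrightarrow> f r1 r2 = f r1' r2'"
    using assms(1) unfolding finitary_def by blast
  obtain M where M: "\<And>r1 r2 r1' r2'. agree M r1 r1' \<Longrightarrow> agree M r2 r2' \<Longrightarrow> g r1 r2 = g r1' r2'"
    using assms(2) unfolding finitary_def by blast
  have "f r1 r2 = f r1' r2' \<and> g r1 r2 = g r1' r2'"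
    if "agree (max N M) r1 r1'" "agree (max N M) r2 r2'" for r1 r2 r1' r2'
    using N[of r1 r1' r2 r2'] M[of r1 r1' r2 r2'] agree_mono[OF that(1)] agree_mono[OF that(2)]
    by (meson max.cobounded1 max.cobounded2)
  then show ?thesis
    unfolding finitary_def by (intro exI[of _ "max N M"] allI impI arg_cong2[of _ _ _ _ h]) auto
qed

lemma finitary_const: "finitary (\<lambda>_ _. a)"
  by (simp add: finitary_def)

lemma finitary_map: "finitary f \<Longrightarrow> finitary (\<lambda>r1 r2. h (f r1 r2))"
  using finitary_map2[OF _ finitary_const, of f "\<lambda>x _. h x"] by simp

lemma finitary_connectives:
  assumes "finitary P" "finitary Q"
  shows "finitary (\<lambda>r1 r2. P r1 r2 \<and> Q r1 r2)"
    and "finitary (\<lambda>r1 r2. P r1 r2 \<or> Q r1 r2)"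
    and "finitary (\<lambda>r1 r2. P r1 r2 \<and> \<not> Q r1 r2)"
  using finitary_map2[OF assms, of "(\<and>)"] finitary_map2[OF assms, of "(\<or>)"]
    finitary_map2[OF assms, of "\<lambda>a b. a \<and> \<not> b"] by simp_all

lemma prob_nonneg: "0 \<le> coin_prob P"
  by (simp add: coin_prob_def)

lemma prob_True: "coin_prob (\<lambda>_ _. True) = 1"
proof -
  interpret prob_space "coins \<Otimes>\<^sub>M coins" by (rule prob_space_pair)
  have "{(r1, r2). True} = space (coins \<Otimes>\<^sub>M coins)"
    by (auto simp: space_pair_measure coins_def space_PiM)
  then show ?thesis unfolding coin_prob_def by (simp only: prob_space)
qed

lemma prob_False: "coin_prob (\<lambda>_ _. False) = 0"
  by (simp add: coin_prob_def)

lemma prob_mono: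
  assumes "finitary Q" "\<And>r1 r2. P r1 r2 \<Longrightarrow> Q r1 r2"
  shows "coin_prob P \<le> coin_prob Q"
proof -
  interpret prob_space "coins \<Otimes>\<^sub>M coins" by (rule prob_space_pair)
  show ?thesis unfolding coin_prob_def
    by (rule finite_measure_mono) (use assms finitary_measurable in auto)
qed

lemma prob_split:
  assumes "finitary P" "finitary Q"
  shows "coin_prob P = coin_prob (\<lambda>r1 r2. P r1 r2 \<and> Q r1 r2) + coin_prob (\<lambda>r1 r2. P r1 r2 \<and> \<not> Q r1 r2)"
proof -
  interpret prob_space "coins \<Otimes>\<^sub>M coins" by (rule prob_space_pair)
  have "{(r1, r2). P r1 r2 \<and> Q r1 r2} \<in> sets (coins \<Otimes>\<^sub>M coins)"
    "{(r1, r2). P r1 r2 \<and> \<not> Q r1 r2} \<in> sets (coins \<Otimes>\<^sub>M coins)"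
    by (intro finitary_measurable finitary_connectives assms)+
  from finite_measure_Union[OF this]
  show ?thesis unfolding coin_prob_def
    by (subst arg_cong[of "{(r1, r2). P r1 r2}" "{(r1, r2). P r1 r2 \<and> Q r1 r2} \<union> {(r1, r2). P r1 r2 \<and> \<not> Q r1 r2}"]) auto
qed

lemma prob_not:
  assumes "finitary P"
  shows "coin_prob (\<lambda>r1 r2. \<not> P r1 r2) = 1 - coin_prob P"
  using prob_split[OF finitary_const assms, of True] by (simp add: prob_True)

lemma prob_or_le:
  assumes "finitary P" "finitary Q"
  shows "coin_prob (\<lambda>r1 r2. P r1 r2 \<or> Q r1 r2) \<le> coin_prob P + coin_prob Q"
proof -
  have "coin_prob (\<lambda>r1 r2. P r1 r2 \<or> Q r1 r2) =
    coin_prob (\<lambda>r1 r2. (P r1 r2 \<or> Q r1 r2) \<and> P r1 r2) +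
    coin_prob (\<lambda>r1 r2. (P r1 r2 \<or> Q r1 r2) \<and> \<not> P r1 r2)"
    by (intro prob_split finitary_connectives assms)
  also have "\<dots> \<le> coin_prob P + coin_prob Q"
    by (intro add_mono prob_mono assms) auto
  finally show ?thesis .
qed

lemma prob_diff_le:
  assumes "finitary P" "finitary Q" "finitary R"
    and "\<And>r1 r2. P r1 r2 \<noteq> Q r1 r2 \<Longrightarrow> R r1 r2"
  shows "\<bar>coin_prob P - coin_prob Q\<bar> \<le> coin_prob R"
proof -
  have "coin_prob P \<le> coin_prob (\<lambda>r1 r2. Q r1 r2 \<or> R r1 r2)" "coin_prob Q \<le> coin_prob (\<lambda>r1 r2. P r1 r2 \<or> R r1 r2)"
    by (rule prob_mono; use assms(4) finitary_connectives(2)[OF assms(2,3)]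
        finitary_connectives(2)[OF assms(1,3)] in blast)+
  then show ?thesis
    using prob_or_le[OF assms(2,3)] prob_or_le[OF assms(1,3)] by linarith
qed

lemma prob_partition:
  assumes "finite C" "finitary P" "finitary f" "\<And>r1 r2. P r1 r2 \<Longrightarrow> f r1 r2 \<in> C"
  shows "coin_prob P = (\<Sum>c\<in>C. coin_prob (\<lambda>r1 r2. P r1 r2 \<and> f r1 r2 = c))"
  using assms(1,2,4)
proof (induction C arbitrary: P)
  case empty
  then have "P = (\<lambda>_ _. False)" by (auto simp: fun_eq_iff)
  then show ?case by (simp add: prob_False)
next
  case (insert c C)
  let ?P = "\<lambda>r1 r2. P r1 r2 \<and> f r1 r2 \<noteq> c"
  have fc: "finitary (\<lambda>r1 r2. f r1 r2 = c)" by (rule finitary_map[OF assms(3)])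
  have "coin_prob ?P = (\<Sum>c'\<in>C. coin_prob (\<lambda>r1 r2. ?P r1 r2 \<and> f r1 r2 = c'))"
  proof (rule insert.IH)
    show "finitary ?P"
      using finitary_map2[OF insert.prems(1) fc, of "\<lambda>a b. a \<and> \<not> b"] .
    show "\<And>r1 r2. ?P r1 r2 \<Longrightarrow> f r1 r2 \<in> C" using insert.prems(2) by blast
  qed
  also have "\<dots> = (\<Sum>c'\<in>C. coin_prob (\<lambda>r1 r2. P r1 r2 \<and> f r1 r2 = c'))"
    using insert.hyps(2) by (intro sum.cong refl arg_cong[of _ _ coin_prob]) (auto simp: fun_eq_iff)
  finally show ?case
    using prob_split[OF insert.prems(1) fc] insert.hyps by simp
qed

definition bounded_by :: "nat poly \<Rightarrow> delem \<Rightarrow> bool" where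
  "bounded_by q d \<longleftrightarrow> (\<forall>w r1 r2. length (d w r1 r2) \<le> poly q (length w) \<and>
     (\<forall>r1' r2'. agree (poly q (length w)) r1 r1' \<longrightarrow> agree (poly q (length w)) r2 r2' \<longrightarrow>
        d w r1 r2 = d w r1' r2'))"

lemma bounded_by_mono:
  assumes "bounded_by q d" "\<And>x. poly q x \<le> poly q' x"
  shows "bounded_by q' d"
  unfolding bounded_by_def
proof (intro allI conjI impI)
  fix w r1 r2
  show "length (d w r1 r2) \<le> poly q' (length w)"
    using assms unfolding bounded_by_def by (meson le_trans)
  fix r1' r2'
  assume "agree (poly q' (length w)) r1 r1'" "agree (poly q' (length w)) r2 r2'"
  then show "d w r1 r2 = d w r1' r2'"
    using assms agree_mono unfolding bounded_by_def by meson
qed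

lemma bounded_by_local: "bounded_by q d \<Longrightarrow> finitary (d w)"
  unfolding bounded_by_def finitary_def by (intro exI[of _ "poly q (length w)"]) blast

lemma bounded_common:
  assumes "\<And>d. d \<in> set ds \<Longrightarrow> \<exists>q. bounded_by q d"
  shows "\<exists>q. \<forall>d\<in>set ds. bounded_by q d"
  using assms
proof (induction ds)
  case (Cons d ds)
  obtain q where q: "\<forall>d\<in>set ds. bounded_by q d" using Cons by auto
  obtain q' where q': "bounded_by q' d" using Cons.prems by auto
  have "\<forall>e\<in>set (d # ds). bounded_by (q + q') e"
    using q q' bounded_by_mono[of q _ "q + q'"] bounded_by_mono[of q' _ "q + q'"] by auto
  then show ?case by blast
qed auto

lemma bounded_values_length:
  assumes "\<And>d. d \<in> set ds \<Longrightarrow> bounded_by q d"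
  shows "(total_length (w # map (\<lambda>d. d w r1 r2) ds)) \<le> length w + length ds * poly q (length w)"
proof -
  have "(\<Sum>d\<leftarrow>ds. length (d w r1 r2)) \<le> (\<Sum>d\<leftarrow>ds. poly q (length w))"
    using assms by (intro sum_list_mono) (auto simp: bounded_by_def)
  then show ?thesis by (simp add: comp_def sum_list_triv)
qed

lemma bounded_values_eq:
  assumes "\<And>d. d \<in> set ds \<Longrightarrow> bounded_by q d"
    "agree (poly q (length w)) r1 r1'" "agree (poly q (length w)) r2 r2'"
  shows "map (\<lambda>d. d w r1 r2) ds = map (\<lambda>d. d w r1' r2') ds"
  using assms unfolding bounded_by_def by (intro map_cong refl) blast

lemma bounded_apply:
  assumes F: "polytime (Suc (length ds)) 1 F" and "\<And>d. d \<in> set ds \<Longrightarrow> \<exists>q. bounded_by q d"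
  shows "\<exists>q. bounded_by q (\<lambda>w r1 r2. F (w # map (\<lambda>d. d w r1 r2) ds) [r2])"
proof -
  obtain q where q: "\<And>d. d \<in> set ds \<Longrightarrow> bounded_by q d" using bounded_common[OF assms(2)] by blast
  obtain p where p:
    "\<And>xs rs. length xs = Suc (length ds) \<Longrightarrow> length rs = 1 \<Longrightarrow>
      length (F xs rs) \<le> poly p (total_length xs)"
    "\<And>xs rs rs'. length xs = Suc (length ds) \<Longrightarrow> length rs = 1 \<Longrightarrow> length rs' = 1 \<Longrightarrow>
       \<forall>j<1. \<forall>i<poly p (total_length xs). (rs ! j) i = (rs' ! j) i \<Longrightarrow> F xs rs = F xs rs'"
    by (rule polytime_bounded[OF F]) blast
  define Q where "Q = q + pcompose p ([:0, 1:] + smult (length ds) q)"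
  have Q: "poly p (total_length (w # map (\<lambda>d. d w r1 r2) ds)) \<le> poly Q (length w)" for w r1 r2
  proof -
    have "poly p (total_length (w # map (\<lambda>d. d w r1 r2) ds)) \<le> poly p (length w + length ds * poly q (length w))"
      by (rule poly_mono_nat, rule bounded_values_length, rule q)
    also have "\<dots> \<le> poly Q (length w)" by (simp add: Q_def poly_pcompose)
    finally show ?thesis .
  qed
  have "bounded_by Q (\<lambda>w r1 r2. F (w # map (\<lambda>d. d w r1 r2) ds) [r2])"
    unfolding bounded_by_def
  proof (intro allI conjI impI)
    fix w r1 r2
    have "length (F (w # map (\<lambda>d. d w r1 r2) ds) [r2])
        \<le> poly p (total_length (w # map (\<lambda>d. d w r1 r2) ds))"
      by (rule p(1)) auto
    also note Q
    finally show "length (F (w # map (\<lambda>d. d w r1 r2) ds) [r2]) \<le> poly Q (length w)" .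
    fix r1' r2'
    assume agr: "agree (poly Q (length w)) r1 r1'" "agree (poly Q (length w)) r2 r2'"
    have "map (\<lambda>d. d w r1 r2) ds = map (\<lambda>d. d w r1' r2') ds"
      by (rule bounded_values_eq[OF q]) (auto intro: agree_mono[OF agr(1)] agree_mono[OF agr(2)] simp: Q_def)
    moreover have "F (w # map (\<lambda>d. d w r1 r2) ds) [r2] = F (w # map (\<lambda>d. d w r1 r2) ds) [r2']"
      by (rule p(2)) (use agr(2) Q[of w r1 r2] in \<open>auto simp: agree_def\<close>)
    ultimately show "F (w # map (\<lambda>d. d w r1 r2) ds) [r2] = F (w # map (\<lambda>d. d w r1' r2') ds) [r2']"
      by (simp only:)
  qed
  then show ?thesis ..
qed

lemma in_domain_bounded:
  assumes "in_domain s d"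
  shows "\<exists>q. bounded_by q d"
proof -
  have "polytime 1 2 (\<lambda>xs rs. d (xs ! 0) (rs ! 0) (rs ! 1))"
    using assms by (simp add: in_domain_def)
  then obtain q where q:
    "\<And>xs rs. length xs = 1 \<Longrightarrow> length rs = 2 \<Longrightarrow>
      length (d (xs ! 0) (rs ! 0) (rs ! 1)) \<le> poly q (total_length xs)"
    "\<And>xs rs rs'. length xs = 1 \<Longrightarrow> length rs = 2 \<Longrightarrow> length rs' = 2 \<Longrightarrow>
       \<forall>j<2. \<forall>i<poly q (total_length xs). (rs ! j) i = (rs' ! j) i \<Longrightarrow>
       d (xs ! 0) (rs ! 0) (rs ! 1) = d (xs ! 0) (rs' ! 0) (rs' ! 1)"
    by (rule polytime_bounded) blast
  have "bounded_by q d"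
    unfolding bounded_by_def
  proof (intro allI conjI impI)
    fix w r1 r2
    show "length (d w r1 r2) \<le> poly q (length w)" using q(1)[of "[w]" "[r1, r2]"] by simp
    fix r1' r2'
    assume "agree (poly q (length w)) r1 r1'" "agree (poly q (length w)) r2 r2'"
    then show "d w r1 r2 = d w r1' r2'"
      using q(2)[of "[w]" "[r1, r2]" "[r1', r2']"] by (simp add: agree_def less_2_cases_iff)
  qed
  then show ?thesis ..
qed

fun sym_fun :: "('n, 'f, 'g) interp \<Rightarrow> ('f, 'g) sym \<Rightarrow> bits list \<Rightarrow> rtape list \<Rightarrow> bits" where
  "sym_fun I (Hon f) xs rs = hon_fun I f xs"
| "sym_fun I (Att g) xs rs = att_fun I g xs (rs ! 0)"

lemma sem_App:
  "sem I \<sigma> (App h ts) =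
     (\<lambda>w r1 r2. sym_fun I h (w # map (\<lambda>d. d w r1 r2) (map (sem I \<sigma>) ts)) [r2])"
  by (cases h) (auto simp: fun_eq_iff comp_def)

lemma interpretation_sym:
  assumes "interpretation_of \<Sigma> I" "sym_type \<Sigma> h = (ss, s)"
  shows "polytime (Suc (length ss)) 1 (sym_fun I h)"
    and "list_all2 (sort_ok (length w)) ss vs \<Longrightarrow> sort_ok (length w) s (sym_fun I h (w # vs) [r2])"
proof -
  have hon: "\<forall>f ss s. fsym_type \<Sigma> f = (ss, s) \<longrightarrow>
        polytime (Suc (length ss)) 0 (\<lambda>xs rs. hon_fun I f xs) \<and>
        (\<forall>w vs. list_all2 (sort_ok (length w)) ss vs \<longrightarrow> sort_ok (length w) s (hon_fun I f (w # vs)))"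
    using assms(1) unfolding interpretation_of_def by (elim conjE)
  have att: "\<forall>g ss s. att_type \<Sigma> g = (ss, s) \<longrightarrow>
        polytime (Suc (length ss)) 1 (\<lambda>xs rs. att_fun I g xs (rs ! 0)) \<and>
        (\<forall>w vs r2. list_all2 (sort_ok (length w)) ss vs \<longrightarrow> sort_ok (length w) s (att_fun I g (w # vs) r2))"
    using assms(1) unfolding interpretation_of_def by (elim conjE)
  have "polytime (Suc (length ss)) 1 (sym_fun I h) \<and>
    (\<forall>w vs r2. list_all2 (sort_ok (length w)) ss vs \<longrightarrow> sort_ok (length w) s (sym_fun I h (w # vs) [r2]))"
  proof (cases h)
    case (Hon f)
    then have *: "polytime (Suc (length ss)) 0 (\<lambda>xs rs. hon_fun I f xs) \<and>
        (\<forall>w vs. list_all2 (sort_ok (length w)) ss vs \<longrightarrow> sort_ok (length w) s (hon_fun I f (w # vs)))"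
      using assms(2) hon[rule_format, of f ss s] by simp
    then have "polytime (Suc (length ss)) 1 (\<lambda>xs rs. hon_fun I f xs)"
      using polytime_lift[of "Suc (length ss)" "hon_fun I f"] by blast
    moreover have "sym_fun I h = (\<lambda>xs rs. hon_fun I f xs)" using Hon by (auto simp: fun_eq_iff)
    ultimately show ?thesis using * Hon by simp
  next
    case (Att g)
    then have "polytime (Suc (length ss)) 1 (\<lambda>xs rs. att_fun I g xs (rs ! 0)) \<and>
        (\<forall>w vs r2. list_all2 (sort_ok (length w)) ss vs \<longrightarrow> sort_ok (length w) s (att_fun I g (w # vs) r2))"
      using assms(2) att[rule_format, of g ss s] by simp
    moreover have "sym_fun I h = (\<lambda>xs rs. att_fun I g xs (rs ! 0))" using Att by (auto simp: fun_eq_iff)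
    ultimately show ?thesis using Att by simp
  qed
  then show "polytime (Suc (length ss)) 1 (sym_fun I h)"
    and "list_all2 (sort_ok (length w)) ss vs \<Longrightarrow> sort_ok (length w) s (sym_fun I h (w # vs) [r2])"
    by auto
qed

lemma sem_sorted:
  assumes I: "interpretation_of \<Sigma> I" and \<sigma>: "valuation_ok \<sigma>" and "has_sort \<Sigma> t s"
  shows "(\<exists>q. bounded_by q (sem I \<sigma> t)) \<and> (\<forall>w r1 r2. sort_ok (length w) s (sem I \<sigma> t w r1 r2))"
  using assms(3)
proof (induction rule: has_sort.induct)
  case (1 s k)
  have "in_domain s (\<sigma> s k)" using \<sigma> by (simp add: valuation_ok_def)
  moreover have "sem I \<sigma> (Var s k) = \<sigma> s k" by (auto simp: fun_eq_iff)
  ultimately show ?case using in_domain_bounded by (auto simp: in_domain_def)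
next
  case (2 n)
  have "in_domain SNonce (name_val I n)" using I by (simp add: interpretation_of_def)
  moreover have "sem I \<sigma> (Name n) = name_val I n" by (auto simp: fun_eq_iff)
  ultimately show ?case using in_domain_bounded[of SNonce "name_val I n"] by (simp add: in_domain_def)
next
  case (3 h ss s ts)
  have "\<exists>q. bounded_by q d" if d: "d \<in> set (map (sem I \<sigma>) ts)" for d
  proof -
    obtain i where "i < length ts" "d = sem I \<sigma> (ts ! i)" using d by (auto simp: in_set_conv_nth)
    then show ?thesis using 3 by auto
  qed
  then have "\<exists>q. bounded_by q (sem I \<sigma> (App h ts))"
    unfolding sem_App using interpretation_sym(1)[OF I 3(1)] 3(2) by (intro bounded_apply) simp_all
  moreover have "sort_ok (length w) s (sem I \<sigma> (App h ts) w r1 r2)" for w r1 r2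
    unfolding sem_App using 3 by (intro interpretation_sym(2)[OF I 3(1)]) (auto simp: list_all2_conv_all_nth)
  ultimately show ?case by blast
qed auto

section \<open>Indistinguishability\<close>

lemma negligible_mono:
  assumes "negligible g" "\<forall>\<^sub>F \<eta> in sequentially. \<bar>f \<eta>\<bar> \<le> \<bar>g \<eta>\<bar>"
  shows "negligible f"
  unfolding negligible_def
proof
  fix k
  have "\<forall>\<^sub>F \<eta> in sequentially. \<bar>g \<eta>\<bar> < 1 / real \<eta> ^ k"
    using assms(1) by (simp add: negligible_def)
  then show "\<forall>\<^sub>F \<eta> in sequentially. \<bar>f \<eta>\<bar> < 1 / real \<eta> ^ k"
    using assms(2) by eventually_elim simp
qed

lemma negligible_zero: "negligible (\<lambda>_. 0)"
  unfolding negligible_def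
proof
  fix k
  show "\<forall>\<^sub>F \<eta> in sequentially. \<bar>0 :: real\<bar> < 1 / real \<eta> ^ k"
    using eventually_gt_at_top[of 0] by eventually_elim simp
qed

lemma negligible_add:
  assumes "negligible f" "negligible g"
  shows "negligible (\<lambda>\<eta>. f \<eta> + g \<eta>)"
  unfolding negligible_def
proof
  fix k
  have "\<forall>\<^sub>F \<eta> in sequentially. \<bar>f \<eta>\<bar> < 1 / real \<eta> ^ Suc k"
    "\<forall>\<^sub>F \<eta> in sequentially. \<bar>g \<eta>\<bar> < 1 / real \<eta> ^ Suc k"
    using assms unfolding negligible_def by blast+
  then show "\<forall>\<^sub>F \<eta> in sequentially. \<bar>f \<eta> + g \<eta>\<bar> < 1 / real \<eta> ^ k"
    using eventually_ge_at_top[of 2]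
  proof eventually_elim
    case (elim \<eta>)
    have "2 * (1 / real \<eta> ^ Suc k) \<le> 1 / real \<eta> ^ k"
      using elim(3) by (simp add: field_simps)
    then show ?case using elim(1,2) by linarith
  qed
qed

lemma negligible_inverse_power2: "negligible (\<lambda>\<eta>. 1 / 2 ^ \<eta>)"
  unfolding negligible_def
proof
  fix k
  have "(\<lambda>\<eta>. real \<eta> ^ k / 2 ^ \<eta>) \<longlonglongrightarrow> 0"
    by real_asymp
  then have "\<forall>\<^sub>F \<eta> in sequentially. real \<eta> ^ k / 2 ^ \<eta> < 1"
    by (rule order_tendstoD) simp
  then show "\<forall>\<^sub>F \<eta> in sequentially. \<bar>1 / 2 ^ \<eta> :: real\<bar> < 1 / real \<eta> ^ k"
    using eventually_gt_at_top[of 0] by eventually_elim (simp add: field_simps)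
qed

abbreviation bounded_delem :: "delem \<Rightarrow> bool" where
  "bounded_delem d \<equiv> \<exists>q. bounded_by q d"

abbreviation ones :: "nat \<Rightarrow> bits" where
  "ones \<eta> \<equiv> replicate \<eta> True"

abbreviation at_all :: "bits \<Rightarrow> rtape \<Rightarrow> rtape \<Rightarrow> delem list \<Rightarrow> bits list" where
  "at_all w r1 r2 ds \<equiv> map (\<lambda>d. d w r1 r2) ds"

definition disagree :: "delem \<Rightarrow> delem \<Rightarrow> nat \<Rightarrow> real" where
  "disagree d d' \<eta> = coin_prob (\<lambda>r1 r2. d (ones \<eta>) r1 r2 \<noteq> d' (ones \<eta>) r1 r2)"

lemma accept_prob_eq:
  "accept_prob A ds \<eta> = coin_prob (\<lambda>r1 r2. A (ones \<eta> # at_all (ones \<eta>) r1 r2 ds) [r2] = [True])"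
  by (simp add: accept_prob_def Let_def coin_prob_def)

lemma values_local:
  assumes "\<forall>d\<in>set ds. bounded_delem d"
  shows "finitary (\<lambda>r1 r2. at_all w r1 r2 ds)"
proof -
  obtain q where "\<forall>d\<in>set ds. bounded_by q d" using bounded_common assms by blast
  then show ?thesis unfolding finitary_def
    by (intro exI[of _ "poly q (length w)"] allI impI bounded_values_eq) auto
qed

lemma accept_local:
  assumes "polytime (Suc (length ds)) 1 A" "\<forall>d\<in>set ds. bounded_delem d"
  shows "finitary (\<lambda>r1 r2. A (w # at_all w r1 r2 ds) [r2] = [True])"
proof -
  obtain q where "bounded_by q (\<lambda>w r1 r2. A (w # at_all w r1 r2 ds) [r2])"
    using bounded_apply assms by blast
  from finitary_map[OF bounded_by_local[OF this], of "\<lambda>x. x = [True]"] show ?thesis .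
qed

lemma disagree_local:
  assumes "bounded_delem d" "bounded_delem d'"
  shows "finitary (\<lambda>r1 r2. d w r1 r2 \<noteq> d' w r1 r2)"
proof -
  obtain q q' where "bounded_by q d" "bounded_by q' d'" using assms by blast
  from finitary_map2[OF this[THEN bounded_by_local], of "(\<noteq>)"] show ?thesis .
qed

lemma negligible_disagree_list:
  assumes "length ds = length ds'" "\<forall>d\<in>set ds. bounded_delem d" "\<forall>d\<in>set ds'. bounded_delem d"
    "\<forall>i<length ds. negligible (disagree (ds ! i) (ds' ! i))"
  shows "negligible (\<lambda>\<eta>. coin_prob (\<lambda>r1 r2. at_all (ones \<eta>) r1 r2 ds \<noteq> at_all (ones \<eta>) r1 r2 ds'))"
  using assms
proof (induction ds ds' rule: list_induct2)
  case Nil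
  then show ?case by (simp add: coin_prob_def negligible_zero)
next
  case (Cons d ds d' ds')
  let ?P = "\<lambda>\<eta> r1 r2. d (ones \<eta>) r1 r2 \<noteq> d' (ones \<eta>) r1 r2"
  let ?Q = "\<lambda>\<eta> r1 r2. at_all (ones \<eta>) r1 r2 ds \<noteq> at_all (ones \<eta>) r1 r2 ds'"
  have P: "finitary (?P \<eta>)" for \<eta> using disagree_local Cons.prems by auto
  have Q: "finitary (?Q \<eta>)" for \<eta>
    using finitary_map2[OF values_local values_local, of ds ds' "(\<noteq>)"] Cons.prems by auto
  have "negligible (disagree d d')" using Cons.prems(3) by force
  moreover have "negligible (\<lambda>\<eta>. coin_prob (?Q \<eta>))"
  proof (rule Cons.IH)
    show "\<forall>i<length ds. negligible (disagree (ds ! i) (ds' ! i))" using Cons.prems(3) by force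
  qed (use Cons.prems in auto)
  ultimately have "negligible (\<lambda>\<eta>. disagree d d' \<eta> + coin_prob (?Q \<eta>))"
    by (rule negligible_add)
  then show ?case
  proof (rule negligible_mono, intro always_eventually allI)
    fix \<eta>
    show "\<bar>coin_prob (\<lambda>r1 r2. at_all (ones \<eta>) r1 r2 (d # ds) \<noteq> at_all (ones \<eta>) r1 r2 (d' # ds'))\<bar>
      \<le> \<bar>disagree d d' \<eta> + coin_prob (?Q \<eta>)\<bar>"
      using prob_or_le[OF P Q, of \<eta>]
      by (simp add: disagree_def prob_nonneg del: map_eq_conv de_Morgan_conj) (simp add: prob_nonneg)
  qed
qed

lemma indist_refl: "indist ds ds"
  by (simp add: indist_def negligible_zero)

lemma indist_sym: "indist ds ds' \<Longrightarrow> indist ds' ds"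
  by (simp add: indist_def abs_minus_commute)

lemma indist_trans:
  assumes "indist ds ds'" "indist ds' ds''"
  shows "indist ds ds''"
  unfolding indist_def
proof (intro conjI allI impI)
  show "length ds = length ds''" using assms by (simp add: indist_def)
  fix A assume "polytime (Suc (length ds)) 1 A"
  then have "negligible (\<lambda>\<eta>. \<bar>accept_prob A ds \<eta> - accept_prob A ds' \<eta>\<bar>)"
    "negligible (\<lambda>\<eta>. \<bar>accept_prob A ds' \<eta> - accept_prob A ds'' \<eta>\<bar>)"
    using assms by (auto simp: indist_def)
  from negligible_add[OF this]
  show "negligible (\<lambda>\<eta>. \<bar>accept_prob A ds \<eta> - accept_prob A ds'' \<eta>\<bar>)"
    by (rule negligible_mono) (rule always_eventually, auto)
qed

lemma indist_if_agree:
  assumes "length ds = length ds'" "\<forall>d\<in>set ds. bounded_delem d" "\<forall>d\<in>set ds'. bounded_delem d"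
    "\<forall>i<length ds. negligible (disagree (ds ! i) (ds' ! i))"
  shows "indist ds ds'"
  unfolding indist_def
proof (intro conjI allI impI)
  fix A assume A: "polytime (Suc (length ds)) 1 A"
  let ?Q = "\<lambda>\<eta> r1 r2. at_all (ones \<eta>) r1 r2 ds \<noteq> at_all (ones \<eta>) r1 r2 ds'"
  have Q: "finitary (?Q \<eta>)" for \<eta>
    using finitary_map2[OF values_local values_local, of ds ds' "(\<noteq>)"] assms by auto
  show "negligible (\<lambda>\<eta>. \<bar>accept_prob A ds \<eta> - accept_prob A ds' \<eta>\<bar>)"
  proof (rule negligible_mono[OF negligible_disagree_list[OF assms]], intro always_eventually allI)
    fix \<eta>
    have "\<bar>accept_prob A ds \<eta> - accept_prob A ds' \<eta>\<bar> \<le> coin_prob (?Q \<eta>)"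
      unfolding accept_prob_eq
    proof (rule prob_diff_le[OF _ _ Q])
      show "finitary (\<lambda>r1 r2. A (ones \<eta> # at_all (ones \<eta>) r1 r2 ds) [r2] = [True])"
        "finitary (\<lambda>r1 r2. A (ones \<eta> # at_all (ones \<eta>) r1 r2 ds') [r2] = [True])"
        using A assms by (auto intro: accept_local)
    qed metis
    then show "\<bar>\<bar>accept_prob A ds \<eta> - accept_prob A ds' \<eta>\<bar>\<bar> \<le> \<bar>coin_prob (?Q \<eta>)\<bar>"
      by simp
  qed
qed fact

lemma polytime_is_true: "polytime 2 1 (\<lambda>xs rs. [xs ! 1 = [True]])"
  by (rule polytime_cong[OF _ polytime_reindex[where f = "\<lambda>i. min i 1" and n = 2 and m = 3,
        OF polytime_decide[where \<phi> = "\<lambda>a b. a"]]]) auto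

lemma indist_transfer:
  assumes "indist ds ds'" "polytime (Suc (length ds)) 1 B"
    "\<And>\<eta>. accept_prob A es \<eta> = accept_prob B ds \<eta>" "\<And>\<eta>. accept_prob A es' \<eta> = accept_prob B ds' \<eta>"
  shows "negligible (\<lambda>\<eta>. \<bar>accept_prob A es \<eta> - accept_prob A es' \<eta>\<bar>)"
  using assms by (simp add: indist_def)

lemma indist_reindex:
  assumes "indist ds ds'" "\<And>i. i < m \<Longrightarrow> g i < length ds"
  shows "indist (map (\<lambda>i. ds ! g i) [0..<m]) (map (\<lambda>i. ds' ! g i) [0..<m])"
  unfolding indist_def
proof (intro conjI allI impI)
  fix A assume A: "polytime (Suc (length (map (\<lambda>i. ds ! g i) [0..<m]))) 1 A"
  let ?f = "\<lambda>i. case i of 0 \<Rightarrow> 0 | Suc j \<Rightarrow> Suc (g j)"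
  let ?B = "\<lambda>xs rs. A (map (\<lambda>i. xs ! ?f i) [0..<Suc m]) rs"
  have len: "length ds' = length ds" using assms(1) by (simp add: indist_def)
  have eq: "map (\<lambda>i. (w # at_all w r1 r2 es) ! ?f i) [0..<Suc m] =
      w # at_all w r1 r2 (map (\<lambda>i. es ! g i) [0..<m])" if "length es = length ds" for es w r1 r2
    using assms(2) that by (intro nth_equalityI) (auto simp: nth_Cons' split: nat.splits simp del: upt_Suc)
  show "negligible (\<lambda>\<eta>. \<bar>accept_prob A (map (\<lambda>i. ds ! g i) [0..<m]) \<eta> -
      accept_prob A (map (\<lambda>i. ds' ! g i) [0..<m]) \<eta>\<bar>)"
  proof (rule indist_transfer[OF assms(1)])
    show "polytime (Suc (length ds)) 1 ?B"
      by (rule polytime_reindex) (use A assms(2) in \<open>auto split: nat.splits\<close>)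
  qed (simp_all only: accept_prob_eq eq len)
qed simp

definition applied :: "(bits list \<Rightarrow> rtape list \<Rightarrow> bits) \<Rightarrow> delem list \<Rightarrow> delem" where
  "applied F ds w r1 r2 = F (w # at_all w r1 r2 ds) [r2]"

lemma indist_apply:
  assumes "indist (xs @ ys) (xs' @ ys')" "length xs = length xs'" "polytime (Suc (length xs)) 1 F"
  shows "indist (applied F xs # ys) (applied F xs' # ys')"
  unfolding indist_def
proof (intro conjI allI impI)
  have len: "length ys' = length ys" using assms by (simp add: indist_def)
  then show "length (applied F xs # ys) = length (applied F xs' # ys')" by simp
  fix A assume A: "polytime (Suc (length (applied F xs # ys))) 1 A"
  let ?n = "Suc (length xs + length ys)"
  let ?f = "\<lambda>i. if i = 0 then 0 else if i = 1 then ?n else length xs + i - 1"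
  let ?B = "\<lambda>zs rs. A (map (\<lambda>i. if ?f i < ?n then zs ! ?f i
     else F (map (\<lambda>i. zs ! i) [0..<Suc (length xs)]) rs) [0..<Suc (Suc (length ys))]) rs"
  have inner: "map (\<lambda>i. (w # at_all w r1 r2 (us @ vs)) ! i) [0..<Suc (length xs)] = w # at_all w r1 r2 us"
    if "length us = length xs" for us vs w r1 r2
    using that by (intro nth_equalityI) (auto simp: nth_Cons' nth_append simp del: upt_Suc)
  have outer: "map (\<lambda>i. if ?f i < ?n then (w # at_all w r1 r2 (us @ vs)) ! ?f i else x)
      [0..<Suc (Suc (length ys))] = w # x # at_all w r1 r2 vs"
    if "length us = length xs" "length vs = length ys" for us vs w r1 r2 x
    using that by (intro nth_equalityI) (auto simp: nth_Cons' nth_append numeral_2_eq_2 simp del: upt_Suc)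
  have eq: "accept_prob A (applied F us # vs) \<eta> = accept_prob ?B (us @ vs) \<eta>"
    if "length us = length xs" "length vs = length ys" for us vs \<eta>
    unfolding accept_prob_eq inner[OF that(1)] outer[OF that] by (simp add: applied_def)
  show "negligible (\<lambda>\<eta>. \<bar>accept_prob A (applied F xs # ys) \<eta> - accept_prob A (applied F xs' # ys') \<eta>\<bar>)"
  proof (rule indist_transfer[OF assms(1)])
    have A': "polytime (Suc (Suc (length ys))) 1 A" using A by simp
    show "polytime (Suc (length (xs @ ys))) 1 ?B"
      unfolding length_append
      by (rule polytime_comp[where f = ?f and g = "\<lambda>i. i", OF A' assms(3)]) auto
  qed (intro eq; simp add: assms(2) len)+
qed

definition cond :: "delem \<Rightarrow> delem \<Rightarrow> delem \<Rightarrow> delem" where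
  "cond b x y w r1 r2 = (if b w r1 r2 = [True] then x w r1 r2 else y w r1 r2)"

lemma indist_case_split:
  assumes 1: "indist (b # cond b x z # us) (b' # cond b' x' z' # us')"
    and 2: "indist (b # cond b z y # us) (b' # cond b' z' y' # us')"
    and bd: "\<forall>d\<in>set (b # cond b x y # us). bounded_delem d"
      "\<forall>d\<in>set (b' # cond b' x' y' # us'). bounded_delem d"
  shows "indist (cond b x y # us) (cond b' x' y' # us')"
  unfolding indist_def
proof (intro conjI allI impI)
  have len: "length us' = length us" using 1 by (simp add: indist_def)
  then show "length (cond b x y # us) = length (cond b' x' y' # us')" by simp
  fix A assume A: "polytime (Suc (length (cond b x y # us))) 1 A"
  let ?n = "length us + 3"
  let ?f = "\<lambda>i. if i = 2 then ?n else i :: nat"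
  let ?g = "\<lambda>i. if i = 0 then 0 else Suc i :: nat"
  define B where "B \<phi> xs rs = [\<phi> (xs ! 1 = [True])
      (A (map (\<lambda>i. xs ! ?g i) [0..<length us + 2]) rs = [True])]" for \<phi> :: "bool \<Rightarrow> bool \<Rightarrow> bool" and xs rs
  have B: "polytime ?n 1 (B \<phi>)" for \<phi>
    by (rule polytime_cong[OF _ polytime_comp[where f = ?f and g = ?g and n = ?n and l = "length us + 2"
          and G = A, OF polytime_decide[where \<phi> = \<phi>]]])
       (use A in \<open>auto simp: B_def numeral_3_eq_3\<close>)
  have args: "map (\<lambda>i. (w # at_all w r1 r2 (c # v # vs)) ! ?g i) [0..<length us + 2] =
      w # at_all w r1 r2 (v # vs)" if "length vs = length us" for c v vs w r1 r2
    using that by (intro nth_equalityI) (auto simp: nth_Cons' simp del: upt_Suc)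
  have acc: "accept_prob (B \<phi>) (c # v # vs) \<eta> = coin_prob (\<lambda>r1 r2. \<phi> (c (ones \<eta>) r1 r2 = [True])
      (A (ones \<eta> # at_all (ones \<eta>) r1 r2 (v # vs)) [r2] = [True]))" if "length vs = length us" for \<phi> c v vs \<eta>
    unfolding accept_prob_eq B_def args[OF that] by simp
  have split: "accept_prob A (cond c u t # vs) \<eta> =
      accept_prob (B (\<lambda>a b. a \<and> b)) (c # cond c u s # vs) \<eta> +
      accept_prob (B (\<lambda>a b. \<not> a \<and> b)) (c # cond c s t # vs) \<eta>"
    if "\<forall>d\<in>set (c # cond c u t # vs). bounded_delem d" "length vs = length us" for c u s t vs \<eta>
  proof -
    let ?P = "\<lambda>r1 r2. A (ones \<eta> # at_all (ones \<eta>) r1 r2 (cond c u t # vs)) [r2] = [True]"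
    let ?Q = "\<lambda>r1 r2. c (ones \<eta>) r1 r2 = [True]"
    have "bounded_delem c" using that(1) by simp
    then obtain q where "bounded_by q c" ..
    from finitary_map[OF bounded_by_local[OF this], of "\<lambda>x. x = [True]"]
    have Q: "finitary ?Q" .
    have P: "finitary ?P" by (rule accept_local) (use A that in auto)
    have "accept_prob A (cond c u t # vs) \<eta> =
      coin_prob (\<lambda>r1 r2. ?P r1 r2 \<and> ?Q r1 r2) + coin_prob (\<lambda>r1 r2. ?P r1 r2 \<and> \<not> ?Q r1 r2)"
      unfolding accept_prob_eq by (rule prob_split[OF P Q])
    also have "(\<lambda>r1 r2. ?P r1 r2 \<and> ?Q r1 r2) = (\<lambda>r1 r2. ?Q r1 r2 \<and>
      A (ones \<eta> # at_all (ones \<eta>) r1 r2 (cond c u s # vs)) [r2] = [True])"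
      by (intro ext) (auto simp: cond_def)
    also have "(\<lambda>r1 r2. ?P r1 r2 \<and> \<not> ?Q r1 r2) = (\<lambda>r1 r2. \<not> ?Q r1 r2 \<and>
      A (ones \<eta> # at_all (ones \<eta>) r1 r2 (cond c s t # vs)) [r2] = [True])"
      by (intro ext) (auto simp: cond_def)
    finally show ?thesis by (simp only: acc[OF that(2)])
  qed
  have "negligible (\<lambda>\<eta>. \<bar>accept_prob (B (\<lambda>a b. a \<and> b)) (b # cond b x z # us) \<eta> -
        accept_prob (B (\<lambda>a b. a \<and> b)) (b' # cond b' x' z' # us') \<eta>\<bar>)"
    "negligible (\<lambda>\<eta>. \<bar>accept_prob (B (\<lambda>a b. \<not> a \<and> b)) (b # cond b z y # us) \<eta> -
        accept_prob (B (\<lambda>a b. \<not> a \<and> b)) (b' # cond b' z' y' # us') \<eta>\<bar>)"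
    using 1 2 B by (auto simp: indist_def eval_nat_numeral)
  from negligible_add[OF this]
  show "negligible (\<lambda>\<eta>. \<bar>accept_prob A (cond b x y # us) \<eta> - accept_prob A (cond b' x' y' # us') \<eta>\<bar>)"
    by (rule negligible_mono) (rule always_eventually, auto simp: split[where s = z, OF bd(1) refl] split[where s = z', OF bd(2) len])
qed

section \<open>Fresh names\<close>

lemma poly_le_power:
  fixes p :: "nat poly"
  shows "\<exists>k. \<forall>x\<ge>2. poly p x \<le> x ^ k"
proof (induction p)
  case 0
  then show ?case by auto
next
  case (pCons a p)
  then obtain k where k: "\<forall>x\<ge>2. poly p x \<le> x ^ k" by blast
  have "poly (pCons a p) x \<le> x ^ (a + k + 2)" if "x \<ge> 2" for x
  proof -
    have "a \<le> 2 ^ a" by (simp add: less_imp_le)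
    also have "\<dots> \<le> x ^ a" using that by (rule power_mono) simp
    also have "\<dots> \<le> x ^ (a + k + 1)" using that by (intro power_increasing) auto
    finally have 1: "a \<le> x ^ (a + k + 1)" .
    have "x * poly p x \<le> x ^ Suc k" using k that by simp
    also have "\<dots> \<le> x ^ (a + k + 1)" using that by (intro power_increasing) auto
    finally have "poly (pCons a p) x \<le> 2 * x ^ (a + k + 1)" unfolding poly_pCons using 1 by linarith
    also have "\<dots> \<le> x * x ^ (a + k + 1)" using that by (intro mult_le_mono1) simp
    finally show ?thesis by simp
  qed
  then show ?case by blast
qed

definition name_bits :: "('n, 'f, 'g) interp \<Rightarrow> 'n \<Rightarrow> nat \<Rightarrow> nat set" where
  "name_bits I n \<eta> = name_pos I n \<eta> ` {..<\<eta>}"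

definition avoids :: "('n, 'f, 'g) interp \<Rightarrow> 'n \<Rightarrow> delem \<Rightarrow> bool" where
  "avoids I n d \<longleftrightarrow> (\<forall>w r1 r1' r2. (\<forall>i. i \<notin> name_bits I n (length w) \<longrightarrow> r1 i = r1' i) \<longrightarrow>
     d w r1 r2 = d w r1' r2)"

lemma interpretation_names:
  assumes "interpretation_of \<Sigma> I"
  shows "in_domain SNonce (name_val I n)" "inj_on (name_pos I n \<eta>) {..<\<eta>}"
    "n \<noteq> n' \<Longrightarrow> name_bits I n \<eta> \<inter> name_bits I n' \<eta> = {}"
proof -
  have "\<forall>n. in_domain SNonce (name_val I n)"
    using assms unfolding interpretation_of_def by (elim conjE)
  then show "in_domain SNonce (name_val I n)" ..
  have "\<forall>\<eta> n. inj_on (name_pos I n \<eta>) {..<\<eta>}"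
    using assms unfolding interpretation_of_def by (elim conjE)
  then show "inj_on (name_pos I n \<eta>) {..<\<eta>}" by blast
  have "\<forall>\<eta> n n'. n \<noteq> n' \<longrightarrow> name_pos I n \<eta> ` {..<\<eta>} \<inter> name_pos I n' \<eta> ` {..<\<eta>} = {}"
    using assms unfolding interpretation_of_def by (elim conjE)
  then show "n \<noteq> n' \<Longrightarrow> name_bits I n \<eta> \<inter> name_bits I n' \<eta> = {}"
    unfolding name_bits_def by simp
qed

lemma ground_avoids:
  assumes I: "interpretation_of \<Sigma> I"
  shows "ground t \<Longrightarrow> n \<notin> names t \<Longrightarrow> avoids I n (sem I \<sigma> t)"
proof (induction t)
  case (Name m)
  then have "name_bits I m \<eta> \<inter> name_bits I n \<eta> = {}" for \<eta>
    using interpretation_names(3)[OF I, of m n] by simp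
  then show ?case by (fastforce simp: avoids_def name_val_def name_bits_def)
next
  case (App h ts)
  then have "avoids I n d" if "d \<in> set (map (sem I \<sigma>) ts)" for d using that by auto
  then show ?case unfolding sem_App avoids_def
    by (intro allI impI arg_cong2[of _ _ _ _ "sym_fun I h"] arg_cong2[of _ _ _ _ Cons] map_cong refl)
       blast
qed auto

lemma name_val_cong:
  "(\<And>i. i < length w \<Longrightarrow> r1 (name_pos I n (length w) i) = b i) \<Longrightarrow> name_val I n w r1 r2 = map b [0..<length w]"
  by (auto simp: name_val_def)

text \<open>Here \<open>Q v\<close> is an event about a value \<open>v\<close> substituted for the fresh name; it does not itself depend on
  the bits of that name.\<close>

lemma prob_flip_name:
  fixes Q :: "bits \<Rightarrow> rtape \<Rightarrow> rtape \<Rightarrow> bool"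
  assumes inj: "inj_on (name_pos I n (length w)) {..<length w}"
    and loc: "finitary (\<lambda>r1 r2. Q (name_val I n w r1 r2) r1 r2)"
    and inv: "\<And>v r1 r1' r2. \<forall>i. i \<notin> name_bits I n (length w) \<longrightarrow> r1 i = r1' i \<Longrightarrow> Q v r1 r2 = Q v r1' r2"
    and c: "length c = length w"
  shows "coin_prob (\<lambda>r1 r2. Q (map2 (\<noteq>) c (name_val I n w r1 r2)) r1 r2) =
    coin_prob (\<lambda>r1 r2. Q (name_val I n w r1 r2) r1 r2)"
proof -
  let ?pos = "name_pos I n (length w)"
  define s where "s x = (case x of Inl j \<Rightarrow> j \<in> name_bits I n (length w) \<and>
      c ! the_inv_into {..<length w} ?pos j | Inr j \<Rightarrow> False)" for x :: "nat + nat"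
  define T where "T r1 r2 j \<longleftrightarrow> case_sum r1 r2 (id j) \<noteq> s j" for r1 r2 :: rtape and j
  have val: "name_val I n w (\<lambda>i. T r1 r2 (Inl i)) r2' = map2 (\<noteq>) c (name_val I n w r1 r2)" for r1 r2 r2'
    using inj c by (intro nth_equalityI)
      (auto simp: name_val_def T_def s_def name_bits_def the_inv_into_f_f)
  have Q: "Q v (\<lambda>i. T r1 r2 (Inl i)) (\<lambda>i. T r1 r2 (Inr i)) = Q v r1 r2" for v r1 r2
  proof -
    have "(\<lambda>i. T r1 r2 (Inr i)) = r2" by (auto simp: T_def s_def)
    moreover have "Q v (\<lambda>i. T r1 r2 (Inl i)) r2 = Q v r1 r2" by (rule inv) (auto simp: T_def s_def)
    ultimately show ?thesis by simp
  qed
  show ?thesis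
    using prob_transform[OF inj_on_id loc, of s]
    unfolding T_def[symmetric] val Q .
qed

lemma prob_sample_name:
  fixes Q :: "bits \<Rightarrow> rtape \<Rightarrow> rtape \<Rightarrow> bool"
  assumes inj: "inj_on (name_pos I n (length w)) {..<length w}"
    and loc: "finitary (\<lambda>r1 r2. Q (name_val I n w r1 r2) r1 r2)"
    and inv1: "\<And>v r1 r1' r2. \<forall>i. i \<notin> name_bits I n (length w) \<longrightarrow> r1 i = r1' i \<Longrightarrow> Q v r1 r2 = Q v r1' r2"
    and inv2: "\<And>v r1 r2 r2'. length v = length w \<Longrightarrow> agree a r2 r2' \<Longrightarrow> Q v r1 r2 = Q v r1 r2'"
  shows "coin_prob (\<lambda>r1 r2. Q (map (\<lambda>i. r2 (a + i)) [0..<length w]) r1 r2) =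
    coin_prob (\<lambda>r1 r2. Q (name_val I n w r1 r2) r1 r2)"
proof -
  let ?pos = "name_pos I n (length w)" and ?inv = "the_inv_into {..<length w} (name_pos I n (length w))"
  define f where "f x = (case x of
      Inl j \<Rightarrow> if j \<in> name_bits I n (length w) then Inr (a + ?inv j) else Inl j
    | Inr j \<Rightarrow> if a \<le> j \<and> j < a + length w then Inl (?pos (j - a)) else Inr j)" for x :: "nat + nat"
  have inv_less: "?inv j < length w" if "j \<in> name_bits I n (length w)" for j
    using that inj by (auto simp: name_bits_def the_inv_into_f_f)
  have pos_inv: "?pos (?inv j) = j" if "j \<in> name_bits I n (length w)" for j
    using that inj by (auto simp: name_bits_def the_inv_into_f_f)
  have inv_pos: "?inv (?pos i) = i" if "i < length w" for i
    using that inj by (auto simp: the_inv_into_f_f)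
  have pos_bits: "?pos i \<in> name_bits I n (length w)" if "i < length w" for i
    using that by (simp add: name_bits_def)
  have "f (f x) = x" for x
    by (cases x) (auto simp: f_def inv_less pos_inv inv_pos pos_bits)
  then have f: "inj f" by (rule inj_on_inverseI)
  define T where "T r1 r2 j \<longleftrightarrow> case_sum r1 r2 (f j) \<noteq> False" for r1 r2 :: rtape and j
  have val: "name_val I n w (\<lambda>i. T r1 r2 (Inl i)) r2' = map (\<lambda>i. r2 (a + i)) [0..<length w]" for r1 r2 r2'
    by (rule name_val_cong) (auto simp: T_def f_def name_bits_def inv_pos)
  have Q: "Q (map (\<lambda>i. r2 (a + i)) [0..<length w]) (\<lambda>i. T r1 r2 (Inl i)) (\<lambda>i. T r1 r2 (Inr i)) =
    Q (map (\<lambda>i. r2 (a + i)) [0..<length w]) r1 r2" for r1 r2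
  proof -
    have "Q (map (\<lambda>i. r2 (a + i)) [0..<length w]) (\<lambda>i. T r1 r2 (Inl i)) (\<lambda>i. T r1 r2 (Inr i)) =
      Q (map (\<lambda>i. r2 (a + i)) [0..<length w]) r1 (\<lambda>i. T r1 r2 (Inr i))"
      by (rule inv1) (auto simp: T_def f_def)
    also have "\<dots> = Q (map (\<lambda>i. r2 (a + i)) [0..<length w]) r1 r2"
      by (rule inv2) (auto simp: T_def f_def agree_def)
    finally show ?thesis .
  qed
  show ?thesis
    using prob_transform[OF f loc, of "\<lambda>_. False"]
    unfolding T_def[symmetric] val Q .
qed

lemma finite_bits: "finite {c :: bits. length c = \<eta>}" "card {c :: bits. length c = \<eta>} = 2 ^ \<eta>"
  using finite_lists_length_eq[of "UNIV :: bool set" \<eta>] card_lists_length_eq[of "UNIV :: bool set" \<eta>]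
  by simp_all

lemma map2_neq_eq_iff: "length c = length v \<Longrightarrow> map2 (\<noteq>) c v = replicate (length v) False \<longleftrightarrow> v = c"
  by (induction c v rule: list_induct2) auto

context
  fixes \<Sigma> :: "('f, 'g) signature" and I :: "('n, 'f, 'g) interp"
  assumes interp: "interpretation_of \<Sigma> I"
begin

lemma name_val_bounded: "bounded_delem (name_val I n)"
  using in_domain_bounded interpretation_names(1)[OF interp] by blast

lemma length_name_val: "length (name_val I n w r1 r2) = length w"
  by (simp add: name_val_def)

lemma prob_name_val:
  assumes "length c = length w"
  shows "coin_prob (\<lambda>r1 r2. name_val I n w r1 r2 = c) = 1 / 2 ^ length w"
proof -
  obtain q where q: "bounded_by q (name_val I n)" using name_val_bounded by blast
  let ?z = "replicate (length w) False" and ?C = "{c :: bits. length c = length w}"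
  have loc: "finitary (\<lambda>r1 r2. name_val I n w r1 r2 = c)" for c
    by (rule finitary_map[OF bounded_by_local[OF q]])
  have eq: "coin_prob (\<lambda>r1 r2. name_val I n w r1 r2 = c) = coin_prob (\<lambda>r1 r2. name_val I n w r1 r2 = ?z)"
    if "length c = length w" for c
    using prob_flip_name[where Q = "\<lambda>v _ _. v = ?z", OF interpretation_names(2)[OF interp] loc refl that]
      map2_neq_eq_iff[of c "name_val I n w _ _"] that
    by (simp add: length_name_val)
  have "1 = (\<Sum>c\<in>?C. coin_prob (\<lambda>r1 r2. True \<and> name_val I n w r1 r2 = c))"
    unfolding prob_True[symmetric]
    by (rule prob_partition[OF finite_bits(1) finitary_const bounded_by_local[OF q]])
       (simp add: length_name_val)
  also have "\<dots> = (\<Sum>c\<in>?C. coin_prob (\<lambda>r1 r2. name_val I n w r1 r2 = ?z))"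
    unfolding simp_thms by (intro sum.cong refl eq) simp
  also have "\<dots> = 2 ^ length w * coin_prob (\<lambda>r1 r2. name_val I n w r1 r2 = ?z)"
    by (simp add: finite_bits)
  finally show ?thesis using eq[OF assms] by (simp add: field_simps)
qed

lemma prob_xor_name:
  fixes Q :: "bits \<Rightarrow> rtape \<Rightarrow> rtape \<Rightarrow> bool"
  assumes loc: "finitary (\<lambda>r1 r2. Q (name_val I n w r1 r2) r1 r2)"
    and loc': "finitary (\<lambda>r1 r2. Q (map2 (\<noteq>) (x w r1 r2) (name_val I n w r1 r2)) r1 r2)"
    and inv: "\<And>v r1 r1' r2. \<forall>i. i \<notin> name_bits I n (length w) \<longrightarrow> r1 i = r1' i \<Longrightarrow> Q v r1 r2 = Q v r1' r2"
    and x: "bounded_delem x" "avoids I n x" "\<And>r1 r2. length (x w r1 r2) = length w"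
  shows "coin_prob (\<lambda>r1 r2. Q (map2 (\<noteq>) (x w r1 r2) (name_val I n w r1 r2)) r1 r2) =
    coin_prob (\<lambda>r1 r2. Q (name_val I n w r1 r2) r1 r2)"
proof -
  obtain q where q: "bounded_by q x" using x(1) by blast
  let ?C = "{c :: bits. length c = length w}" and ?n = "name_val I n w"
  have part: "coin_prob P = (\<Sum>c\<in>?C. coin_prob (\<lambda>r1 r2. P r1 r2 \<and> x w r1 r2 = c))"
    if "finitary P" for P
    by (rule prob_partition[OF finite_bits(1) that bounded_by_local[OF q]]) (simp add: x(3))
  have "coin_prob (\<lambda>r1 r2. Q (map2 (\<noteq>) (x w r1 r2) (?n r1 r2)) r1 r2 \<and> x w r1 r2 = c) =
    coin_prob (\<lambda>r1 r2. Q (?n r1 r2) r1 r2 \<and> x w r1 r2 = c)" if c: "c \<in> ?C" for c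
  proof -
    have "coin_prob (\<lambda>r1 r2. Q (map2 (\<noteq>) (x w r1 r2) (?n r1 r2)) r1 r2 \<and> x w r1 r2 = c) =
      coin_prob (\<lambda>r1 r2. Q (map2 (\<noteq>) c (?n r1 r2)) r1 r2 \<and> x w r1 r2 = c)"
      by (intro arg_cong[of _ _ coin_prob] ext) auto
    also have "\<dots> = coin_prob (\<lambda>r1 r2. Q (?n r1 r2) r1 r2 \<and> x w r1 r2 = c)"
    proof (rule prob_flip_name[where Q = "\<lambda>v r1 r2. Q v r1 r2 \<and> x w r1 r2 = c", OF interpretation_names(2)[OF interp]])
      show "finitary (\<lambda>r1 r2. Q (?n r1 r2) r1 r2 \<and> x w r1 r2 = c)"
        by (rule finitary_connectives(1)[OF loc finitary_map[OF bounded_by_local[OF q]]])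
      fix v :: bits and r1 r1' r2 :: rtape
      assume *: "\<forall>i. i \<notin> name_bits I n (length w) \<longrightarrow> r1 i = r1' i"
      then have "x w r1 r2 = x w r1' r2" using x(2) unfolding avoids_def by blast
      then show "(Q v r1 r2 \<and> x w r1 r2 = c) = (Q v r1' r2 \<and> x w r1' r2 = c)"
        using inv[OF *] by simp
    qed (use c in simp)
    finally show ?thesis .
  qed
  then show ?thesis unfolding part[OF loc] part[OF loc'] by (intro sum.cong refl)
qed

lemma prob_name_val_eq_le:
  assumes x: "bounded_delem x" "avoids I n x"
  shows "coin_prob (\<lambda>r1 r2. name_val I n w r1 r2 = x w r1 r2) \<le> 1 / 2 ^ length w"
proof -
  let ?z = "replicate (length w) False" and ?n = "name_val I n w"
  define x' where "x' v r1 r2 = (if length (x v r1 r2) = length v then x v r1 r2 else replicate (length v) False)"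
    for v and r1 r2 :: rtape
  obtain q where q: "bounded_by q x" using x(1) by blast
  have "bounded_by (q + [:0, 1:]) x'"
    unfolding bounded_by_def
  proof (intro allI conjI impI)
    fix v :: bits and r1 r2 r1' r2' :: rtape
    show "length (x' v r1 r2) \<le> poly (q + [:0, 1:]) (length v)" by (simp add: x'_def)
    assume "agree (poly (q + [:0, 1:]) (length v)) r1 r1'" "agree (poly (q + [:0, 1:]) (length v)) r2 r2'"
    then have "agree (poly q (length v)) r1 r1'" "agree (poly q (length v)) r2 r2'"
      by (auto intro: agree_mono)
    then have "x v r1 r2 = x v r1' r2'" using q unfolding bounded_by_def by blast
    then show "x' v r1 r2 = x' v r1' r2'" by (simp add: x'_def)
  qed
  moreover have "avoids I n x'"
    unfolding avoids_def
  proof (intro allI impI)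
    fix v :: bits and r1 r1' r2 :: rtape
    assume "\<forall>i. i \<notin> name_bits I n (length v) \<longrightarrow> r1 i = r1' i"
    then have "x v r1 r2 = x v r1' r2" using x(2) unfolding avoids_def by blast
    then show "x' v r1 r2 = x' v r1' r2" by (simp add: x'_def)
  qed
  ultimately have x': "bounded_delem x'" "avoids I n x'" by blast+
  obtain q' p where q': "bounded_by q' (name_val I n)" and p: "bounded_by p x'"
    using name_val_bounded x'(1) by blast
  have loc: "finitary (\<lambda>r1 r2. map2 (\<noteq>) (x' w r1 r2) (?n r1 r2) = ?z)"
    using finitary_map2[OF p[THEN bounded_by_local] q'[THEN bounded_by_local], of "\<lambda>a b. map2 (\<noteq>) a b = ?z" w w] .
  have "coin_prob (\<lambda>r1 r2. ?n r1 r2 = x w r1 r2) \<le> coin_prob (\<lambda>r1 r2. map2 (\<noteq>) (x' w r1 r2) (?n r1 r2) = ?z)"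
  proof (rule prob_mono[OF loc])
    fix r1 r2 :: rtape assume "?n r1 r2 = x w r1 r2"
    then have "length (x' w r1 r2) = length (?n r1 r2)" "?n r1 r2 = x' w r1 r2"
      using length_name_val[of n w r1 r2] by (simp_all add: x'_def)
    then show "map2 (\<noteq>) (x' w r1 r2) (?n r1 r2) = ?z"
      using map2_neq_eq_iff[of "x' w r1 r2" "?n r1 r2"] unfolding length_name_val by blast
  qed
  also have "\<dots> = coin_prob (\<lambda>r1 r2. ?n r1 r2 = ?z)"
    by (rule prob_xor_name[where Q = "\<lambda>v _ _. v = ?z", OF _ loc _ x'])
      (use finitary_map[OF bounded_by_local[OF q'], of "\<lambda>v. v = ?z" w] in \<open>simp_all add: x'_def\<close>)
  finally show ?thesis by (simp add: prob_name_val)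
qed

text \<open>The distinguisher replaces the fresh name by bits of its own random tape that lie beyond
  everything the other terms and the distinguisher itself can read.\<close>

definition sampling :: "nat \<Rightarrow> (bits list \<Rightarrow> rtape list \<Rightarrow> bits) \<Rightarrow> bits list \<Rightarrow> rtape list \<Rightarrow> bits" where
  "sampling k A xs rs =
     A (xs @ [map (\<lambda>i. (rs ! 0) (length (xs ! 0) ^ Suc k + i)) [0..<length (xs ! 0)]]) rs"

lemma polytime_sampling:
  assumes "polytime (Suc (Suc m)) 1 A"
  shows "polytime (Suc m) 1 (sampling k A)"
proof (rule polytime_cong[OF _ polytime_comp[where f = "\<lambda>i. i" and g = "\<lambda>i. i" and n = "Suc m",
      OF assms polytime_sample[of k]]])
  fix xs :: "bits list" and rs :: "rtape list"
  assume len: "length xs = Suc m"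
  let ?y = "map (\<lambda>i. (rs ! 0) (length (map (\<lambda>i. xs ! i) [0..<1] ! 0) ^ Suc k + i))
    [0..<length (map (\<lambda>i. xs ! i) [0..<1] ! 0)]"
  have "map (\<lambda>i. if i < Suc m then xs ! i else y) [0..<Suc (Suc m)] = xs @ [y]" for y
    using len by (intro nth_equalityI) (auto simp: nth_append simp del: upt_Suc)
  then show "A (map (\<lambda>i. if i < Suc m then xs ! i else ?y) [0..<Suc (Suc m)]) rs = sampling k A xs rs"
    by (simp only: sampling_def) simp
qed auto

lemma accept_prob_sampling:
  assumes A: "polytime (Suc (Suc (length ds))) 1 A"
    and ds: "\<forall>d\<in>set ds. bounded_delem d" "\<forall>d\<in>set ds. avoids I n d"
  shows "\<exists>k0. \<forall>k\<ge>k0. \<forall>\<eta>\<ge>2. accept_prob A (ds @ [name_val I n]) \<eta> = accept_prob (sampling k A) ds \<eta>"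
proof -
  obtain q where q: "\<And>d. d \<in> set ds \<Longrightarrow> bounded_by q d" using bounded_common ds(1) by blast
  obtain p where p: "\<And>xs rs rs'. length xs = Suc (Suc (length ds)) \<Longrightarrow> length rs = 1 \<Longrightarrow> length rs' = 1 \<Longrightarrow>
       \<forall>j<1. \<forall>i<poly p (total_length xs). (rs ! j) i = (rs' ! j) i \<Longrightarrow> A xs rs = A xs rs'"
    by (rule polytime_bounded[OF A]) blast
  define R where "R = q + pcompose p ([:0, 2:] + smult (length ds) q)"
  obtain k0 where k0: "\<And>x. x \<ge> 2 \<Longrightarrow> poly R x \<le> x ^ k0" using poly_le_power[of R] by blast
  have "accept_prob A (ds @ [name_val I n]) \<eta> = accept_prob (sampling k A) ds \<eta>"
    if k: "k0 \<le> k" and \<eta>: "2 \<le> \<eta>" for k \<eta>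
  proof -
    let ?w = "ones \<eta>" and ?a = "\<eta> ^ Suc k"
    let ?Q = "\<lambda>v r1 r2. A (?w # at_all ?w r1 r2 ds @ [v]) [r2] = [True]"
    have "\<eta> ^ k0 \<le> ?a" using k \<eta> by (intro power_increasing) auto
    then have R: "poly R \<eta> \<le> ?a" using k0[OF \<eta>] by simp
    have "coin_prob (\<lambda>r1 r2. ?Q (map (\<lambda>i. r2 (?a + i)) [0..<length ?w]) r1 r2) =
      coin_prob (\<lambda>r1 r2. ?Q (name_val I n ?w r1 r2) r1 r2)"
    proof (rule prob_sample_name[OF interpretation_names(2)[OF interp]])
      have bd: "\<forall>d\<in>set (ds @ [name_val I n]). bounded_delem d"
        using ds(1) name_val_bounded by auto
      show "finitary (\<lambda>r1 r2. ?Q (name_val I n ?w r1 r2) r1 r2)"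
        using accept_local[OF _ bd, of A ?w] A by simp
    next
      fix v :: bits and r1 r1' r2 :: rtape
      assume *: "\<forall>i. i \<notin> name_bits I n (length ?w) \<longrightarrow> r1 i = r1' i"
      have "at_all ?w r1 r2 ds = at_all ?w r1' r2 ds"
        using ds(2) * unfolding avoids_def by (intro map_cong refl) blast
      then show "?Q v r1 r2 = ?Q v r1' r2" by (simp only:)
    next
      fix v :: bits and r1 r2 r2' :: rtape
      assume v: "length v = length ?w" and agr: "agree ?a r2 r2'"
      have "agree (poly q \<eta>) r2 r2'"
        by (rule agree_mono[OF agr]) (use R in \<open>simp add: R_def\<close>)
      then have 1: "at_all ?w r1 r2 ds = at_all ?w r1 r2' ds"
        by (intro bounded_values_eq[OF q]) (auto simp: agree_def)
      have "(total_length (?w # at_all ?w r1 r2 ds @ [v])) \<le> 2 * \<eta> + length ds * poly q \<eta>"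
        using bounded_values_length[of ds q ?w r1 r2, OF q] v by simp
      then have "poly p (total_length (?w # at_all ?w r1 r2 ds @ [v])) \<le> poly p (2 * \<eta> + length ds * poly q \<eta>)"
        by (rule poly_mono_nat)
      also have "\<dots> \<le> poly R \<eta>" by (simp add: R_def poly_pcompose mult.commute)
      also note R
      finally have "A (?w # at_all ?w r1 r2 ds @ [v]) [r2] = A (?w # at_all ?w r1 r2 ds @ [v]) [r2']"
        by (intro p) (use agr in \<open>auto simp: agree_def\<close>)
      then show "?Q v r1 r2 = ?Q v r1 r2'" unfolding 1 by simp
    qed
    then show ?thesis unfolding accept_prob_eq sampling_def by simp
  qed
  then show ?thesis by blast
qed

lemma indist_fresh_names:
  assumes "indist ds ds'"
    and ds: "\<forall>d\<in>set ds. bounded_delem d" "\<forall>d\<in>set ds. avoids I n d"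
    and ds': "\<forall>d\<in>set ds'. bounded_delem d" "\<forall>d\<in>set ds'. avoids I n' d"
  shows "indist (ds @ [name_val I n]) (ds' @ [name_val I n'])"
  unfolding indist_def
proof (intro conjI allI impI)
  have len: "length ds' = length ds" using assms(1) by (simp add: indist_def)
  then show "length (ds @ [name_val I n]) = length (ds' @ [name_val I n'])" by simp
  fix A assume "polytime (Suc (length (ds @ [name_val I n]))) 1 A"
  then have A: "polytime (Suc (Suc (length ds))) 1 A" "polytime (Suc (Suc (length ds'))) 1 A"
    using len by simp_all
  obtain k1 where k1: "\<And>k \<eta>. k \<ge> k1 \<Longrightarrow> \<eta> \<ge> 2 \<Longrightarrow>
      accept_prob A (ds @ [name_val I n]) \<eta> = accept_prob (sampling k A) ds \<eta>"
    using accept_prob_sampling[OF A(1) ds] by blast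
  obtain k2 where k2: "\<And>k \<eta>. k \<ge> k2 \<Longrightarrow> \<eta> \<ge> 2 \<Longrightarrow>
      accept_prob A (ds' @ [name_val I n']) \<eta> = accept_prob (sampling k A) ds' \<eta>"
    using accept_prob_sampling[OF A(2) ds'] by blast
  let ?B = "sampling (max k1 k2) A"
  have "negligible (\<lambda>\<eta>. \<bar>accept_prob ?B ds \<eta> - accept_prob ?B ds' \<eta>\<bar>)"
    using assms(1) polytime_sampling[OF A(1)] by (simp add: indist_def)
  then show "negligible (\<lambda>\<eta>. \<bar>accept_prob A (ds @ [name_val I n]) \<eta> - accept_prob A (ds' @ [name_val I n']) \<eta>\<bar>)"
  proof (rule negligible_mono)
    show "\<forall>\<^sub>F \<eta> in sequentially. \<bar>\<bar>accept_prob A (ds @ [name_val I n]) \<eta> - accept_prob A (ds' @ [name_val I n']) \<eta>\<bar>\<bar>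
        \<le> \<bar>\<bar>accept_prob ?B ds \<eta> - accept_prob ?B ds' \<eta>\<bar>\<bar>"
      using eventually_ge_at_top[of 2] by eventually_elim (simp add: k1[of "max k1 k2"] k2[of "max k1 k2"])
  qed
qed

lemma accept_prob_xor_name:
  assumes A: "polytime (Suc (Suc (length ds))) 1 A"
    and ds: "\<forall>d\<in>set ds. bounded_delem d" "\<forall>d\<in>set ds. avoids I n d"
    and x: "bounded_delem x" "avoids I n x" "\<And>w r1 r2. length (x w r1 r2) = length w"
    and xn: "bounded_delem xn" "\<And>w r1 r2. xn w r1 r2 = map2 (\<noteq>) (x w r1 r2) (name_val I n w r1 r2)"
  shows "accept_prob A (ds @ [xn]) \<eta> = accept_prob A (ds @ [name_val I n]) \<eta>"
proof -
  let ?w = "ones \<eta>"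
  let ?Q = "\<lambda>v r1 r2. A (?w # at_all ?w r1 r2 ds @ [v]) [r2] = [True]"
  have "coin_prob (\<lambda>r1 r2. ?Q (map2 (\<noteq>) (x ?w r1 r2) (name_val I n ?w r1 r2)) r1 r2) =
    coin_prob (\<lambda>r1 r2. ?Q (name_val I n ?w r1 r2) r1 r2)"
  proof (rule prob_xor_name[OF _ _ _ x])
    have bd: "\<forall>d\<in>set (ds @ [name_val I n]). bounded_delem d" "\<forall>d\<in>set (ds @ [xn]). bounded_delem d"
      using ds(1) name_val_bounded xn(1) by auto
    show "finitary (\<lambda>r1 r2. ?Q (name_val I n ?w r1 r2) r1 r2)"
      "finitary (\<lambda>r1 r2. ?Q (map2 (\<noteq>) (x ?w r1 r2) (name_val I n ?w r1 r2)) r1 r2)"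
      using accept_local[OF _ bd(1), of A ?w] accept_local[OF _ bd(2), of A ?w] A
      by (simp_all add: xn(2))
  next
    fix v :: bits and r1 r1' r2 :: rtape
    assume *: "\<forall>i. i \<notin> name_bits I n (length ?w) \<longrightarrow> r1 i = r1' i"
    have "at_all ?w r1 r2 ds = at_all ?w r1' r2 ds"
      using ds(2) * unfolding avoids_def by (intro map_cong refl) blast
    then show "?Q v r1 r2 = ?Q v r1' r2" by (simp only:)
  qed
  then show ?thesis unfolding accept_prob_eq by (simp add: xn(2))
qed

end

section \<open>Validity of the axioms\<close>

abbreviation sorted_trm :: "('f, 'g) signature \<Rightarrow> ('n, 'f, 'g) trm \<Rightarrow> bool" where
  "sorted_trm \<Sigma> t \<equiv> \<exists>s. has_sort \<Sigma> t s"

lemma has_sort_App: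
  "has_sort \<Sigma> (App h ts) s \<Longrightarrow>
    \<exists>ss s'. sym_type \<Sigma> h = (ss, s') \<and> length ts = length ss \<and> (\<forall>i<length ss. has_sort \<Sigma> (ts ! i) (ss ! i))"
  by (induction "App h ts" s rule: has_sort.induct) auto

lemma sorted_App_args: "has_sort \<Sigma> (App h ts) s \<Longrightarrow> t \<in> set ts \<Longrightarrow> sorted_trm \<Sigma> t"
  using has_sort_App[of \<Sigma> h ts s] by (auto simp: in_set_conv_nth)

lemma has_sort_xort: "has_sort \<Sigma> (xort x y) s \<Longrightarrow> has_sort \<Sigma> x SNonce \<and> has_sort \<Sigma> y SNonce"
  using has_sort_App[of \<Sigma> "Hon Xor" "[x, y]" s] by (force simp: less_Suc_eq)

lemma wf_Eq: "wf_fm \<Sigma> (Eq x y) \<Longrightarrow> sorted_trm \<Sigma> (eqt x y) \<and> sorted_trm \<Sigma> x \<and> sorted_trm \<Sigma> y"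
  by (auto simp: Eq_def intro: sorted_App_args)

lemma wf_Indist:
  "wf_fm \<Sigma> (Indist us vs) \<Longrightarrow>
    length us = length vs \<and> (\<forall>u\<in>set us. sorted_trm \<Sigma> u) \<and> (\<forall>v\<in>set vs. sorted_trm \<Sigma> v)"
  by (fastforce simp: list_all2_conv_all_nth in_set_conv_nth)

lemma wf_Imps: "wf_fm \<Sigma> (Imps \<phi>s \<psi>) \<longleftrightarrow> (\<forall>\<phi>\<in>set \<phi>s. wf_fm \<Sigma> \<phi>) \<and> wf_fm \<Sigma> \<psi>"
  unfolding Imps_def by (induction \<phi>s) auto

lemma sat_Imps: "sat I \<sigma> (Imps \<phi>s \<psi>) \<longleftrightarrow> ((\<forall>\<phi>\<in>set \<phi>s. sat I \<sigma> \<phi>) \<longrightarrow> sat I \<sigma> \<psi>)"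
  unfolding Imps_def by (induction \<phi>s) auto

lemma ball_map2_Eq:
  "length xs = length ys \<Longrightarrow> (\<forall>\<phi>\<in>set (map2 Eq xs ys). P \<phi>) \<longleftrightarrow> (\<forall>i<length xs. P (Eq (xs ! i) (ys ! i)))"
  by (auto simp: set_zip)

lemma sem_Name: "sem I \<sigma> (Name n) = name_val I n"
  by (simp add: fun_eq_iff)

lemma sem_subst_cong:
  "sem I \<sigma> x w r1 r2 = sem I \<sigma> y w r1 r2 \<Longrightarrow>
    sem I \<sigma> (subst t s k x) w r1 r2 = sem I \<sigma> (subst t s k y) w r1 r2"
proof (induction t)
  case (App h ts)
  then have "map (\<lambda>t. sem I \<sigma> t w r1 r2) (map (\<lambda>t. subst t s k x) ts) =
      map (\<lambda>t. sem I \<sigma> t w r1 r2) (map (\<lambda>t. subst t s k y) ts)"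
    by simp
  then show ?case by (cases h) (simp_all only: subst.simps sem.simps)
qed auto

lemma sem_App_cong:
  "map (\<lambda>d. d w r1 r2) (map (sem I \<sigma>) ts) = map (\<lambda>d. d w r1 r2) (map (sem I \<sigma>) ts') \<Longrightarrow>
    sem I \<sigma> (App h ts) w r1 r2 = sem I \<sigma> (App h ts') w r1 r2"
  unfolding sem_App by simp

lemma disagree_commute: "disagree d d' = disagree d' d"
  by (simp add: disagree_def fun_eq_iff eq_commute)

context
  fixes \<Sigma> :: "('f, 'g) signature" and I :: "('n, 'f, 'g) interp" and \<sigma> :: valuation
  assumes interp: "interpretation_of \<Sigma> I" and val: "valuation_ok \<sigma>"
begin

abbreviation sem' ("\<S>") where
  "\<S> \<equiv> sem I \<sigma>"

lemma sem_bounded: "sorted_trm \<Sigma> t \<Longrightarrow> bounded_delem (\<S> t)"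
  using sem_sorted[OF interp val] by blast

lemma sem_nonce_length: "has_sort \<Sigma> t SNonce \<Longrightarrow> length (\<S> t w r1 r2) = length w"
  using sem_sorted[OF interp val, of t SNonce] by simp

lemma sem_prescribed:
  "\<S> truet = (\<lambda>_ _ _. [True])"
  "\<S> falset = (\<lambda>_ _ _. [False])"
  "\<S> zerot = (\<lambda>w _ _. replicate (length w) False)"
  "\<S> (eqt x y) = (\<lambda>w r1 r2. [\<S> x w r1 r2 = \<S> y w r1 r2])"
  "\<S> (ite s b x y) = cond (\<S> b) (\<S> x) (\<S> y)"
  "has_sort \<Sigma> x SNonce \<Longrightarrow> has_sort \<Sigma> y SNonce \<Longrightarrow>
     \<S> (xort x y) = (\<lambda>w r1 r2. map2 (\<noteq>) (\<S> x w r1 r2) (\<S> y w r1 r2))"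
proof -
  have "\<forall>w. hon_fun I TrueS [w] = [True]"
    using interp unfolding interpretation_of_def by (elim conjE)
  then show "\<S> truet = (\<lambda>_ _ _. [True])" by (simp add: fun_eq_iff)
  have "\<forall>w. hon_fun I FalseS [w] = [False]"
    using interp unfolding interpretation_of_def by (elim conjE)
  then show "\<S> falset = (\<lambda>_ _ _. [False])" by (simp add: fun_eq_iff)
  have "\<forall>w. hon_fun I Zero [w] = replicate (length w) False"
    using interp unfolding interpretation_of_def by (elim conjE)
  then show "\<S> zerot = (\<lambda>w _ _. replicate (length w) False)" by (simp add: fun_eq_iff)
  have "\<forall>w x y. hon_fun I Equal [w, x, y] = [x = y]"
    using interp unfolding interpretation_of_def by (elim conjE)
  then show "\<S> (eqt x y) = (\<lambda>w r1 r2. [\<S> x w r1 r2 = \<S> y w r1 r2])"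
    by (simp add: fun_eq_iff)
  have "\<forall>w s b x y. hon_fun I (Ite s) [w, b, x, y] = (if b = [True] then x else y)"
    using interp unfolding interpretation_of_def by (elim conjE)
  then show "\<S> (ite s b x y) = cond (\<S> b) (\<S> x) (\<S> y)"
    by (simp add: fun_eq_iff cond_def)
  have "\<forall>w x y. length x = length w \<and> length y = length w \<longrightarrow> hon_fun I Xor [w, x, y] = map2 (\<noteq>) x y"
    using interp unfolding interpretation_of_def by (elim conjE)
  then show "has_sort \<Sigma> x SNonce \<Longrightarrow> has_sort \<Sigma> y SNonce \<Longrightarrow>
     \<S> (xort x y) = (\<lambda>w r1 r2. map2 (\<noteq>) (\<S> x w r1 r2) (\<S> y w r1 r2))"
    by (simp add: fun_eq_iff sem_nonce_length)
qed

lemma sat_Eq_pointwise: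
  assumes "\<S> x = \<S> y"
  shows "sat I \<sigma> (Eq x y)"
proof -
  have "\<S> (eqt x y) = \<S> truet"
    unfolding sem_prescribed assms by simp
  then show ?thesis unfolding Eq_def sat.simps by (simp only: list.map indist_refl)
qed

lemma sat_Eq_iff:
  assumes "wf_fm \<Sigma> (Eq x y)"
  shows "sat I \<sigma> (Eq x y) \<longleftrightarrow> negligible (disagree (\<S> x) (\<S> y))"
proof
  let ?E = "\<S> (eqt x y)" and ?T = "\<S> truet"
  note wf = wf_Eq[OF assms]
  {
    assume "sat I \<sigma> (Eq x y)"
    then have "negligible (\<lambda>\<eta>. \<bar>accept_prob (\<lambda>xs rs. [xs ! 1 = [True]]) [?E] \<eta> -
        accept_prob (\<lambda>xs rs. [xs ! 1 = [True]]) [?T] \<eta>\<bar>)"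
      using polytime_is_true by (simp add: Eq_def indist_def numeral_2_eq_2)
    moreover have "accept_prob (\<lambda>xs rs. [xs ! 1 = [True]]) [?E] \<eta> = 1 - disagree (\<S> x) (\<S> y) \<eta>" for \<eta>
      using prob_not[OF disagree_local[OF sem_bounded sem_bounded], of x y "ones \<eta>"] wf
      unfolding accept_prob_eq disagree_def sem_prescribed by simp
    moreover have "accept_prob (\<lambda>xs rs. [xs ! 1 = [True]]) [?T] \<eta> = 1" for \<eta>
      unfolding accept_prob_eq sem_prescribed by (simp add: prob_True)
    ultimately show "negligible (disagree (\<S> x) (\<S> y))"
      by (simp add: negligible_def)
  }
  assume "negligible (disagree (\<S> x) (\<S> y))"
  moreover have "disagree ?E ?T = disagree (\<S> x) (\<S> y)"
    unfolding sem_prescribed disagree_def by simp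
  ultimately have "indist [?E] [?T]"
    using sem_bounded[of "eqt x y"] sem_bounded[of "truet"] wf assms
    by (intro indist_if_agree) (auto simp: Eq_def)
  then show "sat I \<sigma> (Eq x y)" by (simp add: Eq_def)
qed

lemma sat_EqTrans:
  assumes wf: "wf_fm \<Sigma> (Eq x y)" "wf_fm \<Sigma> (Eq y z)" "wf_fm \<Sigma> (Eq x z)"
    and "sat I \<sigma> (Eq x y)" "sat I \<sigma> (Eq y z)"
  shows "sat I \<sigma> (Eq x z)"
proof -
  let ?x = "\<S> x" and ?y = "\<S> y" and ?z = "\<S> z"
  have xy: "finitary (\<lambda>r1 r2. ?x w r1 r2 \<noteq> ?y w r1 r2)" and
    yz: "finitary (\<lambda>r1 r2. ?y w r1 r2 \<noteq> ?z w r1 r2)" for w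
    using wf_Eq[OF wf(1)] wf_Eq[OF wf(2)] by (intro disagree_local sem_bounded; blast)+
  have "disagree ?x ?z \<eta> \<le> disagree ?x ?y \<eta> + disagree ?y ?z \<eta>" for \<eta>
  proof -
    have "disagree ?x ?z \<eta> \<le>
        coin_prob (\<lambda>r1 r2. ?x (ones \<eta>) r1 r2 \<noteq> ?y (ones \<eta>) r1 r2 \<or> ?y (ones \<eta>) r1 r2 \<noteq> ?z (ones \<eta>) r1 r2)"
      unfolding disagree_def by (rule prob_mono[OF finitary_connectives(2)[OF xy yz]]) auto
    also have "\<dots> \<le> disagree ?x ?y \<eta> + disagree ?y ?z \<eta>"
      unfolding disagree_def by (rule prob_or_le[OF xy yz])
    finally show ?thesis .
  qed
  moreover have nonneg: "0 \<le> disagree d d' \<eta>" for d d' \<eta> by (simp add: disagree_def prob_nonneg)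
  ultimately have le: "\<bar>disagree ?x ?z \<eta>\<bar> \<le> \<bar>disagree ?x ?y \<eta> + disagree ?y ?z \<eta>\<bar>" for \<eta>
    by (simp add: add_nonneg_nonneg)
  have "negligible (disagree ?x ?y)" "negligible (disagree ?y ?z)"
    using assms(4,5) sat_Eq_iff[OF wf(1)] sat_Eq_iff[OF wf(2)] by simp_all
  then have "negligible (disagree ?x ?z)"
    by (rule negligible_mono[OF negligible_add]) (rule always_eventually, rule allI, rule le)
  then show ?thesis using sat_Eq_iff[OF wf(3)] by simp
qed

lemma Eqs_bounded:
  assumes "length xs = length ys" "\<forall>i<length xs. wf_fm \<Sigma> (Eq (xs ! i) (ys ! i))"
  shows "\<forall>d\<in>set (map (\<S>) xs). bounded_delem d" "\<forall>d\<in>set (map (\<S>) ys). bounded_delem d"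
proof -
  have "bounded_delem (\<S> (xs ! i)) \<and> bounded_delem (\<S> (ys ! i))" if i: "i < length xs" for i
  proof -
    have "sorted_trm \<Sigma> (xs ! i)" "sorted_trm \<Sigma> (ys ! i)"
      using wf_Eq assms(2) i by blast+
    then show ?thesis using sem_bounded by blast
  qed
  then show "\<forall>d\<in>set (map (\<S>) xs). bounded_delem d" "\<forall>d\<in>set (map (\<S>) ys). bounded_delem d"
    using assms(1) unfolding all_set_conv_all_nth by simp_all
qed

lemma sat_CongrFun:
  assumes len: "length xs = length ys" and wf: "\<forall>i<length xs. wf_fm \<Sigma> (Eq (xs ! i) (ys ! i))"
    "wf_fm \<Sigma> (Eq (App h xs) (App h ys))" and "\<forall>i<length xs. sat I \<sigma> (Eq (xs ! i) (ys ! i))"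
  shows "sat I \<sigma> (Eq (App h xs) (App h ys))"
proof -
  let ?xs = "map (\<S>) xs" and ?ys = "map (\<S>) ys"
  let ?d = "disagree (\<S> (App h xs)) (\<S> (App h ys))"
  let ?ne = "\<lambda>\<eta> r1 r2. at_all (ones \<eta>) r1 r2 ?xs \<noteq> at_all (ones \<eta>) r1 r2 ?ys"
  note bd = Eqs_bounded[OF len wf(1)]
  have "negligible (\<lambda>\<eta>. coin_prob (?ne \<eta>))"
    using assms(4) sat_Eq_iff wf(1) len by (intro negligible_disagree_list bd) auto
  then have "negligible (?d)"
  proof (rule negligible_mono, intro always_eventually allI)
    fix \<eta>
    have "finitary (?ne \<eta>)"
      using finitary_map2[OF values_local[OF bd(1)] values_local[OF bd(2)], of "(\<noteq>)"] .
    then have "?d \<eta> \<le>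
        coin_prob (?ne \<eta>)"
      unfolding disagree_def by (rule prob_mono) (metis sem_App_cong)
    then show "\<bar>?d \<eta>\<bar> \<le>
        \<bar>coin_prob (?ne \<eta>)\<bar>"
      using prob_nonneg[of "\<lambda>r1 r2. \<S> (App h xs) (ones \<eta>) r1 r2 \<noteq> \<S> (App h ys) (ones \<eta>) r1 r2"]
      unfolding disagree_def by linarith
  qed
  then show ?thesis using sat_Eq_iff[OF wf(2)] by simp
qed

lemma indist_if_sat_Eq:
  assumes "length us = length us'" "\<forall>i<length us. wf_fm \<Sigma> (Eq (us ! i) (us' ! i))"
    "\<forall>i<length us. sat I \<sigma> (Eq (us ! i) (us' ! i))"
  shows "indist (map (\<S>) us) (map (\<S>) us')"
proof (rule indist_if_agree)
  show "\<forall>d\<in>set (map (\<S>) us). bounded_delem d" "\<forall>d\<in>set (map (\<S>) us'). bounded_delem d"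
    by (rule Eqs_bounded[OF assms(1,2)])+
qed (use assms sat_Eq_iff in auto)

lemma sat_Indep:
  assumes fresh: "\<forall>t\<in>set (us @ vs @ [x, y]). ground t \<and> n \<notin> names t"
    and wf: "wf_fm \<Sigma> (Indist us vs)" "wf_fm \<Sigma> (Indist (us @ [xort x (Name n)]) (vs @ [xort y (Name n)]))"
    and "sat I \<sigma> (Indist us vs)"
  shows "sat I \<sigma> (Indist (us @ [xort x (Name n)]) (vs @ [xort y (Name n)]))"
proof -
  let ?us = "map (\<S>) us" and ?vs = "map (\<S>) vs"
  let ?xn = "\<S> (xort x (Name n))" and ?yn = "\<S> (xort y (Name n))"
  have bd: "\<forall>d\<in>set ?us. bounded_delem d" "\<forall>d\<in>set ?vs. bounded_delem d"
    using wf_Indist[OF wf(1)] sem_bounded by auto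
  have av: "\<forall>d\<in>set ?us. avoids I n d" "\<forall>d\<in>set ?vs. avoids I n d"
    "avoids I n (\<S> x)" "avoids I n (\<S> y)"
    using fresh ground_avoids[OF interp] by auto
  have xn: "sorted_trm \<Sigma> (xort x (Name n))" "sorted_trm \<Sigma> (xort y (Name n))"
    using wf_Indist[OF wf(2)] by auto
  then have xy: "has_sort \<Sigma> x SNonce" "has_sort \<Sigma> y SNonce" "has_sort \<Sigma> (Name n) SNonce"
    using has_sort_xort by blast+
  have len: "length vs = length us" using wf_Indist[OF wf(1)] by simp
  have "indist (?us @ [name_val I n]) (?vs @ [name_val I n])"
    using assms(4) by (intro indist_fresh_names[OF interp] bd av) simp
  moreover have "accept_prob A (?us @ [?xn]) \<eta> = accept_prob A (?us @ [name_val I n]) \<eta>"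
    "accept_prob A (?vs @ [?yn]) \<eta> = accept_prob A (?vs @ [name_val I n]) \<eta>"
    if A: "polytime (Suc (Suc (length us))) 1 A" for A \<eta>
  proof -
    have b: "bounded_delem (\<S> x)" "bounded_delem (\<S> y)" "bounded_delem ?xn" "bounded_delem ?yn"
      using xy xn by (blast intro: sem_bounded)+
    have eq: "?xn w r1 r2 = map2 (\<noteq>) (\<S> x w r1 r2) (name_val I n w r1 r2)"
      "?yn w r1 r2 = map2 (\<noteq>) (\<S> y w r1 r2) (name_val I n w r1 r2)" for w r1 r2
      by (simp_all only: sem_prescribed(6)[OF xy(1,3)] sem_prescribed(6)[OF xy(2,3)] sem_Name)
    show "accept_prob A (?us @ [?xn]) \<eta> = accept_prob A (?us @ [name_val I n]) \<eta>"
      by (rule accept_prob_xor_name[OF interp _ bd(1) av(1) b(1) av(3) sem_nonce_length[OF xy(1)] b(3) eq(1)])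
        (use A in simp)
    show "accept_prob A (?vs @ [?yn]) \<eta> = accept_prob A (?vs @ [name_val I n]) \<eta>"
      by (rule accept_prob_xor_name[OF interp _ bd(2) av(2) b(2) av(4) sem_nonce_length[OF xy(2)] b(4) eq(2)])
        (use A len in simp)
  qed
  ultimately have "indist (?us @ [?xn]) (?vs @ [?yn])"
    using len unfolding indist_def by simp
  then show ?thesis by simp
qed

lemma sat_EqIndep:
  assumes "ground x" "n \<notin> names x" and wf: "wf_fm \<Sigma> (Eq (eqt (Name n) x) falset)"
  shows "sat I \<sigma> (Eq (eqt (Name n) x) falset)"
proof -
  have "sorted_trm \<Sigma> x" using wf_Eq[OF wf] by (auto intro: sorted_App_args)
  then have x: "bounded_delem (\<S> x)" "avoids I n (\<S> x)"
    using sem_bounded ground_avoids[OF interp] assms by auto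
  have "disagree (\<S> (eqt (Name n) x)) (\<S> falset) \<eta> =
      coin_prob (\<lambda>r1 r2. name_val I n (ones \<eta>) r1 r2 = \<S> x (ones \<eta>) r1 r2)" for \<eta>
    unfolding disagree_def sem_prescribed sem_Name by simp
  then have "negligible (disagree (\<S> (eqt (Name n) x)) (\<S> falset))"
    using prob_name_val_eq_le[OF interp x, of "ones _"]
    by (intro negligible_mono[OF negligible_inverse_power2] always_eventually allI) (simp add: prob_nonneg)
  then show ?thesis using sat_Eq_iff[OF wf] by simp
qed

lemma sat_FA:
  assumes "length xs = length xs'" "wf_fm \<Sigma> (Indist (App h xs # ys) (App h xs' # ys'))"
    "sat I \<sigma> (Indist (xs @ ys) (xs' @ ys'))"
  shows "sat I \<sigma> (Indist (App h xs # ys) (App h xs' # ys'))"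
proof -
  have "sorted_trm \<Sigma> (App h xs)" using wf_Indist[OF assms(2)] by simp
  then obtain ss s where "sym_type \<Sigma> h = (ss, s)" "length xs = length ss"
    using has_sort_App by blast
  then have "polytime (Suc (length xs)) 1 (sym_fun I h)"
    using interpretation_sym(1)[OF interp] by simp
  then have "indist (applied (sym_fun I h) (map (\<S>) xs) # map (\<S>) ys)
      (applied (sym_fun I h) (map (\<S>) xs') # map (\<S>) ys')"
    using assms(1,3) by (intro indist_apply) simp_all
  moreover have "applied (sym_fun I h) (map (\<S>) us) = \<S> (App h us)" for us
    unfolding sem_App by (simp add: fun_eq_iff applied_def)
  ultimately show ?thesis by simp
qed

lemma axiom_sat:
  assumes "axiom \<phi>" "wf_fm \<Sigma> \<phi>"
  shows "sat I \<sigma> \<phi>"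
  using assms
proof (induction rule: axiom.induct)
  case (Dup us t vs t')
  let ?g = "\<lambda>i. min i (length us)"
  have eq: "map (\<lambda>i. (map (\<S>) (ws @ [u])) ! ?g i) [0..<length us + 2] = map (\<S>) (ws @ [u, u])"
    if "length ws = length us" for ws u
    using that by (intro nth_equalityI) (auto simp: nth_append nth_Cons' min_def simp del: upt_Suc)
  have len: "length vs = length us" using wf_Indist[of \<Sigma> "us @ [t]" "vs @ [t']"] Dup by simp
  show ?case
    using indist_reindex[of "map (\<S>) (us @ [t])" "map (\<S>) (vs @ [t'])" "length us + 2" ?g]
    unfolding eq[OF refl] eq[OF len] by simp
next
  case (Perm \<pi> xs ys)
  have eq: "map (\<lambda>i. (map (\<S>) zs) ! \<pi> i) [0..<length xs] = map (\<S>) (permute_list \<pi> zs)"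
    if "length zs = length xs" for zs
    using that permutes_in_image[OF Perm(1)] by (auto simp: permute_list_def)
  show ?case
    using indist_reindex[of "map (\<S>) xs" "map (\<S>) ys" "length xs" \<pi>]
      permutes_in_image[OF Perm(1)]
    unfolding eq[OF refl] eq[OF Perm(2)] by simp
next
  case (CongrFun xs ys h)
  then show ?case
    using sat_CongrFun[of xs ys h] unfolding wf_Imps sat_Imps ball_map2_Eq[OF CongrFun(1)] by blast
next
  case (CongrIndist us us' vs vs')
  have wf: "\<forall>i<length us. wf_fm \<Sigma> (Eq (us ! i) (us' ! i))" "\<forall>i<length vs. wf_fm \<Sigma> (Eq (vs ! i) (vs' ! i))"
    using CongrIndist(3) unfolding wf_Imps set_append ball_Un ball_map2_Eq[OF CongrIndist(1)]
      ball_map2_Eq[OF CongrIndist(2)] by blast+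
  show ?case unfolding sat_Imps set_append ball_Un ball_map2_Eq[OF CongrIndist(1)] ball_map2_Eq[OF CongrIndist(2)]
  proof (intro impI, elim conjE)
    assume "\<forall>i<length us. sat I \<sigma> (Eq (us ! i) (us' ! i))" "\<forall>i<length vs. sat I \<sigma> (Eq (vs ! i) (vs' ! i))"
    then have "indist (map (\<S>) us) (map (\<S>) us')" "indist (map (\<S>) vs) (map (\<S>) vs')"
      using indist_if_sat_Eq CongrIndist(1,2) wf by blast+
    then show "sat I \<sigma> (Imp (Indist us vs) (Indist us' vs'))"
      using indist_sym indist_trans unfolding sat.simps by blast
  qed
next
  case (Indep us vs x y n)
  then show ?case using sat_Indep[of us vs x y n] by simp
next
  case (FreshNonce us n us' n')
  then have "sat I \<sigma> (Indist us us') \<Longrightarrow> indist (map (\<S>) us @ [name_val I n]) (map (\<S>) us' @ [name_val I n'])"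
    using wf_Indist[of \<Sigma> us us'] sem_bounded ground_avoids[OF interp]
    by (intro indist_fresh_names[OF interp]) auto
  then show ?case by (simp add: sem_Name del: sem.simps)
next
  case (FA xs xs' ys ys' h)
  then show ?case using sat_FA[of xs xs' h ys ys'] by simp
next
  case (IfThen s1 x y t s k z ws xs' s2)
  have "\<S> (ite s1 (eqt x y) (subst t s k x) z) = \<S> (ite s2 (eqt x y) (subst t s k y) z)"
    unfolding sem_prescribed using sem_subst_cong[of I \<sigma> x _ _ _ y t s k] by (auto simp: cond_def fun_eq_iff)
  then show ?case by (simp del: sem.simps)
next
  case (CS b s1 x z us b' s2 x' z' us' s3 y s4 y' s5 s6)
  have "\<forall>u\<in>set (b # ite s5 b x y # us). sorted_trm \<Sigma> u" "\<forall>u\<in>set (b' # ite s6 b' x' y' # us'). sorted_trm \<Sigma> u"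
    using wf_Indist[of \<Sigma> "b # ite s1 b x z # us" "b' # ite s2 b' x' z' # us'"]
      wf_Indist[of \<Sigma> "ite s5 b x y # us" "ite s6 b' x' y' # us'"] CS by auto
  then have bd: "\<forall>d\<in>set (map (\<S>) (b # ite s5 b x y # us)). bounded_delem d"
    "\<forall>d\<in>set (map (\<S>) (b' # ite s6 b' x' y' # us')). bounded_delem d"
    using sem_bounded by auto
  show ?case
    using indist_case_split[OF _ _ bd[unfolded list.map sem_prescribed]]
    by (simp add: sem_prescribed del: sem.simps)
next
  case (Sym us vs)
  then show ?case by (simp add: indist_sym)
next
  case (Trans us vs ws)
  then show ?case by (auto intro: indist_trans)
next
  case (EqSym x y)
  then show ?case using disagree_commute sat_Eq_iff by (metis sat.simps(3) wf_fm.simps(3))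
next
  case (EqTrans x y z)
  then show ?case using sat_EqTrans[of x y z] by simp
next
  case (EqIndep x n)
  then show ?case by (rule sat_EqIndep)
next
  case (XorComm x y)
  then have "has_sort \<Sigma> x SNonce" "has_sort \<Sigma> y SNonce" using wf_Eq has_sort_xort by blast+
  then show ?case
    by (intro sat_Eq_pointwise ext nth_equalityI) (auto simp: sem_prescribed sem_nonce_length simp del: sem.simps)
next
  case (XorSelf x)
  then have "has_sort \<Sigma> x SNonce" using wf_Eq has_sort_xort by blast
  then show ?case
    by (intro sat_Eq_pointwise ext nth_equalityI) (auto simp: sem_prescribed sem_nonce_length simp del: sem.simps)
next
  case (XorZero x)
  then have "has_sort \<Sigma> x SNonce" "has_sort \<Sigma> (zerot :: ('n, 'f, 'g) trm) SNonce" using wf_Eq has_sort_xort by blast+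
  then show ?case
    by (intro sat_Eq_pointwise ext nth_equalityI) (auto simp: sem_prescribed sem_nonce_length simp del: sem.simps)
next
  case (XorAssoc x y z)
  then have "has_sort \<Sigma> x SNonce" "has_sort \<Sigma> y SNonce" "has_sort \<Sigma> z SNonce"
    "has_sort \<Sigma> (xort x y) SNonce" "has_sort \<Sigma> (xort y z) SNonce"
    using wf_Eq has_sort_xort by blast+
  then show ?case
    by (intro sat_Eq_pointwise ext nth_equalityI) (auto simp: sem_prescribed sem_nonce_length simp del: sem.simps)
next
  case (IfApp h xs s1 b y z ws s2)
  have "\<S> (App h (xs @ [ite s1 b y z] @ ws)) w r1 r2 =
      \<S> (ite s2 b (App h (xs @ [y] @ ws)) (App h (xs @ [z] @ ws))) w r1 r2" for w r1 r2
  proof (cases "\<S> b w r1 r2 = [True]")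
    case True
    have "\<S> (App h (xs @ [ite s1 b y z] @ ws)) w r1 r2 = \<S> (App h (xs @ [y] @ ws)) w r1 r2"
      by (rule sem_App_cong) (simp add: sem_prescribed cond_def True del: sem.simps)
    then show ?thesis by (simp only: sem_prescribed cond_def True simp_thms if_True)
  next
    case False
    have "\<S> (App h (xs @ [ite s1 b y z] @ ws)) w r1 r2 = \<S> (App h (xs @ [z] @ ws)) w r1 r2"
      by (rule sem_App_cong) (simp add: sem_prescribed cond_def False del: sem.simps)
    then show ?thesis by (simp only: sem_prescribed cond_def False if_False)
  qed
  then show ?case by (intro sat_Eq_pointwise ext)
next
  case (Refl us)
  show ?case by (simp add: indist_refl)
qed (rule sat_Eq_pointwise, simp add: sem_prescribed cond_def fun_eq_iff del: sem.simps)+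

end

theorem proposition1:
  fixes \<Sigma> :: "('f, 'g) signature"
    and \<phi> :: "('n, 'f, 'g) fm"
  assumes "axiom \<phi>"
    and "wf_fm \<Sigma> \<phi>"
  shows "comp_valid \<Sigma> \<phi>"
  using axiom_sat assms unfolding comp_valid_def by blast

end
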